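(* Let $G=\mathbb{Z}_8\rtimes \mathrm{Aut}(\mathbb{Z}_8)$ (with the natural action of $\mathrm{Aut}(\mathbb{Z}_8)$ on $\mathbb{Z}_8$), and let $C^{*}(G)$ be its group algebra, regarded as a finite-dimensional Hopf $*$-algebra. Then the unitary invariant second cohomology group $H^{2}_{uinv}(C^{*}(G),S^{1})$ is isomorphic to $\mathbb{Z}_2$, the cyclic group of order $2$.
   Context: The group $G$ has order $32$ and is generated by $s,t,u$ subject to $s^2=t^2=u^8=1$, $st=ts$, $sus^{-1}=u^3$, $tut^{-1}=u^5$. The group algebra $C^{*}(G)=\mathbb{C}[G]$ has coproduct $\Delta(g)=g\otimes g$ and involution $g^{*}=g^{-1}$ for $g\in G$. For a finite-dimensional Hopf $*$-algebra $(\mathcal{Q},\Delta)$: a (left) 2-cocycle is an invertible element $\Omega\in\mathcal{Q}\otimes\mathcal{Q}$ such that $(1\otimes\Omega)(\mathrm{id}\otimes\Delta)(\Omega)=(\Omega\otimes 1)(\Delta\otimes\mathrm{id})(\Omega)$. It is called invariant if it commutes with $\Delta(a)$ for every $a\in\mathcal{Q}$, and unitary if it is a unitary element of $\mathcal{Q}\otimes\mathcal{Q}$. Let $A^{1}_{u}(\mathcal{Q})$ be the group of central unitary elements of $\mathcal{Q}$ and let $A^{2}_{u}(\mathcal{Q})$ be the set of invariant unitary 2-cocycles, which is a group under multiplication in $\mathcal{Q}\otimes\mathcal{Q}$. The map $\delta:A^{1}_{u}(\mathcal{Q})\to A^{2}_{u}(\mathcal{Q})$, $\delta(v)=(v\otimes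 v)\Delta(v^{-1})$, is a group homomorphism whose image is a central subgroup. Define $H^{2}_{uinv}(\mathcal{Q},S^{1})=A^{2}_{u}(\mathcal{Q})/\delta(A^{1}_{u}(\mathcal{Q}))$. *)

theory Defs
  imports Complex_Main "HOL-Algebra.Algebra"
begin

section \<open>Finite-dimensional *-algebras given by a basis\<close>

text \<open>
  A finite-dimensional complex algebra is presented by a finite linear basis
  and structure constants. Its elements are the coefficient functions
  supported on the basis. A field such as \<open>basis_mult A a b\<close> is the coefficient
  function of the product of the basis vectors a and b. This presentation makes tensor
  products available: the tensor product has the product of the two bases as its basis.
\<close>

record 'b star_alg =
  basis :: "'b set"
  basis_mult :: "'b \<Rightarrow> 'b \<Rightarrow> 'b \<Rightarrow> complex"
  alg_unit :: "'b \<Rightarrow> complex"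
  basis_star :: "'b \<Rightarrow> 'b \<Rightarrow> complex"

definition elements :: "('b, 'm) star_alg_scheme \<Rightarrow> ('b \<Rightarrow> complex) set" where
  "elements A = {x. \<forall>b. b \<notin> basis A \<longrightarrow> x b = 0}"

definition bvec :: "'b \<Rightarrow> 'b \<Rightarrow> complex" where
  "bvec b = (\<lambda>c. of_bool (c = b))"

definition lin_ext ::
  "('b, 'm) star_alg_scheme \<Rightarrow> ('b \<Rightarrow> 'c \<Rightarrow> complex) \<Rightarrow> ('b \<Rightarrow> complex) \<Rightarrow> 'c \<Rightarrow> complex" where
  "lin_ext A f x = (\<lambda>c. \<Sum>b\<in>basis A. x b * f b c)"

definition alg_mult ::
  "('b, 'm) star_alg_scheme \<Rightarrow> ('b \<Rightarrow> complex) \<Rightarrow> ('b \<Rightarrow> complex) \<Rightarrow> 'b \<Rightarrow> complex" where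
  "alg_mult A x y = (\<lambda>c. \<Sum>a\<in>basis A. \<Sum>b\<in>basis A. x a * y b * basis_mult A a b c)"

definition alg_star :: "('b, 'm) star_alg_scheme \<Rightarrow> ('b \<Rightarrow> complex) \<Rightarrow> 'b \<Rightarrow> complex" where
  "alg_star A x = (\<lambda>c. \<Sum>b\<in>basis A. cnj (x b) * basis_star A b c)"

definition mult_monoid :: "('b, 'm) star_alg_scheme \<Rightarrow> ('b \<Rightarrow> complex) monoid" where
  "mult_monoid A = \<lparr>carrier = elements A, monoid.mult = alg_mult A, one = alg_unit A\<rparr>"

definition alg_unitary :: "('b, 'm) star_alg_scheme \<Rightarrow> ('b \<Rightarrow> complex) \<Rightarrow> bool" where
  "alg_unitary A x \<longleftrightarrow> x \<in> elements A \<and>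
     alg_mult A (alg_star A x) x = alg_unit A \<and> alg_mult A x (alg_star A x) = alg_unit A"

definition alg_central :: "('b, 'm) star_alg_scheme \<Rightarrow> ('b \<Rightarrow> complex) \<Rightarrow> bool" where
  "alg_central A x \<longleftrightarrow> x \<in> elements A \<and>
     (\<forall>y \<in> elements A. alg_mult A x y = alg_mult A y x)"

definition tens :: "('b \<Rightarrow> complex) \<Rightarrow> ('c \<Rightarrow> complex) \<Rightarrow> 'b \<times> 'c \<Rightarrow> complex" where
  "tens x y = (\<lambda>(b, c). x b * y c)"

definition tensor_alg ::
  "('b, 'm) star_alg_scheme \<Rightarrow> ('c, 'n) star_alg_scheme \<Rightarrow> ('b \<times> 'c) star_alg" where
  "tensor_alg A B = \<lparr>
     basis = basis A \<times> basis B,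
     basis_mult = (\<lambda>(a, b) (a', b'). tens (basis_mult A a a') (basis_mult B b b')),
     alg_unit = tens (alg_unit A) (alg_unit B),
     basis_star = (\<lambda>(a, b). tens (basis_star A a) (basis_star B b))\<rparr>"

text \<open>The identification of (X \<open>\<otimes>\<close> Y) \<open>\<otimes>\<close> Z with X \<open>\<otimes>\<close> (Y \<open>\<otimes>\<close> Z).\<close>

definition tens_assoc :: "(('a \<times> 'b) \<times> 'c \<Rightarrow> complex) \<Rightarrow> 'a \<times> 'b \<times> 'c \<Rightarrow> complex" where
  "tens_assoc x = (\<lambda>(a, b, c). x ((a, b), c))"


section \<open>Finite-dimensional Hopf *-algebras\<close>

record 'b hopf = "'b star_alg" +
  basis_coprod :: "'b \<Rightarrow> 'b \<times> 'b \<Rightarrow> complex"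
  basis_counit :: "'b \<Rightarrow> complex"
  basis_antipode :: "'b \<Rightarrow> 'b \<Rightarrow> complex"

abbreviation tensor2 :: "('b, 'm) hopf_scheme \<Rightarrow> ('b \<times> 'b) star_alg" where
  "tensor2 Q \<equiv> tensor_alg Q Q"

abbreviation tensor3 :: "('b, 'm) hopf_scheme \<Rightarrow> ('b \<times> 'b \<times> 'b) star_alg" where
  "tensor3 Q \<equiv> tensor_alg Q (tensor_alg Q Q)"

definition coprod :: "('b, 'm) hopf_scheme \<Rightarrow> ('b \<Rightarrow> complex) \<Rightarrow> 'b \<times> 'b \<Rightarrow> complex" where
  "coprod Q = lin_ext Q (basis_coprod Q)"

definition id_coprod ::
  "('b, 'm) hopf_scheme \<Rightarrow> ('b \<times> 'b \<Rightarrow> complex) \<Rightarrow> 'b \<times> 'b \<times> 'b \<Rightarrow> complex" where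
  "id_coprod Q = lin_ext (tensor2 Q) (\<lambda>(a, b). tens (bvec a) (basis_coprod Q b))"

definition coprod_id ::
  "('b, 'm) hopf_scheme \<Rightarrow> ('b \<times> 'b \<Rightarrow> complex) \<Rightarrow> 'b \<times> 'b \<times> 'b \<Rightarrow> complex" where
  "coprod_id Q = lin_ext (tensor2 Q) (\<lambda>(a, b). tens_assoc (tens (basis_coprod Q a) (bvec b)))"

text \<open>By (anti)linearity it is enough to require the axioms on basis vectors.\<close>

definition star_algebra :: "('b, 'm) star_alg_scheme \<Rightarrow> bool" where
  "star_algebra A \<longleftrightarrow>
     finite (basis A) \<and>
     alg_unit A \<in> elements A \<and>
     (\<forall>a \<in> basis A. \<forall>b \<in> basis A. basis_mult A a b \<in> elements A) \<and>
     (\<forall>a \<in> basis A. basis_star A a \<in> elements A) \<and>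
     (\<forall>a \<in> basis A. \<forall>b \<in> basis A. \<forall>c \<in> basis A.
        alg_mult A (basis_mult A a b) (bvec c) = alg_mult A (bvec a) (basis_mult A b c)) \<and>
     (\<forall>a \<in> basis A. alg_mult A (alg_unit A) (bvec a) = bvec a \<and>
        alg_mult A (bvec a) (alg_unit A) = bvec a) \<and>
     (\<forall>a \<in> basis A. alg_star A (basis_star A a) = bvec a) \<and>
     (\<forall>a \<in> basis A. \<forall>b \<in> basis A.
        alg_star A (basis_mult A a b) = alg_mult A (basis_star A b) (basis_star A a))"

definition hopf_star_algebra :: "('b, 'm) hopf_scheme \<Rightarrow> bool" where
  "hopf_star_algebra Q \<longleftrightarrow>
     star_algebra Q \<and>
     (\<forall>a \<in> basis Q. basis_coprod Q a \<in> elements (tensor2 Q)) \<and>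
     (\<forall>a \<in> basis Q. basis_antipode Q a \<in> elements Q) \<and>
     \<comment> \<open>the coproduct is a unital *-homomorphism and coassociative\<close>
     (\<forall>a \<in> basis Q. \<forall>b \<in> basis Q.
        coprod Q (basis_mult Q a b) = alg_mult (tensor2 Q) (basis_coprod Q a) (basis_coprod Q b)) \<and>
     coprod Q (alg_unit Q) = alg_unit (tensor2 Q) \<and>
     (\<forall>a \<in> basis Q. coprod Q (basis_star Q a) = alg_star (tensor2 Q) (basis_coprod Q a)) \<and>
     (\<forall>a \<in> basis Q. id_coprod Q (basis_coprod Q a) = coprod_id Q (basis_coprod Q a)) \<and>
     \<comment> \<open>the counit is a unital homomorphism and satisfies the counit law\<close>
     (\<forall>a \<in> basis Q. \<forall>b \<in> basis Q.
        (\<Sum>c \<in> basis Q. basis_mult Q a b c * basis_counit Q c) =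
          basis_counit Q a * basis_counit Q b) \<and>
     (\<Sum>c \<in> basis Q. alg_unit Q c * basis_counit Q c) = 1 \<and>
     (\<forall>a \<in> basis Q.
        lin_ext (tensor2 Q) (\<lambda>(b, c) d. basis_counit Q b * bvec c d) (basis_coprod Q a) = bvec a \<and>
        lin_ext (tensor2 Q) (\<lambda>(b, c) d. bvec b d * basis_counit Q c) (basis_coprod Q a) = bvec a) \<and>
     \<comment> \<open>the antipode law\<close>
     (\<forall>a \<in> basis Q.
        lin_ext (tensor2 Q) (\<lambda>(b, c). alg_mult Q (basis_antipode Q b) (bvec c)) (basis_coprod Q a)
          = (\<lambda>d. basis_counit Q a * alg_unit Q d) \<and>
        lin_ext (tensor2 Q) (\<lambda>(b, c). alg_mult Q (bvec b) (basis_antipode Q c)) (basis_coprod Q a)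
          = (\<lambda>d. basis_counit Q a * alg_unit Q d))"


section \<open>Unitary invariant second cohomology\<close>

definition two_cocycle :: "('b, 'm) hopf_scheme \<Rightarrow> ('b \<times> 'b \<Rightarrow> complex) \<Rightarrow> bool" where
  "two_cocycle Q \<Omega> \<longleftrightarrow>
     \<Omega> \<in> Units (mult_monoid (tensor2 Q)) \<and>
     alg_mult (tensor3 Q) (tens (alg_unit Q) \<Omega>) (id_coprod Q \<Omega>) =
     alg_mult (tensor3 Q) (tens_assoc (tens \<Omega> (alg_unit Q))) (coprod_id Q \<Omega>)"

definition invariant :: "('b, 'm) hopf_scheme \<Rightarrow> ('b \<times> 'b \<Rightarrow> complex) \<Rightarrow> bool" where
  "invariant Q \<Omega> \<longleftrightarrow>
     (\<forall>a \<in> elements Q. alg_mult (tensor2 Q) \<Omega> (coprod Q a) = alg_mult (tensor2 Q) (coprod Q a) \<Omega>)"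

definition A1u :: "('b, 'm) hopf_scheme \<Rightarrow> ('b \<Rightarrow> complex) set" where
  "A1u Q = {v. alg_central Q v \<and> alg_unitary Q v}"

definition A2u :: "('b, 'm) hopf_scheme \<Rightarrow> ('b \<times> 'b \<Rightarrow> complex) monoid" where
  "A2u Q = mult_monoid (tensor2 Q)
     \<lparr>carrier := {\<Omega>. two_cocycle Q \<Omega> \<and> invariant Q \<Omega> \<and> alg_unitary (tensor2 Q) \<Omega>}\<rparr>"

definition coboundary :: "('b, 'm) hopf_scheme \<Rightarrow> ('b \<Rightarrow> complex) \<Rightarrow> 'b \<times> 'b \<Rightarrow> complex" where
  "coboundary Q v = alg_mult (tensor2 Q) (tens v v) (coprod Q (inv\<^bsub>mult_monoid Q\<^esub> v))"

definition H2_uinv :: "('b, 'm) hopf_scheme \<Rightarrow> ('b \<times> 'b \<Rightarrow> complex) set monoid" where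
  "H2_uinv Q = A2u Q Mod (coboundary Q ` A1u Q)"


section \<open>The group algebra as a Hopf *-algebra\<close>

definition group_algebra :: "('g, 'm) monoid_scheme \<Rightarrow> 'g hopf" where
  "group_algebra G = \<lparr>
     basis = carrier G,
     basis_mult = (\<lambda>g h. bvec (g \<otimes>\<^bsub>G\<^esub> h)),
     alg_unit = bvec \<one>\<^bsub>G\<^esub>,
     basis_star = (\<lambda>g. bvec (inv\<^bsub>G\<^esub> g)),
     basis_coprod = (\<lambda>g. tens (bvec g) (bvec g)),
     basis_counit = (\<lambda>g. 1),
     basis_antipode = (\<lambda>g. bvec (inv\<^bsub>G\<^esub> g))\<rparr>"

lemma tens_bvec: "tens (bvec a) (bvec b) = bvec (a, b)"
  by (auto simp: tens_def bvec_def fun_eq_iff)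

lemma tens_assoc_bvec: "tens_assoc (bvec ((a, b), c)) = bvec (a, b, c)"
  by (auto simp: tens_assoc_def bvec_def fun_eq_iff)

lemma bvec_in_elements: "b \<in> basis A \<Longrightarrow> bvec b \<in> elements A"
  by (auto simp: elements_def bvec_def)

lemma sum_bvec:
  assumes "finite S" "a \<in> S"
  shows "(\<Sum>b\<in>S. bvec a b * f b) = f a"
proof -
  have "(\<Sum>b\<in>S. bvec a b * f b) = (\<Sum>b\<in>S. if b = a then f b else 0)"
    by (rule sum.cong) (auto simp: bvec_def)
  then show ?thesis using assms by simp
qed

lemma lin_ext_bvec:
  assumes "finite (basis A)" "a \<in> basis A"
  shows "lin_ext A f (bvec a) = f a"
  using assms by (simp add: lin_ext_def sum_bvec)

lemma alg_star_bvec: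
  assumes "finite (basis A)" "a \<in> basis A"
  shows "alg_star A (bvec a) = basis_star A a"
proof -
  have "cnj (bvec a b) = bvec a b" for b by (simp add: bvec_def)
  with assms show ?thesis by (simp add: alg_star_def sum_bvec)
qed

lemma alg_mult_bvec:
  assumes "finite (basis A)" "a \<in> basis A" "b \<in> basis A"
  shows "alg_mult A (bvec a) (bvec b) = basis_mult A a b"
  using assms by (simp add: alg_mult_def sum_bvec mult.assoc flip: sum_distrib_left)

theorem hopf_star_algebra_group_algebra:
  assumes "group G" "finite (carrier G)"
  shows "hopf_star_algebra (group_algebra G)"
proof -
  interpret group G by fact
  let ?Q = "group_algebra G"
  have fin: "finite (basis ?Q)" "finite (basis (tensor2 ?Q))"
    using assms(2) by (auto simp: group_algebra_def tensor_alg_def)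
  have b: "basis ?Q = carrier G" "basis (tensor2 ?Q) = carrier G \<times> carrier G"
    by (auto simp: group_algebra_def tensor_alg_def)
  have m: "basis_mult ?Q g h = bvec (g \<otimes>\<^bsub>G\<^esub> h)" "alg_unit ?Q = bvec \<one>\<^bsub>G\<^esub>"
    "basis_star ?Q g = bvec (inv\<^bsub>G\<^esub> g)" "basis_coprod ?Q g = bvec (g, g)"
    "basis_counit ?Q g = 1" "basis_antipode ?Q g = bvec (inv\<^bsub>G\<^esub> g)" for g h
    by (auto simp: group_algebra_def tens_bvec)
  have t: "basis_mult (tensor2 ?Q) (g, g') (h, h') = bvec (g \<otimes>\<^bsub>G\<^esub> h, g' \<otimes>\<^bsub>G\<^esub> h')"
    "alg_unit (tensor2 ?Q) = bvec (\<one>\<^bsub>G\<^esub>, \<one>\<^bsub>G\<^esub>)"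
    "basis_star (tensor2 ?Q) (g, h) = bvec (inv\<^bsub>G\<^esub> g, inv\<^bsub>G\<^esub> h)" for g h g' h'
    by (auto simp: tensor_alg_def m tens_bvec)
  note simps = b m t assms(2) lin_ext_bvec alg_star_bvec alg_mult_bvec bvec_in_elements
    coprod_def id_coprod_def coprod_id_def tens_bvec tens_assoc_bvec
  show ?thesis
    unfolding hopf_star_algebra_def star_algebra_def
    using sum_bvec[OF fin(1), where f = "\<lambda>_. 1"]
    by (auto simp: simps m_assoc inv_mult_group)
qed


section \<open>Semidirect products and the holomorph of the cyclic group of order 8\<close>

definition semidirect ::
  "('n, 'a) monoid_scheme \<Rightarrow> ('h, 'b) monoid_scheme \<Rightarrow> ('h \<Rightarrow> 'n \<Rightarrow> 'n) \<Rightarrow> ('n \<times> 'h) monoid" where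
  "semidirect N H \<phi> = \<lparr>
     carrier = carrier N \<times> carrier H,
     monoid.mult = (\<lambda>(n, h) (n', h'). (n \<otimes>\<^bsub>N\<^esub> \<phi> h n', h \<otimes>\<^bsub>H\<^esub> h')),
     one = (\<one>\<^bsub>N\<^esub>, \<one>\<^bsub>H\<^esub>)\<rparr>"

definition Z8_Aut :: "(int \<times> (int \<Rightarrow> int)) monoid" where
  "Z8_Aut = semidirect (integer_mod_group 8) (AutoGroup (integer_mod_group 8)) (\<lambda>\<alpha> n. \<alpha> n)"

lemma group_semidirect:
  assumes "group N" "group H"
    and \<phi>: "\<And>h. h \<in> carrier H \<Longrightarrow> \<phi> h \<in> hom N N"
    and \<phi>_one: "\<And>n. n \<in> carrier N \<Longrightarrow> \<phi> \<one>\<^bsub>H\<^esub> n = n"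
    and \<phi>_mult: "\<And>h k n. \<lbrakk>h \<in> carrier H; k \<in> carrier H; n \<in> carrier N\<rbrakk>
      \<Longrightarrow> \<phi> (h \<otimes>\<^bsub>H\<^esub> k) n = \<phi> h (\<phi> k n)"
  shows "group (semidirect N H \<phi>)"
proof -
  interpret N: group N by fact
  interpret H: group H by fact
  have cl: "\<phi> h n \<in> carrier N" if "h \<in> carrier H" "n \<in> carrier N" for h n
    using \<phi>[OF that(1)] that(2) by (auto simp: hom_def)
  have hm: "\<phi> h (n \<otimes>\<^bsub>N\<^esub> n') = \<phi> h n \<otimes>\<^bsub>N\<^esub> \<phi> h n'"
    if "h \<in> carrier H" "n \<in> carrier N" "n' \<in> carrier N" for h n n'
    using \<phi>[OF that(1)] that(2,3) by (auto simp: hom_def)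
  show ?thesis
  proof (rule groupI)
    fix x assume "x \<in> carrier (semidirect N H \<phi>)"
    then obtain n h where x: "x = (n, h)" "n \<in> carrier N" "h \<in> carrier H"
      by (auto simp: semidirect_def)
    let ?y = "(\<phi> (inv\<^bsub>H\<^esub> h) (inv\<^bsub>N\<^esub> n), inv\<^bsub>H\<^esub> h)"
    have "\<phi> (inv\<^bsub>H\<^esub> h) (inv\<^bsub>N\<^esub> n) \<otimes>\<^bsub>N\<^esub> \<phi> (inv\<^bsub>H\<^esub> h) n = \<one>\<^bsub>N\<^esub>"
      using x hm[of "inv\<^bsub>H\<^esub> h" "inv\<^bsub>N\<^esub> n" n] \<phi>[of "inv\<^bsub>H\<^esub> h"]
      by (simp add: hom_one)
    then show "\<exists>y\<in>carrier (semidirect N H \<phi>). y \<otimes>\<^bsub>semidirect N H \<phi>\<^esub> x = \<one>\<^bsub>semidirect N H \<phi>\<^esub>"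
      using x by (intro bexI[of _ ?y]) (auto simp: semidirect_def cl)
  qed (auto simp: semidirect_def cl hm \<phi>_one \<phi>_mult N.m_assoc H.m_assoc)
qed

lemma group_Z8_Aut: "group Z8_Aut"
proof -
  let ?N = "integer_mod_group 8"
  have A: "carrier (AutoGroup ?N) \<subseteq> Bij (carrier ?N)" "carrier (AutoGroup ?N) \<subseteq> hom ?N ?N"
    by (auto simp: AutoGroup_def auto_def)
  show ?thesis
    unfolding Z8_Aut_def
  proof (rule group_semidirect)
    fix h k n assume "h \<in> carrier (AutoGroup ?N)" "k \<in> carrier (AutoGroup ?N)" "n \<in> carrier ?N"
    then show "(h \<otimes>\<^bsub>AutoGroup ?N\<^esub> k) n = h (k n)"
      using A by (auto simp: AutoGroup_def BijGroup_def compose_def)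
  qed (use A in \<open>auto simp: group.AutoGroup, simp add: AutoGroup_def BijGroup_def\<close>)
qed

lemma finite_Z8_Aut: "finite (carrier Z8_Aut)"
proof -
  let ?S = "carrier (integer_mod_group 8)"
  have f: "finite ?S" by (simp add: carrier_integer_mod_group)
  have "carrier (AutoGroup (integer_mod_group 8)) \<subseteq> ?S \<rightarrow>\<^sub>E ?S"
    by (auto simp: AutoGroup_def auto_def Bij_def bij_betw_def PiE_def)
  then have "finite (carrier (AutoGroup (integer_mod_group 8)))"
    using finite_PiE[OF f, of "\<lambda>_. ?S"] f finite_subset by blast
  with f show ?thesis by (simp add: Z8_Aut_def semidirect_def)
qed

end

theory Submission
  imports Defs
begin

text \<open>
  Write \<open>z = u\<^sup>4\<close> and \<open>r = u\<^sup>2\<close>. The proof shows that every invariant unitary 2-cocycle has the form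
  \<open>\<Omega> = (v \<otimes> v) \<Delta>(v\<^sup>-\<^sup>1)\<close> for a unitary \<open>v\<close> of the group algebra, not necessarily central. Invariance of
  such an \<open>\<Omega>\<close> says exactly that each \<open>v\<^sup>-\<^sup>1 g v\<close> is group-like, that is, that conjugation by \<open>v\<close> is an
  automorphism of the group. Central unitaries and group elements change nothing, so the cohomology is the
  group of those automorphisms that become inner in the group algebra, modulo inner automorphisms.
  Such automorphisms preserve conjugacy classes. Up to an inner one, they fix \<open>u\<close> and \<open>s\<close> and send \<open>t\<close>
  to \<open>t\<close> or \<open>z t\<close>. The second case does occur: it is implemented by the unitary
  \<open>(1 + z)/2 + (u + u\<^sup>3 - u\<^sup>5 - u\<^sup>7)/(2\<surd>2)\<close>, and it is not inner. This gives two classes.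
  
  To find \<open>v\<close>, let \<open>\<Omega>\<close> twist the pointwise product of functions on the group to
  \<open>(f \<star> h)(x) = \<Sum> \<Omega>(a, b) f(a x) h(b x)\<close>. The cocycle equation makes this product associative, and right
  translations are automorphisms of it. A linear functional multiplicative for \<open>\<star>\<close> is evaluation at an
  element \<open>v\<close> with \<open>\<Omega> \<Delta>(v) = v \<otimes> v\<close>, and such a \<open>v\<close> is automatically unitary. The functional comes
  from a minimal idempotent \<open>p\<close> for which every \<open>p \<star> h\<close> is a multiple of \<open>p\<close>
  (\<open>minimal_idempotent\<close>, \<open>twisted_character\<close>, \<open>cocycle_is_coboundary\<close>).
  
  The decisive property of the group is this: each element other than \<open>1\<close> and \<open>z\<close> is
  conjugate to its product with \<open>z\<close>. Hence central elements act by scalars on the functions that are odd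
  under \<open>z\<close> (\<open>odd_class_scalar\<close>), and for a character \<open>\<chi>\<close> with values \<open>\<plusminus>1\<close> and an odd \<open>f\<close> one gets
  \<open>\<chi> \<star> f = \<phi>(\<chi>) \<chi> f\<close> and \<open>f \<star> \<chi> = \<psi>(\<chi>) \<chi> f\<close>. Integrating \<open>f \<star> \<chi> \<star> f\<close> over the group forces
  \<open>\<phi> = \<psi>\<close> (\<open>phi_eq_psi\<close>). After division by \<open>\<phi>\<close> the characters multiply as they do without the twist
  (\<open>E_star_E\<close>), and their average \<open>e\<close> is an idempotent that is a two-sided unit for the odd functions
  supported on the cyclic group generated by \<open>r\<close>. If \<open>f\<close> is the odd function on that group with
  \<open>f(r\<^sup>k) = \<i>\<^sup>k\<close>, then \<open>f \<star> f\<^sup>*\<close>, where \<open>f\<^sup>*\<close> is its complex conjugate, and \<open>f \<star> f \<star> f \<star> f\<close> are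
  translation invariant under \<open>r\<close>, hence multiples of \<open>e\<close>, and the multiples are not 0. With \<open>f\<close> scaled
  to a fourth root of \<open>e\<close>, the element \<open>p = e + f + f \<star> f + f \<star> f \<star> f\<close> is the one required.
\<close>

section \<open>Group algebras through test functions\<close>

locale finite_group = group G for G (structure) +
  assumes finite_carrier [simp]: "finite (carrier G)"

lemma finite_group_DirProd:
  "finite_group G \<Longrightarrow> finite_group H \<Longrightarrow> finite_group (G \<times>\<times> H)"
  by (simp add: finite_group_def finite_group_axioms_def DirProd_group)

abbreviation ga :: "('g, 'm) monoid_scheme \<Rightarrow> ('g \<Rightarrow> complex) monoid" where
  "ga G \<equiv> mult_monoid (group_algebra G)"

abbreviation adj :: "('g, 'm) monoid_scheme \<Rightarrow> ('g \<Rightarrow> complex) \<Rightarrow> 'g \<Rightarrow> complex" where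
  "adj G \<equiv> alg_star (group_algebra G)"

text \<open>
  Elements of a group algebra are compared by pairing them with arbitrary functions on the group. Under this
  pairing, products, adjoints and images under group homomorphisms turn into substitutions in the test
  function, so that identities between elements of tensor powers reduce to the group law.
\<close>
definition ev :: "('g, 'm) monoid_scheme \<Rightarrow> ('g \<Rightarrow> complex) \<Rightarrow> ('g \<Rightarrow> complex) \<Rightarrow> complex" where
  "ev G x f = (\<Sum>g\<in>carrier G. x g * f g)"

text \<open>
  The coproduct, its extensions to tensor powers and the inclusions of tensor factors are all of this form,
  for homomorphisms between powers of the group.
\<close>
definition push ::
  "('g, 'm) monoid_scheme \<Rightarrow> ('g \<Rightarrow> 'h) \<Rightarrow> ('g \<Rightarrow> complex) \<Rightarrow> 'h \<Rightarrow> complex" where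
  "push G \<phi> = lin_ext (group_algebra G) (\<lambda>g. bvec (\<phi> g))"

lemma ga_sel:
  "x \<in> carrier (ga G) \<longleftrightarrow> (\<forall>g. g \<notin> carrier G \<longrightarrow> x g = 0)"
  "\<one>\<^bsub>ga G\<^esub> = bvec \<one>\<^bsub>G\<^esub>"
  by (auto simp: mult_monoid_def elements_def group_algebra_def)

lemma ev_cong: "(\<And>g. g \<in> carrier G \<Longrightarrow> f g = h g) \<Longrightarrow> ev G x f = ev G x h"
  by (simp add: ev_def)

lemma ev_bvec: "finite (carrier G) \<Longrightarrow> g \<in> carrier G \<Longrightarrow> ev G (bvec g) f = f g"
  by (simp add: ev_def sum_bvec)

lemma ev_bvec_right:
  assumes "finite (carrier G)" "g \<in> carrier G" shows "ev G x (bvec g) = x g"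
  using sum_bvec[OF assms, of x] by (simp add: ev_def mult.commute)

lemma ga_eqI:
  assumes "finite (carrier G)" "x \<in> carrier (ga G)" "y \<in> carrier (ga G)"
    and "\<And>f. ev G x f = ev G y f"
  shows "x = y"
proof
  fix g
  show "x g = y g"
    using assms(2,3) assms(4)[of "bvec g"]
    by (cases "g \<in> carrier G") (simp_all add: ev_bvec_right assms(1) ga_sel)
qed

lemma ev_scale: "ev G x (\<lambda>g. c * f g) = c * ev G x f"
  by (simp add: ev_def sum_distrib_left algebra_simps)

lemma ev_swap:
  "ev G x (\<lambda>a. ev H y (\<lambda>b. f a b)) = ev H y (\<lambda>b. ev G x (\<lambda>a. f a b))"
proof -
  have "ev G x (\<lambda>a. ev H y (\<lambda>b. f a b)) = (\<Sum>a\<in>carrier G. \<Sum>b\<in>carrier H. y b * (x a * f a b))"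
    by (simp add: ev_def sum_distrib_left algebra_simps)
  also have "\<dots> = (\<Sum>b\<in>carrier H. \<Sum>a\<in>carrier G. y b * (x a * f a b))"
    by (rule sum.swap)
  finally show ?thesis
    by (simp add: ev_def sum_distrib_left)
qed

lemma ev_push:
  assumes "finite (carrier G)" "finite (carrier H)" "\<And>g. g \<in> carrier G \<Longrightarrow> \<phi> g \<in> carrier H"
  shows "ev H (push G \<phi> x) f = ev G x (\<lambda>g. f (\<phi> g))"
proof -
  have "ev H (push G \<phi> x) f = (\<Sum>c\<in>carrier H. \<Sum>g\<in>carrier G. x g * (bvec (\<phi> g) c * f c))"
    by (simp add: ev_def push_def lin_ext_def group_algebra_def sum_distrib_right mult.assoc)
  also have "\<dots> = (\<Sum>g\<in>carrier G. x g * (\<Sum>c\<in>carrier H. bvec (\<phi> g) c * f c))"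
    by (subst sum.swap) (simp add: sum_distrib_left)
  also have "\<dots> = ev G x (\<lambda>g. f (\<phi> g))"
    using assms by (simp add: ev_def sum_bvec)
  finally show ?thesis .
qed

lemma push_closed:
  assumes "\<And>g. g \<in> carrier G \<Longrightarrow> \<phi> g \<in> carrier H"
  shows "push G \<phi> x \<in> carrier (ga H)"
proof -
  have "push G \<phi> x h = 0" if "h \<notin> carrier H" for h
    unfolding push_def lin_ext_def
    by (rule sum.neutral) (use assms that in \<open>auto simp: bvec_def group_algebra_def\<close>)
  then show ?thesis by (simp add: ga_sel)
qed

lemma push_bvec:
  "finite (carrier G) \<Longrightarrow> g \<in> carrier G \<Longrightarrow> push G \<phi> (bvec g) = bvec (\<phi> g)"
  by (simp add: push_def group_algebra_def lin_ext_bvec)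

lemma push_push:
  fixes G :: "('g, 'm) monoid_scheme" and H :: "('h, 'n) monoid_scheme" and K :: "('k, 'l) monoid_scheme"
  assumes "finite (carrier G)" "finite (carrier H)" "finite (carrier K)"
    "\<And>g. g \<in> carrier G \<Longrightarrow> \<phi> g \<in> carrier H" "\<And>h. h \<in> carrier H \<Longrightarrow> \<psi> h \<in> carrier K"
  shows "push H \<psi> (push G \<phi> x) = push G (\<lambda>g. \<psi> (\<phi> g)) x"
  by (rule ga_eqI[where G = K]) (use assms in \<open>auto simp: push_closed ev_push\<close>)

context finite_group
begin

abbreviation conv (infixl "\<cdot>" 70) where "x \<cdot> y \<equiv> x \<otimes>\<^bsub>ga G\<^esub> y"

lemma bvec_closed: "g \<in> carrier G \<Longrightarrow> bvec g \<in> carrier (ga G)"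
  by (auto simp: ga_sel bvec_def)

lemma ga_closed: "x \<cdot> y \<in> carrier (ga G)"
proof -
  have "(x \<cdot> y) c = 0" if "c \<notin> carrier G" for c
    unfolding mult_monoid_def alg_mult_def
    using that by (auto simp: group_algebra_def bvec_def intro!: sum.neutral)
  then show ?thesis by (simp add: ga_sel)
qed

lemma ev_mult: "ev G (x \<cdot> y) f = ev G x (\<lambda>a. ev G y (\<lambda>b. f (a \<otimes> b)))"
proof -
  have "ev G (x \<cdot> y) f
      = (\<Sum>c\<in>carrier G. \<Sum>a\<in>carrier G. \<Sum>b\<in>carrier G. x a * y b * (bvec (a \<otimes> b) c * f c))"
    by (simp add: ev_def mult_monoid_def alg_mult_def group_algebra_def sum_distrib_right mult.assoc)
  also have "\<dots> = (\<Sum>a\<in>carrier G. \<Sum>b\<in>carrier G. \<Sum>c\<in>carrier G. x a * y b * (bvec (a \<otimes> b) c * f c))"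
    by (subst sum.swap) (intro sum.cong refl sum.swap)
  also have "\<dots> = (\<Sum>a\<in>carrier G. \<Sum>b\<in>carrier G. x a * y b * f (a \<otimes> b))"
    by (intro sum.cong refl) (simp add: sum_bvec flip: sum_distrib_left)
  finally show ?thesis
    by (simp add: ev_def sum_distrib_left mult.assoc)
qed

lemma monoid_ga: "monoid (ga G)"
proof
  fix x y z assume "x \<in> carrier (ga G)" "y \<in> carrier (ga G)" "z \<in> carrier (ga G)"
  show "x \<cdot> y \<cdot> z = x \<cdot> (y \<cdot> z)"
    by (rule ga_eqI[where G = G]) (auto simp: ga_closed ev_mult m_assoc intro!: ev_cong)
next
  fix x assume x: "x \<in> carrier (ga G)"
  show "\<one>\<^bsub>ga G\<^esub> \<cdot> x = x" "x \<cdot> \<one>\<^bsub>ga G\<^esub> = x"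
    by (rule ga_eqI[where G = G], use x in \<open>auto simp: ga_closed ev_mult ev_bvec ga_sel(2) intro!: ev_cong\<close>)+
qed (auto simp: ga_closed, auto simp: ga_sel bvec_def)

lemma bvec_mult:
  "g \<in> carrier G \<Longrightarrow> h \<in> carrier G \<Longrightarrow> bvec g \<cdot> bvec h = bvec (g \<otimes> h)"
  by (rule ga_eqI[where G = G]) (auto simp: ga_closed bvec_closed ev_mult ev_bvec)

lemma adj_closed: "adj G x \<in> carrier (ga G)"
proof -
  have "adj G x c = 0" if "c \<notin> carrier G" for c
    unfolding alg_star_def
    using that by (auto simp: group_algebra_def bvec_def intro!: sum.neutral)
  then show ?thesis by (simp add: ga_sel)
qed

lemma ev_adj: "ev G (adj G x) f = ev G (\<lambda>g. cnj (x g)) (\<lambda>g. f (inv g))"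
proof -
  have "ev G (adj G x) f = (\<Sum>c\<in>carrier G. \<Sum>g\<in>carrier G. cnj (x g) * (bvec (inv g) c * f c))"
    by (simp add: ev_def alg_star_def group_algebra_def sum_distrib_right mult.assoc)
  also have "\<dots> = (\<Sum>g\<in>carrier G. cnj (x g) * (\<Sum>c\<in>carrier G. bvec (inv g) c * f c))"
    by (subst sum.swap) (simp add: sum_distrib_left)
  finally show ?thesis
    by (simp add: ev_def sum_bvec)
qed

lemma adj_apply: "g \<in> carrier G \<Longrightarrow> adj G x g = cnj (x (inv g))"
proof -
  assume g: "g \<in> carrier G"
  have "adj G x g = ev G (adj G x) (bvec g)" using g by (simp add: ev_bvec_right)
  also have "\<dots> = ev G (\<lambda>g. cnj (x g)) (bvec (inv g))"
    unfolding ev_adj by (rule ev_cong) (use g in \<open>auto simp: bvec_def\<close>)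
  finally show ?thesis using g by (simp add: ev_bvec_right)
qed

lemma adj_adj: "x \<in> carrier (ga G) \<Longrightarrow> adj G (adj G x) = x"
  using adj_closed[of "adj G x"] by (auto simp: fun_eq_iff ga_sel adj_apply) (metis adj_apply complex_cnj_cnj inv_closed inv_inv)

lemma ev_cnj: "cnj (ev G x f) = ev G (\<lambda>g. cnj (x g)) (\<lambda>g. cnj (f g))"
  by (simp add: ev_def)

lemma adj_mult: "adj G (x \<cdot> y) = adj G y \<cdot> adj G x"
proof (rule ga_eqI[where G = G])
  fix f
  have "ev G (adj G (x \<cdot> y)) f = cnj (ev G (x \<cdot> y) (\<lambda>g. cnj (f (inv g))))"
    by (simp add: ev_adj ev_cnj)
  also have "\<dots> = ev G (\<lambda>g. cnj (x g)) (\<lambda>a. ev G (\<lambda>g. cnj (y g)) (\<lambda>b. f (inv (a \<otimes> b))))"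
    by (simp add: ev_mult ev_cnj)
  also have "\<dots> = ev G (\<lambda>g. cnj (y g)) (\<lambda>b. ev G (\<lambda>g. cnj (x g)) (\<lambda>a. f (inv (a \<otimes> b))))"
    by (rule ev_swap)
  also have "\<dots> = ev G (adj G y \<cdot> adj G x) f"
    by (auto simp: ev_mult ev_adj inv_mult_group intro!: ev_cong)
  finally show "ev G (adj G (x \<cdot> y)) f = ev G (adj G y \<cdot> adj G x) f" .
qed (auto simp: adj_closed ga_closed)

lemma adj_one: "adj G \<one>\<^bsub>ga G\<^esub> = \<one>\<^bsub>ga G\<^esub>"
proof -
  have "adj G (bvec \<one>) = bvec \<one>"
    by (subst alg_star_bvec) (auto simp: group_algebra_def)
  then show ?thesis by (simp add: ga_sel)
qed

end

lemma push_hom: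
  assumes "finite_group G" "finite_group H" "\<phi> \<in> hom G H"
  shows "push G \<phi> \<in> hom (ga G) (ga H)" "push G \<phi> \<one>\<^bsub>ga G\<^esub> = \<one>\<^bsub>ga H\<^esub>"
proof -
  interpret G: finite_group G by fact
  interpret H: finite_group H by fact
  have c: "\<phi> g \<in> carrier H" if "g \<in> carrier G" for g using that assms(3) by (auto simp: hom_def)
  have m: "\<phi> (g \<otimes>\<^bsub>G\<^esub> h) = \<phi> g \<otimes>\<^bsub>H\<^esub> \<phi> h" if "g \<in> carrier G" "h \<in> carrier G" for g h
    using that assms(3) by (auto simp: hom_def)
  show "push G \<phi> \<in> hom (ga G) (ga H)"
    unfolding hom_def
    by (auto simp: push_closed c G.ga_closed H.ga_closed ev_push G.ev_mult H.ev_mult m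
        intro!: ga_eqI[where G = H] ev_cong)
  show "push G \<phi> \<one>\<^bsub>ga G\<^esub> = \<one>\<^bsub>ga H\<^esub>"
    using hom_one[OF assms(3) G.is_group H.is_group] by (simp add: ga_sel push_bvec)
qed

lemma push_adj:
  assumes "finite_group G" "finite_group H" "\<phi> \<in> hom G H"
  shows "adj H (push G \<phi> x) = push G \<phi> (adj G x)"
proof -
  interpret G: finite_group G by fact
  interpret H: finite_group H by fact
  interpret group_hom G H \<phi> by unfold_locales fact
  show ?thesis
  proof (rule ga_eqI[where G = H])
    fix f
    have "ev H (adj H (push G \<phi> x)) f = cnj (ev H (push G \<phi> x) (\<lambda>h. cnj (f (inv\<^bsub>H\<^esub> h))))"
      by (simp add: H.ev_adj H.ev_cnj)
    also have "\<dots> = ev H (push G \<phi> (adj G x)) f"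
      by (auto simp: ev_push G.ev_cnj G.ev_adj intro!: ev_cong)
    finally show "ev H (adj H (push G \<phi> x)) f = ev H (push G \<phi> (adj G x)) f" .
  qed (auto simp: H.adj_closed push_closed)
qed

lemma push_commute:
  assumes "finite_group H" "finite (carrier G)" "finite (carrier K)"
    and c: "\<And>g. g \<in> carrier G \<Longrightarrow> \<phi> g \<in> carrier H" "\<And>k. k \<in> carrier K \<Longrightarrow> \<psi> k \<in> carrier H"
    and comm: "\<And>g k. g \<in> carrier G \<Longrightarrow> k \<in> carrier K \<Longrightarrow> \<phi> g \<otimes>\<^bsub>H\<^esub> \<psi> k = \<psi> k \<otimes>\<^bsub>H\<^esub> \<phi> g"
  shows "push G \<phi> x \<otimes>\<^bsub>ga H\<^esub> push K \<psi> y = push K \<psi> y \<otimes>\<^bsub>ga H\<^esub> push G \<phi> x"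
proof -
  interpret H: finite_group H by fact
  show ?thesis
  proof (rule ga_eqI[where G = H])
    fix f
    have "ev H (push G \<phi> x \<otimes>\<^bsub>ga H\<^esub> push K \<psi> y) f = ev G x (\<lambda>g. ev K y (\<lambda>k. f (\<phi> g \<otimes>\<^bsub>H\<^esub> \<psi> k)))"
      using assms by (simp add: H.ev_mult ev_push)
    also have "\<dots> = ev G x (\<lambda>g. ev K y (\<lambda>k. f (\<psi> k \<otimes>\<^bsub>H\<^esub> \<phi> g)))"
      by (auto intro!: ev_cong simp: comm)
    also have "\<dots> = ev K y (\<lambda>k. ev G x (\<lambda>g. f (\<psi> k \<otimes>\<^bsub>H\<^esub> \<phi> g)))"
      by (rule ev_swap)
    also have "\<dots> = ev H (push K \<psi> y \<otimes>\<^bsub>ga H\<^esub> push G \<phi> x) f"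
      using assms by (simp add: H.ev_mult ev_push)
    finally show "ev H (push G \<phi> x \<otimes>\<^bsub>ga H\<^esub> push K \<psi> y) f
      = ev H (push K \<psi> y \<otimes>\<^bsub>ga H\<^esub> push G \<phi> x) f" .
  qed (auto simp: H.ga_closed)
qed

lemma hom_unit:
  assumes "monoid M" "monoid N" "f \<in> hom M N" "f \<one>\<^bsub>M\<^esub> = \<one>\<^bsub>N\<^esub>" "x \<in> Units M"
  shows "f x \<in> Units N" "f (inv\<^bsub>M\<^esub> x) = inv\<^bsub>N\<^esub> (f x)"
proof -
  interpret M: monoid M by fact
  interpret N: monoid N by fact
  have cl: "f x \<in> carrier N" "f (inv\<^bsub>M\<^esub> x) \<in> carrier N"
    using assms by (auto simp: hom_def)
  have r: "f x \<otimes>\<^bsub>N\<^esub> f (inv\<^bsub>M\<^esub> x) = \<one>\<^bsub>N\<^esub>"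
    using assms hom_mult[OF assms(3), of x "inv\<^bsub>M\<^esub> x"] by (simp add: M.Units_closed)
  have l: "f (inv\<^bsub>M\<^esub> x) \<otimes>\<^bsub>N\<^esub> f x = \<one>\<^bsub>N\<^esub>"
    using assms hom_mult[OF assms(3), of "inv\<^bsub>M\<^esub> x" x] by (simp add: M.Units_closed)
  show "f x \<in> Units N" using l r cl by (auto simp: Units_def)
  show "f (inv\<^bsub>M\<^esub> x) = inv\<^bsub>N\<^esub> (f x)" using N.inv_unique'[OF cl r l] .
qed

section \<open>Tensor powers and the cocycle equation\<close>

text \<open>
  A tensor power of a group algebra is the group algebra of a power of the group. Only the multiplicative
  structures are identified literally: the field giving the adjoint of a basis vector involves inverses, which
  are unspecified outside the carrier, so adjoints are compared after summation over the basis.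
\<close>
lemma ga_tensor2: "mult_monoid (tensor2 (group_algebra G)) = ga (G \<times>\<times> G)"
proof -
  have "alg_mult (tensor2 (group_algebra G)) = alg_mult (group_algebra (G \<times>\<times> G))"
    by (intro ext) (simp add: alg_mult_def tensor_alg_def group_algebra_def
        tens_bvec DirProd_def case_prod_unfold)
  then show ?thesis
    by (simp add: mult_monoid_def elements_def) (simp add: tensor_alg_def group_algebra_def tens_bvec)
qed

lemma ga_tensor3: "mult_monoid (tensor3 (group_algebra G)) = ga (G \<times>\<times> G \<times>\<times> G)"
proof -
  have "alg_mult (tensor3 (group_algebra G)) = alg_mult (group_algebra (G \<times>\<times> G \<times>\<times> G))"
    by (intro ext) (simp add: alg_mult_def tensor_alg_def group_algebra_def
        tens_bvec DirProd_def case_prod_unfold)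
  then show ?thesis
    by (simp add: mult_monoid_def elements_def) (simp add: tensor_alg_def group_algebra_def tens_bvec)
qed

lemma adj_tensor2:
  assumes "group G"
  shows "alg_star (tensor2 (group_algebra G)) = adj (G \<times>\<times> G)"
  using assms by (auto simp: alg_star_def tensor_alg_def group_algebra_def fun_eq_iff tens_bvec
      intro!: sum.cong)

abbreviation sq :: "('g, 'm) monoid_scheme \<Rightarrow> ('g \<times> 'g) monoid" where
  "sq G \<equiv> G \<times>\<times> G"

abbreviation cube :: "('g, 'm) monoid_scheme \<Rightarrow> ('g \<times> 'g \<times> 'g) monoid" where
  "cube G \<equiv> G \<times>\<times> G \<times>\<times> G"

lemma coprod_group_algebra: "coprod (group_algebra G) = push G (\<lambda>g. (g, g))"
  by (simp add: coprod_def push_def group_algebra_def tens_bvec)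

lemma id_coprod_group_algebra:
  "id_coprod (group_algebra G) = push (sq G) (\<lambda>(a, b). (a, b, b))"
  by (auto simp: id_coprod_def push_def lin_ext_def group_algebra_def tensor_alg_def tens_bvec fun_eq_iff
      case_prod_unfold)

lemma coprod_id_group_algebra:
  "coprod_id (group_algebra G) = push (sq G) (\<lambda>(a, b). (a, a, b))"
  by (auto simp: coprod_id_def push_def lin_ext_def group_algebra_def tensor_alg_def tens_bvec tens_assoc_bvec
      fun_eq_iff case_prod_unfold)

lemma alg_mult_ga: "alg_mult (group_algebra G) x y = x \<otimes>\<^bsub>ga G\<^esub> y"
  by (simp add: mult_monoid_def)

lemma alg_mult_ga2: "alg_mult (tensor2 (group_algebra G)) x y = x \<otimes>\<^bsub>ga (sq G)\<^esub> y"
  unfolding ga_tensor2[symmetric] by (simp add: mult_monoid_def)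

lemma alg_mult_ga3: "alg_mult (tensor3 (group_algebra G)) x y = x \<otimes>\<^bsub>ga (cube G)\<^esub> y"
  unfolding ga_tensor3[symmetric] by (simp add: mult_monoid_def)

lemma elements_ga: "elements (group_algebra G) = carrier (ga G)"
  by (simp add: mult_monoid_def)

lemma ev_tens:
  "ev (G \<times>\<times> H) (tens x y) f = ev G x (\<lambda>a. ev H y (\<lambda>b. f (a, b)))"
  by (simp add: ev_def tens_def sum.cartesian_product case_prod_unfold sum_distrib_left mult.assoc)

lemma tens_closed:
  "x \<in> carrier (ga G) \<Longrightarrow> y \<in> carrier (ga H) \<Longrightarrow> tens x y \<in> carrier (ga (G \<times>\<times> H))"
  by (auto simp: ga_sel tens_def)

context finite_group
begin

abbreviation conv2 (infixl "\<cdot>\<^sub>2" 70) where "x \<cdot>\<^sub>2 y \<equiv> x \<otimes>\<^bsub>ga (sq G)\<^esub> y"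
abbreviation conv3 (infixl "\<cdot>\<^sub>3" 70) where "x \<cdot>\<^sub>3 y \<equiv> x \<otimes>\<^bsub>ga (cube G)\<^esub> y"

lemma sq: "finite_group (sq G)" and cube: "finite_group (cube G)"
  by (intro finite_group_DirProd finite_group_axioms)+

lemma monoid2: "monoid (ga (sq G))" and monoid3: "monoid (ga (cube G))"
  by (simp_all add: sq cube finite_group.monoid_ga)

lemma unitary_iff:
  "alg_unitary (group_algebra G) x \<longleftrightarrow> x \<in> carrier (ga G) \<and>
    adj G x \<cdot> x = \<one>\<^bsub>ga G\<^esub> \<and> x \<cdot> adj G x = \<one>\<^bsub>ga G\<^esub>"
  by (simp add: alg_unitary_def mult_monoid_def)

lemma unitary2_iff:
  "alg_unitary (tensor2 (group_algebra G)) x \<longleftrightarrow> alg_unitary (group_algebra (sq G)) x"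
proof -
  have "elements (tensor2 (group_algebra G)) = carrier (ga (sq G))"
    "alg_unit (tensor2 (group_algebra G)) = \<one>\<^bsub>ga (sq G)\<^esub>"
    by (simp_all flip: ga_tensor2) (simp_all add: mult_monoid_def)
  then show ?thesis
    unfolding finite_group.unitary_iff[OF sq]
    by (simp add: alg_unitary_def adj_tensor2 alg_mult_ga2)
qed

lemma unitary_Units:
  assumes "alg_unitary (group_algebra G) x"
  shows "x \<in> Units (ga G)" "inv\<^bsub>ga G\<^esub> x = adj G x"
proof -
  interpret M: monoid "ga G" by (rule monoid_ga)
  show "x \<in> Units (ga G)"
    using assms adj_closed[of x] by (auto simp: unitary_iff Units_def)
  show "inv\<^bsub>ga G\<^esub> x = adj G x"
    using assms adj_closed by (auto simp: unitary_iff intro!: M.inv_unique'[symmetric])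
qed

lemma unitary_mult:
  assumes "alg_unitary (group_algebra G) x" "alg_unitary (group_algebra G) y"
  shows "alg_unitary (group_algebra G) (x \<cdot> y)"
proof -
  interpret M: monoid "ga G" by (rule monoid_ga)
  have x: "x \<in> carrier (ga G)" "adj G x \<in> carrier (ga G)"
    "adj G x \<cdot> x = \<one>\<^bsub>ga G\<^esub>" "x \<cdot> adj G x = \<one>\<^bsub>ga G\<^esub>"
    using assms(1) by (simp_all add: unitary_iff adj_closed)
  have y: "y \<in> carrier (ga G)" "adj G y \<in> carrier (ga G)"
    "adj G y \<cdot> y = \<one>\<^bsub>ga G\<^esub>" "y \<cdot> adj G y = \<one>\<^bsub>ga G\<^esub>"
    using assms(2) by (simp_all add: unitary_iff adj_closed)
  have "(adj G y \<cdot> adj G x) \<cdot> (x \<cdot> y)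
      = adj G y \<cdot> ((adj G x \<cdot> x) \<cdot> y)"
    using x(1,2) y(1,2) by (simp add: M.m_assoc)
  moreover have "(x \<cdot> y) \<cdot> (adj G y \<cdot> adj G x)
      = x \<cdot> ((y \<cdot> adj G y) \<cdot> adj G x)"
    using x(1,2) y(1,2) by (simp add: M.m_assoc)
  ultimately show ?thesis
    using x y by (simp add: unitary_iff adj_mult)
qed

lemma unitary_adj:
  "alg_unitary (group_algebra G) x \<Longrightarrow> alg_unitary (group_algebra G) (adj G x)"
  by (auto simp: unitary_iff adj_closed adj_adj)

lemma unitary_one: "alg_unitary (group_algebra G) \<one>\<^bsub>ga G\<^esub>"
  using monoid.one_closed[OF monoid_ga] monoid.l_one[OF monoid_ga]
  by (simp add: unitary_iff adj_one)

lemma tens_one: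
  assumes "\<Omega> \<in> carrier (ga (sq G))"
  shows "tens (alg_unit (group_algebra G)) \<Omega> = push (sq G) (Pair \<one>) \<Omega>" (is "?l = ?r")
    and "tens_assoc (tens \<Omega> (alg_unit (group_algebra G))) = push (sq G) (\<lambda>(a, b). (a, b, \<one>)) \<Omega>"
      (is "?l' = ?r'")
proof -
  interpret G2: finite_group "sq G" by (rule sq)
  interpret G3: finite_group "cube G" by (rule cube)
  have u: "alg_unit (group_algebra G) = bvec \<one>" by (simp add: group_algebra_def)
  show "?l = ?r"
  proof (rule ga_eqI[where G = "cube G"])
    fix f
    have "ev (cube G) ?r f = ev (sq G) \<Omega> (\<lambda>b. f (\<one>, b))"
      by (subst ev_push) (auto intro!: ev_cong)
    then show "ev (cube G) ?l f = ev (cube G) ?r f"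
      by (simp add: ev_tens u ev_bvec)
  qed (use assms in \<open>auto simp: u intro!: tens_closed push_closed bvec_closed\<close>)
  have b: "ev (cube G) ?l' f = ev (sq G) \<Omega> (\<lambda>(a, b). f (a, b, \<one>))" for f
  proof -
    have "ev (cube G) ?l' f = (\<Sum>a\<in>carrier G. \<Sum>b\<in>carrier G. \<Sum>c\<in>carrier G.
        \<Omega> (a, b) * (bvec \<one> c * f (a, b, c)))"
      by (simp add: ev_def tens_assoc_def tens_def u case_prod_unfold mult.assoc
          sum.cartesian_product')
    also have "\<dots> = (\<Sum>a\<in>carrier G. \<Sum>b\<in>carrier G. \<Omega> (a, b) * f (a, b, \<one>))"
      by (simp add: sum_bvec flip: sum_distrib_left)
    also have "\<dots> = ev (sq G) \<Omega> (\<lambda>(a, b). f (a, b, \<one>))"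
      by (simp add: ev_def case_prod_unfold sum.cartesian_product')
    finally show ?thesis .
  qed
  show "?l' = ?r'"
  proof (rule ga_eqI[where G = "cube G"])
    fix f
    show "ev (cube G) ?l' f = ev (cube G) ?r' f"
      unfolding b by (subst ev_push) (auto intro!: ev_cong)
    show "?l' \<in> carrier (ga (cube G))"
      using assms by (auto simp: u ga_sel tens_assoc_def tens_def bvec_def)
    show "?r' \<in> carrier (ga (cube G))"
      by (rule push_closed) auto
  qed simp
qed

abbreviation "leg23 \<equiv> push (sq G) (Pair \<one>)"
abbreviation "leg12 \<equiv> push (sq G) (\<lambda>(a, b). (a, b, \<one>))"
abbreviation "cop2 \<equiv> push (sq G) (\<lambda>(a, b). (a, b, b))"
abbreviation "cop1 \<equiv> push (sq G) (\<lambda>(a, b). (a, a, b))"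
abbreviation "diag \<equiv> push G (\<lambda>g. (g, g))"

lemma two_cocycle_iff:
  "two_cocycle (group_algebra G) \<Omega> \<longleftrightarrow> \<Omega> \<in> Units (ga (sq G)) \<and>
     leg23 \<Omega> \<cdot>\<^sub>3 cop2 \<Omega> = leg12 \<Omega> \<cdot>\<^sub>3 cop1 \<Omega>"
proof (cases "\<Omega> \<in> Units (ga (sq G))")
  case True
  then have "\<Omega> \<in> carrier (ga (sq G))" by (rule monoid.Units_closed[OF monoid2])
  with True show ?thesis
    by (simp add: two_cocycle_def ga_tensor2 alg_mult_ga3 tens_one id_coprod_group_algebra
        coprod_id_group_algebra)
qed (simp add: two_cocycle_def ga_tensor2)

lemma invariant_iff:
  "invariant (group_algebra G) \<Omega> \<longleftrightarrow>
    (\<forall>a\<in>carrier (ga G). \<Omega> \<cdot>\<^sub>2 diag a = diag a \<cdot>\<^sub>2 \<Omega>)"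
  by (simp add: invariant_def elements_ga alg_mult_ga2 coprod_group_algebra)

lemma coboundary_eq:
  "coboundary (group_algebra G) v = tens v v \<cdot>\<^sub>2 diag (inv\<^bsub>ga G\<^esub> v)"
  by (simp add: coboundary_def alg_mult_ga2 coprod_group_algebra)

lemma homs:
  "(Pair \<one>) \<in> hom (sq G) (cube G)"
  "(\<lambda>(a, b). (a, b, \<one>)) \<in> hom (sq G) (cube G)"
  "(\<lambda>(a, b). (a, b, b)) \<in> hom (sq G) (cube G)"
  "(\<lambda>(a, b). (a, a, b)) \<in> hom (sq G) (cube G)"
  "(\<lambda>g. (g, g)) \<in> hom G (sq G)"
  by (auto simp: hom_def)

lemmas push_homs = homs(1-4)[THEN push_hom(1)[OF sq cube]] homs(5)[THEN push_hom(1)[OF finite_group_axioms sq]]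
lemmas push_ones = homs(1-4)[THEN push_hom(2)[OF sq cube]] homs(5)[THEN push_hom(2)[OF finite_group_axioms sq]]

text \<open>
  Invariance in the form in which it is used: the substitution rule that lets a group element change sides
  simultaneously in both legs.
\<close>
lemma invariant_ev:
  assumes "invariant (group_algebra G) \<Omega>" "g \<in> carrier G"
  shows "ev (sq G) \<Omega> (\<lambda>(a, b). f (a \<otimes> g, b \<otimes> g)) = ev (sq G) \<Omega> (\<lambda>(a, b). f (g \<otimes> a, g \<otimes> b))"
proof -
  interpret G2: finite_group "sq G" by (rule sq)
  have "ev (sq G) (\<Omega> \<cdot>\<^sub>2 bvec (g, g)) f = ev (sq G) (bvec (g, g) \<cdot>\<^sub>2 \<Omega>) f"
    using assms bvec_closed by (fastforce simp: invariant_iff push_bvec)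
  then show ?thesis
    using assms(2) by (simp add: G2.ev_mult ev_bvec case_prod_unfold mult_DirProd')
qed

text \<open>
  An invariant \<open>\<Omega>\<close> placed in the last two legs commutes with \<open>a \<otimes> \<Delta>(b)\<close>, because there it only meets
  \<open>\<Delta>(b)\<close>. The next lemma is the mirror image. Together they make invariant cocycles closed under products.
\<close>
lemma leg23_cop2:
  assumes "invariant (group_algebra G) \<Omega>"
  shows "leg23 \<Omega> \<cdot>\<^sub>3 cop2 x = cop2 x \<cdot>\<^sub>3 leg23 \<Omega>"
proof -
  interpret G3: finite_group "cube G" by (rule cube)
  show ?thesis
  proof (rule ga_eqI[where G = "cube G"])
    fix f
    have "ev (cube G) (leg23 \<Omega> \<cdot>\<^sub>3 cop2 x) f
      = ev (sq G) \<Omega> (\<lambda>q. ev (sq G) x (\<lambda>p. f (fst p, fst q \<otimes> snd p, snd q \<otimes> snd p)))"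
      by (subst G3.ev_mult, subst ev_push, force+, rule ev_cong, subst ev_push, force+)
        (auto intro!: ev_cong)
    also have "\<dots> = ev (sq G) x (\<lambda>p. ev (sq G) \<Omega> (\<lambda>q. f (fst p, fst q \<otimes> snd p, snd q \<otimes> snd p)))"
      by (rule ev_swap)
    also have "\<dots> = ev (sq G) x (\<lambda>p. ev (sq G) \<Omega> (\<lambda>q. f (fst p, snd p \<otimes> fst q, snd p \<otimes> snd q)))"
    proof (rule ev_cong)
      fix p assume "p \<in> carrier (sq G)"
      then show "ev (sq G) \<Omega> (\<lambda>q. f (fst p, fst q \<otimes> snd p, snd q \<otimes> snd p))
          = ev (sq G) \<Omega> (\<lambda>q. f (fst p, snd p \<otimes> fst q, snd p \<otimes> snd q))"
        using invariant_ev[OF assms, of "snd p" "\<lambda>(y, z). f (fst p, y, z)"]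
        by (auto simp: case_prod_unfold)
    qed
    also have "\<dots> = ev (cube G) (cop2 x \<cdot>\<^sub>3 leg23 \<Omega>) f"
      by (subst G3.ev_mult, subst ev_push, force+, rule ev_cong, subst ev_push, force+)
        (auto intro!: ev_cong)
    finally show "ev (cube G) (leg23 \<Omega> \<cdot>\<^sub>3 cop2 x) f
      = ev (cube G) (cop2 x \<cdot>\<^sub>3 leg23 \<Omega>) f" .
  qed (auto simp: G3.ga_closed)
qed

lemma leg12_cop1:
  assumes "invariant (group_algebra G) \<Omega>"
  shows "leg12 \<Omega> \<cdot>\<^sub>3 cop1 x = cop1 x \<cdot>\<^sub>3 leg12 \<Omega>"
proof -
  interpret G3: finite_group "cube G" by (rule cube)
  show ?thesis
  proof (rule ga_eqI[where G = "cube G"])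
    fix f
    have "ev (cube G) (leg12 \<Omega> \<cdot>\<^sub>3 cop1 x) f
      = ev (sq G) \<Omega> (\<lambda>q. ev (sq G) x (\<lambda>p. f (fst q \<otimes> fst p, snd q \<otimes> fst p, snd p)))"
      by (subst G3.ev_mult, subst ev_push, force+, rule ev_cong, subst ev_push, force+)
        (auto intro!: ev_cong)
    also have "\<dots> = ev (sq G) x (\<lambda>p. ev (sq G) \<Omega> (\<lambda>q. f (fst q \<otimes> fst p, snd q \<otimes> fst p, snd p)))"
      by (rule ev_swap)
    also have "\<dots> = ev (sq G) x (\<lambda>p. ev (sq G) \<Omega> (\<lambda>q. f (fst p \<otimes> fst q, fst p \<otimes> snd q, snd p)))"
    proof (rule ev_cong)
      fix p assume "p \<in> carrier (sq G)"
      then show "ev (sq G) \<Omega> (\<lambda>q. f (fst q \<otimes> fst p, snd q \<otimes> fst p, snd p))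
          = ev (sq G) \<Omega> (\<lambda>q. f (fst p \<otimes> fst q, fst p \<otimes> snd q, snd p))"
        using invariant_ev[OF assms, of "fst p" "\<lambda>(y, z). f (y, z, snd p)"]
        by (auto simp: case_prod_unfold)
    qed
    also have "\<dots> = ev (cube G) (cop1 x \<cdot>\<^sub>3 leg12 \<Omega>) f"
      by (subst G3.ev_mult, subst ev_push, force+, rule ev_cong, subst ev_push, force+)
        (auto intro!: ev_cong)
    finally show "ev (cube G) (leg12 \<Omega> \<cdot>\<^sub>3 cop1 x) f
      = ev (cube G) (cop1 x \<cdot>\<^sub>3 leg12 \<Omega>) f" .
  qed (auto simp: G3.ga_closed)
qed

end

section \<open>The group of invariant unitary cocycles\<close>

lemma (in monoid) inv_commute:
  assumes "x \<in> Units G" "y \<in> carrier G" "x \<otimes> y = y \<otimes> x"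
  shows "inv x \<otimes> y = y \<otimes> inv x"
proof -
  have "inv x \<otimes> y = inv x \<otimes> (y \<otimes> x) \<otimes> inv x"
    using assms(1,2) by (simp add: m_assoc Units_closed)
  also have "\<dots> = y \<otimes> inv x"
    using assms(1,2) by (simp add: assms(3)[symmetric] Units_closed flip: m_assoc)
  finally show ?thesis .
qed

lemma (in monoid) Units_inv_mult:
  assumes "x \<in> Units G" "y \<in> Units G"
  shows "inv (x \<otimes> y) = inv y \<otimes> inv x"
  using group.inv_mult_group[OF units_group] assms
  by (simp add: units_of_carrier units_of_mult units_of_inv)

lemma (in monoid) commute_mult:
  assumes "x \<in> carrier G" "y \<in> carrier G" "z \<in> carrier G"
    "x \<otimes> z = z \<otimes> x" "y \<otimes> z = z \<otimes> y"
  shows "(x \<otimes> y) \<otimes> z = z \<otimes> (x \<otimes> y)"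
  using assms by (metis m_assoc)

context finite_group
begin

definition cocycles :: "('a \<times> 'a \<Rightarrow> complex) set" where
  "cocycles = {\<Omega>. two_cocycle (group_algebra G) \<Omega> \<and> invariant (group_algebra G) \<Omega> \<and>
     alg_unitary (tensor2 (group_algebra G)) \<Omega>}"

lemma A2u_group_algebra: "A2u (group_algebra G) = (units_of (ga (sq G))) \<lparr>carrier := cocycles\<rparr>"
  unfolding A2u_def ga_tensor2 cocycles_def by (simp add: units_of_def mult_monoid_def)

text \<open>
  The cocycle equation of a product separates into the two given equations once \<open>\<Omega>'\<close> in legs 2 and 3 is
  moved past \<open>(id \<otimes> \<Delta>)(\<Omega>)\<close>, and likewise on the other side.
\<close>
lemma cocycle_mult:
  assumes "\<Omega> \<in> cocycles" "\<Omega>' \<in> cocycles"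
  shows "\<Omega> \<cdot>\<^sub>2 \<Omega>' \<in> cocycles"
proof -
  interpret M2: monoid "ga (sq G)" by (rule monoid2)
  interpret M3: monoid "ga (cube G)" by (rule monoid3)
  note d = assms[unfolded cocycles_def two_cocycle_iff, simplified]
  have c: "\<Omega> \<in> carrier (ga (sq G))" "\<Omega>' \<in> carrier (ga (sq G))"
    using d by (auto simp: M2.Units_closed)
  have inv: "invariant (group_algebra G) \<Omega>'" using d by simp
  note cl = push_homs[THEN hom_in_carrier]
  note mu = push_homs(1-4)[THEN hom_mult, OF c]
  have "leg23 (\<Omega> \<cdot>\<^sub>2 \<Omega>') \<cdot>\<^sub>3 cop2 (\<Omega> \<cdot>\<^sub>2 \<Omega>')
    = leg23 \<Omega> \<cdot>\<^sub>3 (leg23 \<Omega>' \<cdot>\<^sub>3 cop2 \<Omega>) \<cdot>\<^sub>3 cop2 \<Omega>'"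
    using cl c by (simp add: mu M3.m_assoc)
  also have "\<dots> = (leg23 \<Omega> \<cdot>\<^sub>3 cop2 \<Omega>) \<cdot>\<^sub>3
      (leg23 \<Omega>' \<cdot>\<^sub>3 cop2 \<Omega>')"
    using cl c leg23_cop2[OF inv, of \<Omega>] by (simp add: M3.m_assoc)
  also have "\<dots> = (leg12 \<Omega> \<cdot>\<^sub>3 cop1 \<Omega>) \<cdot>\<^sub>3
      (leg12 \<Omega>' \<cdot>\<^sub>3 cop1 \<Omega>')"
    using d by simp
  also have "\<dots> = leg12 \<Omega> \<cdot>\<^sub>3 (leg12 \<Omega>' \<cdot>\<^sub>3 cop1 \<Omega>) \<cdot>\<^sub>3 cop1 \<Omega>'"
    using cl c leg12_cop1[OF inv, of \<Omega>] by (simp add: M3.m_assoc)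
  also have "\<dots> = leg12 (\<Omega> \<cdot>\<^sub>2 \<Omega>') \<cdot>\<^sub>3 cop1 (\<Omega> \<cdot>\<^sub>2 \<Omega>')"
    using cl c by (simp add: mu M3.m_assoc)
  finally show ?thesis
    using d c cl finite_group.unitary_mult[OF sq]
    by (auto simp: cocycles_def two_cocycle_iff invariant_iff unitary2_iff intro!: M2.commute_mult)
qed

lemma cocycle_inv:
  assumes "\<Omega> \<in> cocycles"
  shows "inv\<^bsub>ga (sq G)\<^esub> \<Omega> \<in> cocycles"
proof -
  interpret M2: monoid "ga (sq G)" by (rule monoid2)
  interpret M3: monoid "ga (cube G)" by (rule monoid3)
  note d = assms[unfolded cocycles_def two_cocycle_iff, simplified]
  let ?I = "inv\<^bsub>ga (sq G)\<^esub> \<Omega>"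
  have u: "\<Omega> \<in> Units (ga (sq G))" and c: "\<Omega> \<in> carrier (ga (sq G))" "?I \<in> carrier (ga (sq G))"
    using d by (auto simp: M2.Units_closed)
  have inv: "invariant (group_algebra G) ?I"
    using d u push_homs(5)[THEN hom_in_carrier] by (auto simp: invariant_iff intro!: M2.inv_commute)
  have U: "leg23 \<Omega> \<in> Units (ga (cube G))" "leg12 \<Omega> \<in> Units (ga (cube G))"
      "cop2 \<Omega> \<in> Units (ga (cube G))" "cop1 \<Omega> \<in> Units (ga (cube G))"
    and I: "leg23 ?I = inv\<^bsub>ga (cube G)\<^esub> (leg23 \<Omega>)" "leg12 ?I = inv\<^bsub>ga (cube G)\<^esub> (leg12 \<Omega>)"
      "cop2 ?I = inv\<^bsub>ga (cube G)\<^esub> (cop2 \<Omega>)" "cop1 ?I = inv\<^bsub>ga (cube G)\<^esub> (cop1 \<Omega>)"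
    using hom_unit[OF monoid2 monoid3 push_homs(1) push_ones(1) u]
      hom_unit[OF monoid2 monoid3 push_homs(2) push_ones(2) u]
      hom_unit[OF monoid2 monoid3 push_homs(3) push_ones(3) u]
      hom_unit[OF monoid2 monoid3 push_homs(4) push_ones(4) u] by auto
  have "leg23 ?I \<cdot>\<^sub>3 cop2 ?I = cop2 ?I \<cdot>\<^sub>3 leg23 ?I"
    by (rule leg23_cop2[OF inv])
  also have "\<dots> = inv\<^bsub>ga (cube G)\<^esub> (leg23 \<Omega> \<cdot>\<^sub>3 cop2 \<Omega>)"
    using U by (simp add: I M3.Units_inv_mult)
  also have "\<dots> = inv\<^bsub>ga (cube G)\<^esub> (leg12 \<Omega> \<cdot>\<^sub>3 cop1 \<Omega>)"
    using d by simp
  also have "\<dots> = cop1 ?I \<cdot>\<^sub>3 leg12 ?I"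
    using U by (simp add: I M3.Units_inv_mult)
  also have "\<dots> = leg12 ?I \<cdot>\<^sub>3 cop1 ?I"
    by (rule leg12_cop1[OF inv, symmetric])
  finally show ?thesis
    using d u inv finite_group.unitary_adj[OF sq]
    by (auto simp: cocycles_def two_cocycle_iff unitary2_iff finite_group.unitary_Units[OF sq])
qed

lemma tens_mult:
  assumes "x \<in> carrier (ga G)" "y \<in> carrier (ga G)" "x' \<in> carrier (ga G)" "y' \<in> carrier (ga G)"
  shows "tens x y \<cdot>\<^sub>2 tens x' y' = tens (x \<cdot> x') (y \<cdot> y')"
proof -
  interpret G2: finite_group "sq G" by (rule sq)
  show ?thesis
  proof (rule ga_eqI[where G = "sq G"])
    fix f
    have "ev (sq G) (tens x y \<cdot>\<^sub>2 tens x' y') f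
       = ev G x (\<lambda>a. ev G y (\<lambda>b. ev G x' (\<lambda>a'. ev G y' (\<lambda>b'. f (a \<otimes> a', b \<otimes> b')))))"
      by (simp add: G2.ev_mult ev_tens)
    also have "\<dots> = ev G x (\<lambda>a. ev G x' (\<lambda>a'. ev G y (\<lambda>b. ev G y' (\<lambda>b'. f (a \<otimes> a', b \<otimes> b')))))"
      by (intro ev_cong ev_swap)
    also have "\<dots> = ev (sq G) (tens (x \<cdot> x') (y \<cdot> y')) f"
      by (simp add: ev_mult ev_tens)
    finally show "ev (sq G) (tens x y \<cdot>\<^sub>2 tens x' y') f
       = ev (sq G) (tens (x \<cdot> x') (y \<cdot> y')) f" .
  qed (auto intro: tens_closed ga_closed G2.ga_closed)
qed

lemma tens_unit: "tens \<one>\<^bsub>ga G\<^esub> \<one>\<^bsub>ga G\<^esub> = \<one>\<^bsub>ga (sq G)\<^esub>"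
  by (simp add: ga_sel tens_bvec)

lemma adj_tens:
  assumes "x \<in> carrier (ga G)" "y \<in> carrier (ga G)"
  shows "adj (sq G) (tens x y) = tens (adj G x) (adj G y)"
proof -
  interpret G2: finite_group "sq G" by (rule sq)
  show ?thesis
    using G2.adj_closed[of "tens x y"] tens_closed[OF adj_closed adj_closed, of x y]
    by (auto simp: fun_eq_iff ga_sel) (metis G2.adj_apply SigmaI adj_apply carrier_DirProd case_prod_conv complex_cnj_mult inv_DirProd is_group tens_def)
qed

lemma tens_Units:
  assumes "x \<in> Units (ga G)" "y \<in> Units (ga G)"
  shows "tens x y \<in> Units (ga (sq G))"
    and "inv\<^bsub>ga (sq G)\<^esub> (tens x y) = tens (inv\<^bsub>ga G\<^esub> x) (inv\<^bsub>ga G\<^esub> y)"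
proof -
  interpret M: monoid "ga G" by (rule monoid_ga)
  interpret M2: monoid "ga (sq G)" by (rule monoid2)
  have e: "tens x y \<cdot>\<^sub>2 tens (inv\<^bsub>ga G\<^esub> x) (inv\<^bsub>ga G\<^esub> y) = \<one>\<^bsub>ga (sq G)\<^esub>"
    "tens (inv\<^bsub>ga G\<^esub> x) (inv\<^bsub>ga G\<^esub> y) \<cdot>\<^sub>2 tens x y = \<one>\<^bsub>ga (sq G)\<^esub>"
    using assms by (simp_all add: tens_mult tens_unit M.Units_closed)
  have c: "tens x y \<in> carrier (ga (sq G))" "tens (inv\<^bsub>ga G\<^esub> x) (inv\<^bsub>ga G\<^esub> y) \<in> carrier (ga (sq G))"
    using assms by (auto intro!: tens_closed M.Units_closed)
  show "tens x y \<in> Units (ga (sq G))" using e c by (auto simp: Units_def)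
  show "inv\<^bsub>ga (sq G)\<^esub> (tens x y) = tens (inv\<^bsub>ga G\<^esub> x) (inv\<^bsub>ga G\<^esub> y)"
    using M2.inv_unique'[OF c e] by simp
qed

lemma diag_Units:
  assumes "x \<in> Units (ga G)"
  shows "diag x \<in> Units (ga (sq G))" "diag (inv\<^bsub>ga G\<^esub> x) = inv\<^bsub>ga (sq G)\<^esub> (diag x)"
  using hom_unit[OF monoid_ga monoid2 push_homs(5) push_ones(5) assms] by auto

lemma cocycles_subgroup: "subgroup cocycles (units_of (ga (sq G)))"
proof -
  interpret M2: monoid "ga (sq G)" by (rule monoid2)
  interpret M3: monoid "ga (cube G)" by (rule monoid3)
  have one: "\<one>\<^bsub>ga (sq G)\<^esub> \<in> cocycles"
    using push_homs(5)[THEN hom_in_carrier] finite_group.unitary_one[OF sq]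
    by (auto simp: cocycles_def two_cocycle_iff invariant_iff unitary2_iff push_ones)
  show ?thesis
    by (rule subgroup.intro)
      (use one in \<open>auto simp: cocycles_def two_cocycle_iff units_of_carrier units_of_mult
        units_of_one M2.units_of_inv\<close>,
       use cocycle_mult cocycle_inv in \<open>auto simp: cocycles_def two_cocycle_iff\<close>)
qed

lemma group_A2u: "group (A2u (group_algebra G))"
  unfolding A2u_group_algebra
  by (rule subgroup.subgroup_is_group[OF cocycles_subgroup monoid.units_group[OF monoid2]])

section \<open>Coboundaries of unitaries that normalize the group\<close>

lemma commute_push:
  assumes "finite_group H" "\<And>g. g \<in> carrier G \<Longrightarrow> \<phi> g \<in> carrier H"
    and "\<And>g. g \<in> carrier G \<Longrightarrow> x \<otimes>\<^bsub>ga H\<^esub> bvec (\<phi> g) = bvec (\<phi> g) \<otimes>\<^bsub>ga H\<^esub> x"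
  shows "x \<otimes>\<^bsub>ga H\<^esub> push G \<phi> a = push G \<phi> a \<otimes>\<^bsub>ga H\<^esub> x"
proof -
  interpret H: finite_group H by fact
  show ?thesis
  proof (rule ga_eqI[where G = H])
    fix f
    have "ev H (x \<otimes>\<^bsub>ga H\<^esub> push G \<phi> a) f = ev H x (\<lambda>p. ev G a (\<lambda>g. f (p \<otimes>\<^bsub>H\<^esub> \<phi> g)))"
      using assms(2) by (simp add: H.ev_mult ev_push)
    also have "\<dots> = ev G a (\<lambda>g. ev H x (\<lambda>p. f (p \<otimes>\<^bsub>H\<^esub> \<phi> g)))"
      by (rule ev_swap)
    also have "\<dots> = ev G a (\<lambda>g. ev H (x \<otimes>\<^bsub>ga H\<^esub> bvec (\<phi> g)) f)"
      using assms(2) by (auto intro!: ev_cong simp: H.ev_mult ev_bvec)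
    also have "\<dots> = ev G a (\<lambda>g. ev H (bvec (\<phi> g) \<otimes>\<^bsub>ga H\<^esub> x) f)"
      using assms(3) by (auto intro!: ev_cong)
    also have "\<dots> = ev H (push G \<phi> a \<otimes>\<^bsub>ga H\<^esub> x) f"
      using assms(2) by (auto intro!: ev_cong simp: H.ev_mult ev_bvec ev_push)
    finally show "ev H (x \<otimes>\<^bsub>ga H\<^esub> push G \<phi> a) f = ev H (push G \<phi> a \<otimes>\<^bsub>ga H\<^esub> x) f" .
  qed (auto simp: H.ga_closed)
qed

lemma push_id: "x \<in> carrier (ga G) \<Longrightarrow> push G (\<lambda>g. g) x = x"
  by (rule ga_eqI[where G = G]) (auto simp: ev_push intro: push_closed)

lemma commute_all:
  assumes "\<And>g. g \<in> carrier G \<Longrightarrow> x \<cdot> bvec g = bvec g \<cdot> x" "y \<in> carrier (ga G)"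
  shows "x \<cdot> y = y \<cdot> x"
  using commute_push[OF finite_group_axioms, of "\<lambda>g. g" x y] assms by (simp add: push_id)

lemma tens_eq_push:
  assumes "x \<in> carrier (ga G)" "y \<in> carrier (ga G)"
  shows "tens x y = push G (\<lambda>g. (g, \<one>)) x \<cdot>\<^sub>2 push G (Pair \<one>) y"
    and "tens x y = push G (Pair \<one>) y \<cdot>\<^sub>2 push G (\<lambda>g. (g, \<one>)) x"
proof -
  interpret G2: finite_group "sq G" by (rule sq)
  show *: "tens x y = push G (\<lambda>g. (g, \<one>)) x \<cdot>\<^sub>2 push G (Pair \<one>) y"
  proof (rule ga_eqI[where G = "sq G"])
    fix f
    show "ev (sq G) (tens x y) f
      = ev (sq G) (push G (\<lambda>g. (g, \<one>)) x \<cdot>\<^sub>2 push G (Pair \<one>) y) f"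
      by (auto simp: ev_tens G2.ev_mult ev_push intro!: ev_cong)
  qed (use assms in \<open>auto intro: tens_closed G2.ga_closed\<close>)
  show "tens x y = push G (Pair \<one>) y \<cdot>\<^sub>2 push G (\<lambda>g. (g, \<one>)) x"
    unfolding * by (rule push_commute) (auto intro: sq)
qed

abbreviation bd :: "('a \<Rightarrow> complex) \<Rightarrow> 'a \<times> 'a \<Rightarrow> complex" where
  "bd \<equiv> coboundary (group_algebra G)"

text \<open>
  Both sides equal \<open>(v \<otimes> v \<otimes> v) \<Delta>\<^sup>2(v\<^sup>-\<^sup>1)\<close>, where \<open>\<Delta>\<^sup>2\<close> is the iterated coproduct. On each side the factor
  \<open>\<Delta>(v\<^sup>-\<^sup>1)\<close> coming from the first cochain cancels against \<open>\<Delta>(v)\<close> coming from the second, provided the two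
  commuting factors of \<open>v \<otimes> v\<close> are written in the right order there.
\<close>
lemma bd_cocycle_equation:
  assumes v: "v \<in> Units (ga G)"
  shows "leg23 (bd v) \<cdot>\<^sub>3 cop2 (bd v) = leg12 (bd v) \<cdot>\<^sub>3 cop1 (bd v)"
proof -
  interpret M: monoid "ga G" by (rule monoid_ga)
  interpret M2: monoid "ga (sq G)" by (rule monoid2)
  interpret M3: monoid "ga (cube G)" by (rule monoid3)
  interpret G2: finite_group "sq G" by (rule sq)
  interpret G3: finite_group "cube G" by (rule cube)
  let ?w = "inv\<^bsub>ga G\<^esub> v"
  let ?j1 = "push G (\<lambda>g. (g, \<one>, \<one>)) v"
  let ?j2 = "push G (\<lambda>g. (\<one>, g, \<one>)) v"
  let ?j3 = "push G (\<lambda>g. (\<one>, \<one>, g)) v"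
  let ?D = "push G (\<lambda>g. (g, g, g)) ?w"
  have vc: "v \<in> carrier (ga G)" "?w \<in> carrier (ga G)"
    using v by (auto simp: M.Units_closed)
  have c2: "push G (\<lambda>g. (g, \<one>)) v \<in> carrier (ga (sq G))" "push G (Pair \<one>) v \<in> carrier (ga (sq G))"
    "diag ?w \<in> carrier (ga (sq G))" by (auto intro!: push_closed)
  have c3: "push G (\<lambda>g. (\<one>, g, g)) x \<in> carrier (ga (cube G))"
     "push G (\<lambda>g. (g, g, \<one>)) x \<in> carrier (ga (cube G))"
     "push G (\<lambda>g. (g, g, g)) x \<in> carrier (ga (cube G))"
     "?j1 \<in> carrier (ga (cube G))" "?j2 \<in> carrier (ga (cube G))" "?j3 \<in> carrier (ga (cube G))" for x
    by (auto intro!: push_closed)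
  note mu = push_homs(1-4)[THEN hom_mult]
  have pp: "push (sq G) \<psi> (push G \<phi> x) = push G (\<lambda>g. \<psi> (\<phi> g)) x"
    if "\<And>g. g \<in> carrier G \<Longrightarrow> \<phi> g \<in> carrier (sq G)" "\<psi> \<in> hom (sq G) (cube G)" for \<phi> \<psi> x
    by (rule push_push[where K = "cube G"]) (use that in \<open>auto simp: hom_def\<close>)
  have inv1: "push G \<phi> ?w \<cdot>\<^sub>3 push G \<phi> v = \<one>\<^bsub>ga (cube G)\<^esub>"
    if "\<phi> \<in> hom G (cube G)" for \<phi>
    using hom_mult[OF push_hom(1)[OF finite_group_axioms cube that] vc(2,1)] v
      push_hom(2)[OF finite_group_axioms cube that] by simp
  have i: "push G (\<lambda>g. (\<one>, g, g)) ?w \<cdot>\<^sub>3 push G (\<lambda>g. (\<one>, g, g)) v = \<one>\<^bsub>ga (cube G)\<^esub>"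
    "push G (\<lambda>g. (g, g, \<one>)) ?w \<cdot>\<^sub>3 push G (\<lambda>g. (g, g, \<one>)) v = \<one>\<^bsub>ga (cube G)\<^esub>"
    by (rule inv1, auto simp: hom_def)+
  have "leg23 (bd v) = ?j2 \<cdot>\<^sub>3 ?j3 \<cdot>\<^sub>3 push G (\<lambda>g. (\<one>, g, g)) ?w"
    using c2 unfolding coboundary_eq tens_eq_push(1)[OF vc(1) vc(1)] by (simp add: mu pp homs)
  moreover have "cop2 (bd v) = push G (\<lambda>g. (\<one>, g, g)) v \<cdot>\<^sub>3 ?j1 \<cdot>\<^sub>3 ?D"
    using c2 unfolding coboundary_eq tens_eq_push(2)[OF vc(1) vc(1)] by (simp add: mu pp homs)
  ultimately have "leg23 (bd v) \<cdot>\<^sub>3 cop2 (bd v)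
     = ?j2 \<cdot>\<^sub>3 ?j3 \<cdot>\<^sub>3 (push G (\<lambda>g. (\<one>, g, g)) ?w \<cdot>\<^sub>3
       push G (\<lambda>g. (\<one>, g, g)) v) \<cdot>\<^sub>3 ?j1 \<cdot>\<^sub>3 ?D"
    using c3 by (simp add: M3.m_assoc)
  also have "\<dots> = (?j2 \<cdot>\<^sub>3 ?j3) \<cdot>\<^sub>3 ?j1 \<cdot>\<^sub>3 ?D"
    using c3 by (simp add: i)
  also have "(?j2 \<cdot>\<^sub>3 ?j3) \<cdot>\<^sub>3 ?j1 = ?j1 \<cdot>\<^sub>3 (?j2 \<cdot>\<^sub>3 ?j3)"
    by (rule M3.commute_mult) (use c3 in \<open>auto intro!: push_commute cube\<close>)
  also have "\<dots> \<cdot>\<^sub>3 ?D = ?j1 \<cdot>\<^sub>3 ?j2 \<cdot>\<^sub>3 (push G (\<lambda>g. (g, g, \<one>)) ?w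
      \<cdot>\<^sub>3 push G (\<lambda>g. (g, g, \<one>)) v) \<cdot>\<^sub>3 ?j3 \<cdot>\<^sub>3 ?D"
    using c3 by (simp add: i M3.m_assoc)
  also have "\<dots> = leg12 (bd v) \<cdot>\<^sub>3 cop1 (bd v)"
  proof -
    have "leg12 (bd v) = ?j1 \<cdot>\<^sub>3 ?j2 \<cdot>\<^sub>3 push G (\<lambda>g. (g, g, \<one>)) ?w"
      using c2 unfolding coboundary_eq tens_eq_push(1)[OF vc(1) vc(1)] by (simp add: mu pp homs)
    moreover have "cop1 (bd v) = push G (\<lambda>g. (g, g, \<one>)) v \<cdot>\<^sub>3 ?j3 \<cdot>\<^sub>3 ?D"
      using c2 unfolding coboundary_eq tens_eq_push(1)[OF vc(1) vc(1)] by (simp add: mu pp homs)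
    ultimately show ?thesis using c3 by (simp add: M3.m_assoc)
  qed
  finally show ?thesis .
qed

text \<open>
  These are the unitaries that implement an automorphism of the group; \<open>h\<close> is the image of \<open>g\<close>.
\<close>
definition normalizes :: "('a \<Rightarrow> complex) \<Rightarrow> bool" where
  "normalizes v \<longleftrightarrow> alg_unitary (group_algebra G) v \<and>
    (\<forall>g\<in>carrier G. \<exists>h\<in>carrier G. bvec g \<cdot> v = v \<cdot> bvec h)"

lemma unitary_tens:
  assumes "alg_unitary (group_algebra G) v" "alg_unitary (group_algebra G) w"
  shows "alg_unitary (group_algebra (sq G)) (tens v w)"
  using assms finite_group.unitary_iff[OF sq] unitary_iff
  by (auto simp: adj_tens tens_mult adj_closed tens_unit tens_closed)

lemma unitary_diag:
  assumes "alg_unitary (group_algebra G) v"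
  shows "alg_unitary (group_algebra (sq G)) (diag v)"
  using assms push_homs(5) hom_mult[OF push_homs(5), symmetric] finite_group.unitary_iff[OF sq] unitary_iff
  by (auto simp: push_adj[OF finite_group_axioms sq homs(5)] push_ones adj_closed hom_in_carrier)

lemma bd_closed:
  assumes "v \<in> Units (ga G)"
  shows "bd v \<in> Units (ga (sq G))" "bd v \<in> carrier (ga (sq G))"
proof -
  interpret M: monoid "ga G" by (rule monoid_ga)
  interpret M2: monoid "ga (sq G)" by (rule monoid2)
  show "bd v \<in> Units (ga (sq G))"
    using assms tens_Units[of v v] diag_Units[of v] by (simp add: coboundary_eq)
  then show "bd v \<in> carrier (ga (sq G))" by (rule M2.Units_closed)
qed

lemma bd_invariant:
  assumes "normalizes v"
  shows "invariant (group_algebra G) (bd v)"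
proof -
  interpret M: monoid "ga G" by (rule monoid_ga)
  interpret M2: monoid "ga (sq G)" by (rule monoid2)
  interpret G2: finite_group "sq G" by (rule sq)
  have u: "v \<in> Units (ga G)"
    using assms unitary_Units by (auto simp: normalizes_def)
  let ?w = "inv\<^bsub>ga G\<^esub> v"
  have c: "v \<in> carrier (ga G)" "?w \<in> carrier (ga G)" using u by (auto simp: M.Units_closed)
  have "bd v \<cdot>\<^sub>2 bvec (g, g) = bvec (g, g) \<cdot>\<^sub>2 bd v" if g: "g \<in> carrier G" for g
  proof -
    obtain h where h: "h \<in> carrier G" "bvec g \<cdot> v = v \<cdot> bvec h"
      using assms g by (auto simp: normalizes_def)
    have b: "bvec g \<in> carrier (ga G)" "bvec h \<in> carrier (ga G)" using g h bvec_closed by auto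
    have t: "tens v v \<in> carrier (ga (sq G))" "bvec (g, g) \<in> carrier (ga (sq G))"
      "bvec (h, h) \<in> carrier (ga (sq G))" "diag x \<in> carrier (ga (sq G))" for x
      using c g h G2.bvec_closed by (auto intro!: tens_closed push_closed)
    have "?w \<cdot> bvec g = ?w \<cdot> (bvec g \<cdot> v) \<cdot> ?w"
      using b c u by (simp add: M.m_assoc)
    also have "\<dots> = (?w \<cdot> v) \<cdot> bvec h \<cdot> ?w"
      unfolding h(2) using b c by (simp add: M.m_assoc)
    also have "\<dots> = bvec h \<cdot> ?w" using b c u by simp
    finally have *: "?w \<cdot> bvec g = bvec h \<cdot> ?w" .
    have "bvec (g, g) \<cdot>\<^sub>2 bd v
      = (tens (bvec g) (bvec g) \<cdot>\<^sub>2 tens v v) \<cdot>\<^sub>2 diag ?w"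
      using t by (simp add: coboundary_eq M2.m_assoc tens_bvec)
    also have "\<dots> = (tens v v \<cdot>\<^sub>2 tens (bvec h) (bvec h)) \<cdot>\<^sub>2 diag ?w"
      using b c h by (simp add: tens_mult)
    also have "\<dots> = tens v v \<cdot>\<^sub>2 (diag (bvec h) \<cdot>\<^sub>2 diag ?w)"
      using t h by (simp add: M2.m_assoc tens_bvec push_bvec)
    also have "diag (bvec h) \<cdot>\<^sub>2 diag ?w = diag (?w \<cdot> bvec g)"
      using b c by (simp add: * hom_mult[OF push_homs(5)])
    also have "\<dots> = diag ?w \<cdot>\<^sub>2 bvec (g, g)"
      using b c g by (simp add: hom_mult[OF push_homs(5)] push_bvec)
    finally show ?thesis
      using t by (simp add: coboundary_eq M2.m_assoc)
  qed
  then show ?thesis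
    using commute_push[OF sq, of "\<lambda>g. (g, g)" "bd v"] by (simp add: invariant_iff)
qed

lemma bd_in_cocycles:
  assumes "normalizes v"
  shows "bd v \<in> cocycles"
proof -
  interpret G2: finite_group "sq G" by (rule sq)
  have v: "alg_unitary (group_algebra G) v" using assms by (simp add: normalizes_def)
  have "alg_unitary (group_algebra (sq G)) (bd v)"
    using v unfolding coboundary_eq
    by (intro G2.unitary_mult unitary_tens unitary_diag) (simp_all add: unitary_Units unitary_adj)
  then show ?thesis
    using v bd_cocycle_equation bd_invariant[OF assms] bd_closed unitary_Units
    by (simp add: cocycles_def two_cocycle_iff unitary2_iff)
qed

text \<open>
  Comparison of coefficients at \<open>(g, h)\<close> shows that two different coefficients of \<open>x\<close> cannot both be nonzero
  and that a nonzero coefficient equals its square.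
\<close>
lemma grouplike:
  assumes "x \<in> carrier (ga G)" "diag x = tens x x" "x g \<noteq> 0"
  shows "x = bvec g"
proof
  fix h
  have d: "diag x (a, b) = (if a = b then x a else 0)" if "a \<in> carrier G" "b \<in> carrier G" for a b
  proof -
    have "diag x (a, b) = ev (sq G) (diag x) (bvec (a, b))"
      using that by (simp add: ev_bvec_right)
    also have "\<dots> = ev G x (\<lambda>g. bvec (a, b) (g, g))" by (subst ev_push) auto
    also have "\<dots> = ev G x (\<lambda>g. if a = b then bvec a g else 0)"
      by (rule ev_cong) (auto simp: bvec_def)
    finally show ?thesis using that by (simp add: ev_bvec_right ev_def[of G x "\<lambda>_. 0"])
  qed
  have g: "g \<in> carrier G" using assms by (auto simp: ga_sel)
  show "x h = bvec g h"
  proof (cases "h \<in> carrier G")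
    case True
    then have "x g * x h = (if g = h then x g else 0)"
      using d[OF g True] assms(2) by (simp add: tens_def)
    then show ?thesis using assms(3) by (auto simp: bvec_def split: if_splits)
  next
    case False
    then show ?thesis using assms(1) g by (auto simp: ga_sel bvec_def)
  qed
qed

text \<open>
  Commutation of \<open>(v \<otimes> v) \<Delta>(v\<^sup>-\<^sup>1)\<close> with \<open>\<Delta>(g)\<close> can be rearranged to
  \<open>\<Delta>(v\<^sup>-\<^sup>1 g v) = v\<^sup>-\<^sup>1 g v \<otimes> v\<^sup>-\<^sup>1 g v\<close>, and group-like elements lie in the group.
\<close>
lemma invariant_bd_normalizes:
  assumes v: "alg_unitary (group_algebra G) v" and inv: "invariant (group_algebra G) (bd v)"
  shows "normalizes v"
proof -
  interpret M: monoid "ga G" by (rule monoid_ga)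
  interpret M2: monoid "ga (sq G)" by (rule monoid2)
  have u: "v \<in> Units (ga G)" using v unitary_Units by simp
  let ?w = "inv\<^bsub>ga G\<^esub> v"
  have c: "v \<in> carrier (ga G)" "?w \<in> carrier (ga G)" using u by (auto simp: M.Units_closed)
  have "\<exists>h\<in>carrier G. bvec g \<cdot> v = v \<cdot> bvec h" if g: "g \<in> carrier G" for g
  proof -
    let ?x = "?w \<cdot> (bvec g \<cdot> v)"
    have b: "bvec g \<in> carrier (ga G)" using g bvec_closed by auto
    have t: "tens v v \<in> carrier (ga (sq G))" "diag x \<in> carrier (ga (sq G))"
       "tens ?w ?w \<in> carrier (ga (sq G))" for x
      using c g by (auto intro!: tens_closed push_closed)
    have x: "?x \<in> carrier (ga G)" using b c by simp
    have vx: "v \<cdot> ?x = bvec g \<cdot> v"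
      using b c u by (simp flip: M.m_assoc)
    have i: "tens ?w ?w \<cdot>\<^sub>2 tens v v = \<one>\<^bsub>ga (sq G)\<^esub>"
      using c u by (simp add: tens_mult tens_unit)
    have i2: "diag ?w \<cdot>\<^sub>2 diag v = \<one>\<^bsub>ga (sq G)\<^esub>"
      using c u push_ones(5) by (simp flip: hom_mult[OF push_homs(5)])
    have "diag ?x = tens ?w ?w \<cdot>\<^sub>2 tens v v \<cdot>\<^sub>2 (diag ?w \<cdot>\<^sub>2 (diag (bvec g) \<cdot>\<^sub>2 diag v))"
      using t b c by (simp add: i hom_mult[OF push_homs(5)])
    also have "\<dots> = tens ?w ?w \<cdot>\<^sub>2 (bd v \<cdot>\<^sub>2 diag (bvec g)) \<cdot>\<^sub>2 diag v"
      using t by (simp add: coboundary_eq M2.m_assoc)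
    also have "bd v \<cdot>\<^sub>2 diag (bvec g) = diag (bvec g) \<cdot>\<^sub>2 bd v"
      using inv b by (simp add: invariant_iff)
    also have "tens ?w ?w \<cdot>\<^sub>2 (diag (bvec g) \<cdot>\<^sub>2 bd v) \<cdot>\<^sub>2 diag v
      = tens ?w ?w \<cdot>\<^sub>2 (diag (bvec g) \<cdot>\<^sub>2 (tens v v \<cdot>\<^sub>2 (diag ?w \<cdot>\<^sub>2 diag v)))"
      using t by (simp add: coboundary_eq M2.m_assoc)
    also have "\<dots> = tens ?w ?w \<cdot>\<^sub>2 (tens (bvec g) (bvec g) \<cdot>\<^sub>2 tens v v)"
      using t g by (simp add: i2 push_bvec tens_bvec)
    also have "\<dots> = tens ?x ?x"
      using b c by (simp add: tens_mult)
    finally have gl: "diag ?x = tens ?x ?x" .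
    have "\<exists>h. ?x h \<noteq> 0"
    proof (rule ccontr)
      assume "\<not> ?thesis"
      then have x0: "?x = (\<lambda>_. 0)" by auto
      have 1: "bvec (inv g) \<cdot> (v \<cdot> ?x) \<cdot> ?w = \<one>\<^bsub>ga G\<^esub>"
        unfolding vx using b c u g bvec_closed[of "inv g"]
        by (simp add: M.m_assoc bvec_mult ga_sel(2))
      have "ev G (bvec (inv g) \<cdot> (v \<cdot> ?x) \<cdot> ?w) (\<lambda>_. 1) = 0"
        unfolding x0 ev_mult by (simp add: ev_def)
      then show False unfolding 1 by (simp add: ga_sel(2) ev_bvec)
    qed
    then obtain h where h: "?x h \<noteq> 0" by auto
    have "h \<in> carrier G" using h x unfolding ga_sel by blast
    then show ?thesis using grouplike[OF x gl h] vx by (intro bexI[of _ h]) simp_all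
  qed
  then show ?thesis using v by (simp add: normalizes_def)
qed

end

section \<open>The product on functions twisted by a cocycle\<close>

lemma (in finite_group) sum_shift:
  assumes "g \<in> carrier G"
  shows "(\<Sum>x\<in>carrier G. f (g \<otimes> x)) = (\<Sum>x\<in>carrier G. f x)"
    and "(\<Sum>x\<in>carrier G. f (x \<otimes> g)) = (\<Sum>x\<in>carrier G. f x)"
proof -
  show "(\<Sum>x\<in>carrier G. f (g \<otimes> x)) = (\<Sum>x\<in>carrier G. f x)"
    by (rule sum.reindex_bij_witness[of _ "\<lambda>x. inv g \<otimes> x" "\<lambda>x. g \<otimes> x"])
      (use assms in \<open>auto simp flip: m_assoc\<close>)
  show "(\<Sum>x\<in>carrier G. f (x \<otimes> g)) = (\<Sum>x\<in>carrier G. f x)"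
    by (rule sum.reindex_bij_witness[of _ "\<lambda>x. x \<otimes> inv g" "\<lambda>x. x \<otimes> g"])
      (use assms in \<open>auto simp: m_assoc\<close>)
qed

locale twisting = finite_group +
  fixes \<Omega> :: "'a \<times> 'a \<Rightarrow> complex"
  assumes cocycle: "\<Omega> \<in> cocycles"
begin

text \<open>
  The convolution product dual to the map \<open>x \<mapsto> \<Omega> \<Delta>(x)\<close>. The value 0 outside the carrier makes products
  comparable as functions on the whole type.
\<close>
definition star (infixl "\<star>" 70) where
  "f \<star> h = (\<lambda>x. if x \<in> carrier G then ev (sq G) \<Omega> (\<lambda>(a, b). f (a \<otimes> x) * h (b \<otimes> x)) else 0)"

lemma star_closed: "f \<star> h \<in> carrier (ga G)"
  by (simp add: star_def ga_sel)

lemma star_cong: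
  assumes "\<And>x. x \<in> carrier G \<Longrightarrow> f x = f' x" "\<And>x. x \<in> carrier G \<Longrightarrow> h x = h' x"
  shows "f \<star> h = f' \<star> h'"
  using assms by (auto simp: star_def fun_eq_iff intro!: ev_cong)

lemma star_scale_left: "(\<lambda>x. c * f x) \<star> h = (\<lambda>x. c * (f \<star> h) x)"
  by (auto simp: star_def fun_eq_iff case_prod_unfold mult.assoc ev_scale)

lemma star_scale_right: "f \<star> (\<lambda>x. c * h x) = (\<lambda>x. c * (f \<star> h) x)"
  by (auto simp: star_def fun_eq_iff case_prod_unfold mult.left_commute ev_scale)

lemma star_add_left: "(\<lambda>x. f x + f' x) \<star> h = (\<lambda>x. (f \<star> h) x + (f' \<star> h) x)"
  by (auto simp: star_def fun_eq_iff case_prod_unfold ring_distribs ev_def sum.distrib)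

lemma star_add_right: "f \<star> (\<lambda>x. h x + h' x) = (\<lambda>x. (f \<star> h) x + (f \<star> h') x)"
  by (auto simp: star_def fun_eq_iff case_prod_unfold ring_distribs ev_def sum.distrib)

lemma star_zero_left: "(\<lambda>x. 0) \<star> h = (\<lambda>x. 0)"
  by (auto simp: star_def fun_eq_iff case_prod_unfold ev_def)

lemma star_zero_right: "h \<star> (\<lambda>x. 0) = (\<lambda>x. 0)"
  by (auto simp: star_def fun_eq_iff case_prod_unfold ev_def)

lemma star_sum_left: "(\<lambda>x. \<Sum>i\<in>I. f i x) \<star> h = (\<lambda>x. \<Sum>i\<in>I. (f i \<star> h) x)"
  by (induction I rule: infinite_finite_induct) (simp_all add: star_zero_left star_add_left)

lemma star_sum_right: "f \<star> (\<lambda>x. \<Sum>i\<in>I. h i x) = (\<lambda>x. \<Sum>i\<in>I. (f \<star> h i) x)"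
  by (induction I rule: infinite_finite_induct) (simp_all add: star_zero_right star_add_right)

lemma cocycleD:
  "\<Omega> \<in> carrier (ga (sq G))" "\<Omega> \<in> Units (ga (sq G))" "invariant (group_algebra G) \<Omega>"
  "alg_unitary (group_algebra (sq G)) \<Omega>"
  "leg23 \<Omega> \<cdot>\<^sub>3 cop2 \<Omega> = leg12 \<Omega> \<cdot>\<^sub>3 cop1 \<Omega>"
  using cocycle monoid.Units_closed[OF monoid2]
  by (auto simp: cocycles_def two_cocycle_iff unitary2_iff)

text \<open>
  Both sides at \<open>x\<close> are pairings of the function \<open>(a, b, c) \<mapsto> f(a x) h(b x) k(c x)\<close> with one side of the
  cocycle equation.
\<close>
lemma star_assoc: "f \<star> h \<star> k = f \<star> (h \<star> k)"
proof
  fix x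
  interpret G2: finite_group "sq G" by (rule sq)
  interpret G3: finite_group "cube G" by (rule cube)
  show "(f \<star> h \<star> k) x = (f \<star> (h \<star> k)) x"
  proof (cases "x \<in> carrier G")
    case x: True
    let ?F = "\<lambda>(p, q, s). f (p \<otimes> x) * h (q \<otimes> x) * k (s \<otimes> x)"
    have "(f \<star> h \<star> k) x = ev (sq G) \<Omega> (\<lambda>q. ev (sq G) \<Omega> (\<lambda>p.
        f (fst p \<otimes> fst q \<otimes> x) * h (snd p \<otimes> fst q \<otimes> x) * k (snd q \<otimes> x)))"
      unfolding star_def[of "f \<star> h"] if_P[OF x]
    proof (rule ev_cong)
      fix q assume "q \<in> carrier (sq G)"
      then show "(case q of (a, b) \<Rightarrow> (f \<star> h) (a \<otimes> x) * k (b \<otimes> x)) = ev (sq G) \<Omega> (\<lambda>p.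
          f (fst p \<otimes> fst q \<otimes> x) * h (snd p \<otimes> fst q \<otimes> x) * k (snd q \<otimes> x))"
        using x by (auto simp: star_def m_assoc mult.commute[of _ "k _"] case_prod_unfold intro!: ev_cong simp flip: ev_scale)
    qed
    also have "\<dots> = ev (sq G) \<Omega> (\<lambda>p. ev (sq G) \<Omega> (\<lambda>q.
        f (fst p \<otimes> fst q \<otimes> x) * h (snd p \<otimes> fst q \<otimes> x) * k (snd q \<otimes> x)))"
      by (rule ev_swap)
    also have "\<dots> = ev (cube G) (leg12 \<Omega> \<cdot>\<^sub>3 cop1 \<Omega>) ?F"
      by (subst G3.ev_mult, subst ev_push, force+, rule ev_cong, subst ev_push, force+)
        (auto intro!: ev_cong)
    also have "\<dots> = ev (cube G) (leg23 \<Omega> \<cdot>\<^sub>3 cop2 \<Omega>) ?F"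
      by (simp add: cocycleD(5))
    also have "\<dots> = ev (sq G) \<Omega> (\<lambda>p. ev (sq G) \<Omega> (\<lambda>q.
        f (fst q \<otimes> x) * h (fst p \<otimes> snd q \<otimes> x) * k (snd p \<otimes> snd q \<otimes> x)))"
      by (subst G3.ev_mult, subst ev_push, force+, rule ev_cong, subst ev_push, force+)
        (auto intro!: ev_cong)
    also have "\<dots> = ev (sq G) \<Omega> (\<lambda>q. ev (sq G) \<Omega> (\<lambda>p.
        f (fst q \<otimes> x) * h (fst p \<otimes> snd q \<otimes> x) * k (snd p \<otimes> snd q \<otimes> x)))"
      by (rule ev_swap)
    also have "\<dots> = (f \<star> (h \<star> k)) x"
      unfolding star_def[of "f"] if_P[OF x]
    proof (rule ev_cong)
      fix q assume "q \<in> carrier (sq G)"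
      then show "ev (sq G) \<Omega> (\<lambda>p.
          f (fst q \<otimes> x) * h (fst p \<otimes> snd q \<otimes> x) * k (snd p \<otimes> snd q \<otimes> x))
        = (case q of (a, b) \<Rightarrow> f (a \<otimes> x) * (h \<star> k) (b \<otimes> x))"
        using x by (auto simp: star_def m_assoc mult.assoc case_prod_unfold intro!: ev_cong simp flip: ev_scale)
    qed
    finally show ?thesis .
  qed (simp add: star_def)
qed

text \<open>
  Eigenfunctions of right translation by \<open>r\<close>. This translation is an automorphism of the twisted product, so
  eigenvalues multiply.
\<close>
definition eig :: "'a \<Rightarrow> complex \<Rightarrow> ('a \<Rightarrow> complex) \<Rightarrow> bool" where
  "eig r q f \<longleftrightarrow> f \<in> carrier (ga G) \<and> (\<forall>x\<in>carrier G. f (x \<otimes> r) = q * f x)"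

lemma eig_star:
  assumes "r \<in> carrier G" "eig r q f" "eig r q' h"
  shows "eig r (q * q') (f \<star> h)"
proof -
  have "(f \<star> h) (x \<otimes> r) = q * q' * (f \<star> h) x" if x: "x \<in> carrier G" for x
    using assms x by (auto simp: star_def eig_def mult_ac intro!: ev_cong simp flip: ev_scale m_assoc)
  then show ?thesis by (simp add: eig_def star_closed)
qed

lemma cocycle_conj:
  assumes "g \<in> carrier G" "a \<in> carrier G" "b \<in> carrier G"
  shows "\<Omega> (g \<otimes> a \<otimes> inv g, g \<otimes> b \<otimes> inv g) = \<Omega> (a, b)"
proof -
  have "\<Omega> (g \<otimes> a \<otimes> inv g, g \<otimes> b \<otimes> inv g)
      = ev (sq G) \<Omega> (bvec (g \<otimes> a \<otimes> inv g, g \<otimes> b \<otimes> inv g))"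
    using assms by (simp add: ev_bvec_right)
  also have "\<dots> = ev (sq G) \<Omega> (\<lambda>(c, d). bvec (g \<otimes> a, g \<otimes> b) (c \<otimes> g, d \<otimes> g))"
  proof (rule ev_cong)
    fix p assume "p \<in> carrier (sq G)"
    moreover have "c \<otimes> g = g \<otimes> x \<longleftrightarrow> c = g \<otimes> x \<otimes> inv g" if "c \<in> carrier G" "x \<in> carrier G" for c x
      using assms that inv_solve_right[of c "g \<otimes> x" g] by auto
    ultimately show "bvec (g \<otimes> a \<otimes> inv g, g \<otimes> b \<otimes> inv g) p
      = (case p of (c, d) \<Rightarrow> bvec (g \<otimes> a, g \<otimes> b) (c \<otimes> g, d \<otimes> g))"
      using assms by (auto simp: bvec_def)
  qed
  also have "\<dots> = ev (sq G) \<Omega> (\<lambda>(c, d). bvec (g \<otimes> a, g \<otimes> b) (g \<otimes> c, g \<otimes> d))"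
    by (rule invariant_ev) (use assms cocycleD in auto)
  also have "\<dots> = ev (sq G) \<Omega> (bvec (a, b))"
    using assms by (intro ev_cong) (auto simp: bvec_def)
  finally show ?thesis using assms by (simp add: ev_bvec_right)
qed

end

section \<open>Functions that are odd under a central involution\<close>

text \<open>
  What the proof uses about the group. In every irreducible representation in which \<open>z\<close> acts by \<open>-1\<close>, the
  assumption \<open>conj_z\<close> makes the character vanish outside \<open>1\<close> and \<open>z\<close>; so there is just one such
  representation. The assumption \<open>separated\<close> says that the characters with values \<open>\<plusminus>1\<close> detect everything outside
  the cyclic group generated by \<open>r\<close>, on which \<open>r_square\<close> makes them trivial.
\<close>
locale central_square_group = finite_group +
  fixes r z :: 'a
  assumes r: "r \<in> carrier G"
    and z_def: "z = r \<otimes> r"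
    and z_square: "z \<otimes> z = \<one>"
    and z_nontrivial: "z \<noteq> \<one>"
    and z_central: "x \<in> carrier G \<Longrightarrow> z \<otimes> x = x \<otimes> z"
    and conj_z: "x \<in> carrier G \<Longrightarrow> x \<noteq> \<one> \<Longrightarrow> x \<noteq> z \<Longrightarrow> \<exists>g\<in>carrier G. g \<otimes> x \<otimes> inv g = z \<otimes> x"
    and r_square: "\<exists>y\<in>carrier G. r = y \<otimes> y"
    and separated: "x \<in> carrier G \<Longrightarrow> x \<notin> {\<one>, r, z, z \<otimes> r} \<Longrightarrow>
       \<exists>\<chi>. \<chi> x = -1 \<and> (\<forall>a\<in>carrier G. \<forall>b\<in>carrier G. \<chi> (a \<otimes> b) = \<chi> a * \<chi> b) \<and>
         (\<forall>a\<in>carrier G. \<chi> a \<in> {1, -1 :: complex})"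
begin

lemma z: "z \<in> carrier G"
  using r by (simp add: z_def)

lemma zz: "x \<in> carrier G \<Longrightarrow> z \<otimes> (z \<otimes> x) = x"
  using z z_square by (simp flip: m_assoc)

lemma rr: "x \<in> carrier G \<Longrightarrow> r \<otimes> (r \<otimes> x) = z \<otimes> x" "x \<in> carrier G \<Longrightarrow> x \<otimes> r \<otimes> r = x \<otimes> z"
  using r by (simp_all add: z_def m_assoc)

text \<open>
  Among the functions that vanish outside the group these are the matrix coefficients of the representations
  in which \<open>z\<close> acts by \<open>-1\<close>.
\<close>
definition z_odd :: "('a \<Rightarrow> complex) \<Rightarrow> bool" where
  "z_odd f \<longleftrightarrow> f \<in> carrier (ga G) \<and> (\<forall>x\<in>carrier G. f (z \<otimes> x) = - f x)"

text \<open>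
  In the sum, the terms for \<open>b\<close> and \<open>z b\<close> cancel as soon as \<open>b\<close> is conjugate to \<open>z b\<close>; only \<open>b = 1\<close> and
  \<open>b = z\<close> survive.
\<close>
lemma odd_class_scalar:
  assumes c: "\<And>g x. g \<in> carrier G \<Longrightarrow> x \<in> carrier G \<Longrightarrow> c (g \<otimes> x \<otimes> inv g) = (c x :: complex)"
    and f: "\<And>x. x \<in> carrier G \<Longrightarrow> f (z \<otimes> x) = - f x" and x: "x \<in> carrier G"
  shows "(\<Sum>b\<in>carrier G. c b * f (b \<otimes> x)) = (c \<one> - c z) * f x"
proof -
  let ?S = "\<Sum>b\<in>carrier G - {\<one>, z}. c b * f (b \<otimes> x)"
  have "?S = (\<Sum>b\<in>carrier G - {\<one>, z}. c (z \<otimes> b) * f (z \<otimes> b \<otimes> x))"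
    by (rule sum.reindex_bij_witness[of _ "\<lambda>b. z \<otimes> b" "\<lambda>b. z \<otimes> b"])
      (use z x zz z_square in \<open>auto simp: \<close>, (metis inv_equality m_closed zz r_one z)+)
  also have "\<dots> = (\<Sum>b\<in>carrier G - {\<one>, z}. - (c b * f (b \<otimes> x)))"
  proof (rule sum.cong[OF refl])
    fix b assume b: "b \<in> carrier G - {\<one>, z}"
    then obtain g where "g \<in> carrier G" "g \<otimes> b \<otimes> inv g = z \<otimes> b" using conj_z by auto
    then have "c (z \<otimes> b) = c b" using c[of g b] b by auto
    then show "c (z \<otimes> b) * f (z \<otimes> b \<otimes> x) = - (c b * f (b \<otimes> x))"
      using b x z f[of "b \<otimes> x"] by (simp add: m_assoc)
  qed
  also have "\<dots> = - ?S" by (simp add: sum_negf)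
  finally have S: "?S = 0" by simp
  have "(\<Sum>b\<in>carrier G. c b * f (b \<otimes> x)) = (\<Sum>b\<in>{\<one>, z}. c b * f (b \<otimes> x)) + ?S"
    using z by (subst sum.subset_diff[of "{\<one>, z}"]) auto
  then show ?thesis
    using S z x f[OF x] z_nontrivial by (simp add: algebra_simps)
qed

definition signs :: "('a \<Rightarrow> complex) set" where
  "signs = {\<chi>\<in>carrier (ga G). (\<forall>a\<in>carrier G. \<forall>b\<in>carrier G. \<chi> (a \<otimes> b) = \<chi> a * \<chi> b) \<and>
     (\<forall>a\<in>carrier G. \<chi> a \<in> {1, -1})}"

abbreviation pointwise :: "('a \<Rightarrow> complex) \<Rightarrow> ('a \<Rightarrow> complex) \<Rightarrow> 'a \<Rightarrow> complex" (infixl "\<bullet>" 75) where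
  "f \<bullet> h \<equiv> (\<lambda>x. f x * h x)"

lemma finite_signs: "finite signs"
  by (rule finite_subset[OF _ finite_set_of_finite_funs[of "carrier G" "{1, -1}" 0]])
    (auto simp: signs_def ga_sel)

lemma signs_values: "\<chi> \<in> signs \<Longrightarrow> a \<in> carrier G \<Longrightarrow> \<chi> a = 1 \<or> \<chi> a = -1"
  by (auto simp: signs_def)

lemma signs_mult:
  assumes "\<chi> \<in> signs" "\<psi> \<in> signs" shows "\<chi> \<bullet> \<psi> \<in> signs"
proof -
  have "\<chi> a * \<psi> a \<in> {1, -1}" if "a \<in> carrier G" for a
    using signs_values[OF assms(1) that] signs_values[OF assms(2) that] by auto
  with assms show ?thesis by (auto simp: signs_def ga_sel)
qed

lemma signs_hom: "\<chi> \<in> signs \<Longrightarrow> a \<in> carrier G \<Longrightarrow> b \<in> carrier G \<Longrightarrow> \<chi> (a \<otimes> b) = \<chi> a * \<chi> b"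
  by (simp add: signs_def)

lemma signs_square: "\<chi> \<in> signs \<Longrightarrow> a \<in> carrier G \<Longrightarrow> \<chi> a * \<chi> a = 1"
  by (auto simp: signs_def)

lemma signs_one: "\<chi> \<in> signs \<Longrightarrow> \<chi> \<one> = 1"
  using signs_hom[of \<chi> \<one> \<one>] signs_square[of \<chi> \<one>] by simp

lemma signs_r: "\<chi> \<in> signs \<Longrightarrow> \<chi> r = 1"
  using r_square signs_hom signs_square by fastforce

lemma signs_z: "\<chi> \<in> signs \<Longrightarrow> \<chi> z = 1"
  using signs_r[of \<chi>] signs_hom[of \<chi> r r] r by (simp add: z_def)

lemma signs_zr: "\<chi> \<in> signs \<Longrightarrow> \<chi> (z \<otimes> r) = 1"
  using signs_r[of \<chi>] signs_z[of \<chi>] signs_hom[of \<chi> z r] r z by simp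

lemma signs_inv: "\<chi> \<in> signs \<Longrightarrow> a \<in> carrier G \<Longrightarrow> \<chi> (inv a) = \<chi> a"
  using signs_hom[of \<chi> "inv a" a] signs_one[of \<chi>] signs_square[of \<chi> a]
  by (metis inv_closed l_inv mult.commute mult_cancel_left mult_zero_left zero_neq_one)

lemma signs_cancel:
  assumes "\<chi> \<in> signs" "\<psi> \<in> signs" shows "(\<chi> \<bullet> \<psi>) \<bullet> \<psi> = \<chi>"
proof
  fix x
  show "\<chi> x * \<psi> x * \<psi> x = \<chi> x"
    using signs_square[OF assms(2), of x] assms(1)
    by (cases "x \<in> carrier G") (auto simp: mult.assoc signs_def ga_sel)
qed

lemma one_in_signs: "(\<lambda>x. of_bool (x \<in> carrier G)) \<in> signs"
  by (auto simp: signs_def ga_sel)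

lemma card_signs: "card signs > 0"
  using finite_signs one_in_signs by (auto simp: card_gt_0_iff)

lemma sum_signs_shift:
  assumes "\<psi> \<in> signs"
  shows "(\<Sum>\<chi>\<in>signs. F (\<chi> \<bullet> \<psi>)) = (\<Sum>\<chi>\<in>signs. F \<chi>)"
  by (rule sum.reindex_bij_witness[of _ "\<lambda>\<chi>. \<chi> \<bullet> \<psi>" "\<lambda>\<chi>. \<chi> \<bullet> \<psi>"])
    (use assms signs_cancel signs_mult in auto)

abbreviation four :: "'a set" where "four \<equiv> {\<one>, r, z, z \<otimes> r}"

text \<open>
  Outside the four powers of \<open>r\<close> some sign takes the value \<open>-1\<close>, and multiplication by it permutes the signs
  and reverses the sum.
\<close>
lemma sum_signs:
  assumes "x \<in> carrier G"
  shows "(\<Sum>\<chi>\<in>signs. \<chi> x) = of_nat (card signs) * of_bool (x \<in> four)"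
proof (cases "x \<in> four")
  case True
  then have "\<chi> x = 1" if "\<chi> \<in> signs" for \<chi>
    using that signs_one signs_r signs_z signs_zr by auto
  then have "(\<Sum>\<chi>\<in>signs. \<chi> x) = (\<Sum>\<chi>\<in>signs. 1)" by (rule sum.cong[OF refl])
  with True show ?thesis by simp
next
  case False
  then obtain \<psi> :: "'a \<Rightarrow> complex" where \<psi>: "\<psi> x = -1"
     "\<And>a b. a \<in> carrier G \<Longrightarrow> b \<in> carrier G \<Longrightarrow> \<psi> (a \<otimes> b) = \<psi> a * \<psi> b"
     "\<And>a. a \<in> carrier G \<Longrightarrow> \<psi> a \<in> {1, -1}"
    using separated[OF assms False] by blast
  define \<psi>' where "\<psi>' a = (if a \<in> carrier G then \<psi> a else 0)" for a
  have "\<psi>' \<in> signs" using \<psi> by (auto simp: signs_def \<psi>'_def ga_sel)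
  from sum_signs_shift[OF this, of "\<lambda>\<chi>. \<chi> x"]
  have "(\<Sum>\<chi>\<in>signs. \<chi> x) = - (\<Sum>\<chi>\<in>signs. \<chi> x)"
    using \<psi>(1) assms by (simp add: \<psi>'_def sum_negf)
  with False show ?thesis by simp
qed

lemma four_distinct: "r \<noteq> \<one>" "r \<noteq> z" "z \<otimes> r \<noteq> \<one>" "z \<otimes> r \<noteq> z" "z \<otimes> r \<noteq> r" "z \<noteq> \<one>"
proof -
  show a: "r \<noteq> \<one>" using z_nontrivial by (auto simp: z_def)
  show "r \<noteq> z" using a r by (auto simp: z_def)
  show "z \<otimes> r \<noteq> z" using a r z by auto
  show "z \<otimes> r \<noteq> r" using z_nontrivial r z by auto
  show "z \<otimes> r \<noteq> \<one>"
  proof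
    assume "z \<otimes> r = \<one>"
    then have "z \<otimes> (z \<otimes> r) = z" using z by simp
    then show False using zz[OF r] \<open>r \<noteq> z\<close> by simp
  qed
qed (rule z_nontrivial)

text \<open>
  Fourier inversion: a function invariant under right translation by \<open>r\<close> is a combination of signs. The factor
  4 is the order of \<open>r\<close>.
\<close>
lemma fixed_expand:
  assumes w: "w \<in> carrier (ga G)" "\<And>x. x \<in> carrier G \<Longrightarrow> w (x \<otimes> r) = w x"
  shows "w = (\<lambda>x. \<Sum>\<chi>\<in>signs. (\<Sum>y\<in>carrier G. w y * \<chi> y) / (4 * of_nat (card signs)) * \<chi> x)"
proof
  fix x
  have N: "of_nat (card signs) \<noteq> (0::complex)" using card_signs by simp
  show "w x = (\<Sum>\<chi>\<in>signs. (\<Sum>y\<in>carrier G. w y * \<chi> y) / (4 * of_nat (card signs)) * \<chi> x)"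
  proof (cases "x \<in> carrier G")
    case x: True
    have wf: "w (x \<otimes> y) = w x" if "y \<in> four" for y
      using that x w(2)[of x] w(2)[of "x \<otimes> r"] w(2)[of "x \<otimes> z"] r z
      by (auto simp: m_assoc z_def[symmetric])
    have "(\<Sum>\<chi>\<in>signs. (\<Sum>y\<in>carrier G. w y * \<chi> y) * \<chi> x)
        = (\<Sum>y\<in>carrier G. w y * (\<Sum>\<chi>\<in>signs. \<chi> (inv x \<otimes> y)))"
      unfolding sum_distrib_right sum_distrib_left
      by (subst sum.swap) (use x in \<open>auto intro!: sum.cong simp: signs_hom signs_inv\<close>)
    also have "\<dots> = of_nat (card signs) * (\<Sum>y\<in>carrier G. w y * of_bool (inv x \<otimes> y \<in> four))"
      unfolding sum_distrib_left
      by (intro sum.cong refl)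
        (simp only: sum_distrib_left[symmetric] sum_signs m_closed inv_closed x mult.left_commute)
    also have "(\<Sum>y\<in>carrier G. w y * of_bool (inv x \<otimes> y \<in> four))
        = (\<Sum>y\<in>carrier G. w (x \<otimes> y) * of_bool (inv x \<otimes> (x \<otimes> y) \<in> four))"
      by (rule sum_shift(1)[OF x, symmetric])
    also have "\<dots> = (\<Sum>y\<in>carrier G. if y \<in> four then w x else 0)"
    proof (rule sum.cong[OF refl])
      fix y assume y: "y \<in> carrier G"
      have "inv x \<otimes> (x \<otimes> y) = y" using x y by (simp flip: m_assoc)
      then show "w (x \<otimes> y) * of_bool (inv x \<otimes> (x \<otimes> y) \<in> four) = (if y \<in> four then w x else 0)"
        using wf[of y] by (simp only: of_bool_def) (simp del: insert_iff)
    qed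
    also have "\<dots> = (\<Sum>y\<in>four. w x)"
      using r z by (intro sum.mono_neutral_cong_right) auto
    also have "\<dots> = 4 * w x"
      using four_distinct[THEN not_sym] four_distinct by simp
    finally show ?thesis
      using N by (simp add: field_simps flip: sum_divide_distrib)
  next
    case False
    then show ?thesis using w(1) by (auto simp: ga_sel signs_def)
  qed
qed

text \<open>
  For \<open>q = \<plusminus>\<i>\<close> this is the character \<open>r\<^sup>k \<mapsto> q\<^sup>k\<close> of the cyclic group generated by \<open>r\<close>, extended by 0. It is an
  odd eigenfunction for the translation by \<open>r\<close>. For other \<open>q\<close> it is merely odd; \<open>q = 0\<close> gives the difference of
  the point masses at \<open>1\<close> and \<open>z\<close>, used as a test function.
\<close>
definition \<rho> :: "complex \<Rightarrow> 'a \<Rightarrow> complex" where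
  "\<rho> q x = (if x = \<one> then 1 else if x = r then q else if x = z then -1 else if x = z \<otimes> r then - q else 0)"

lemma rho_odd: "z_odd (\<rho> q)"
proof -
  have "\<rho> q (z \<otimes> x) = - \<rho> q x" if x: "x \<in> carrier G" for x
  proof (cases "x \<in> four")
    case True
    then show ?thesis
      using four_distinct four_distinct[THEN not_sym] z r zz z_square by (auto simp: \<rho>_def)
  next
    case False
    then have "z \<otimes> x \<notin> four" using x z r zz z_square by (metis insertE insertI1 insertI2 empty_iff r_one)
    with False show ?thesis by (auto simp: \<rho>_def)
  qed
  then show ?thesis using z r by (auto simp: z_odd_def ga_sel \<rho>_def)
qed

lemma rho_shift:
  assumes "q * q = -1" "x \<in> carrier G"
  shows "\<rho> q (x \<otimes> r) = q * \<rho> q x"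
proof (cases "x \<in> four")
  case True
  moreover have "z \<otimes> r \<otimes> r = \<one>" using rr(2)[OF z] z_square by simp
  ultimately show ?thesis
    using four_distinct four_distinct[THEN not_sym] z r assms(1) z_def[symmetric] by (auto simp: \<rho>_def)
next
  case False
  have "x \<otimes> r \<notin> four"
  proof
    assume "x \<otimes> r \<in> four"
    then have "x \<otimes> r \<otimes> r \<otimes> z \<in> {r \<otimes> z, r \<otimes> r \<otimes> z, z \<otimes> r \<otimes> z, z \<otimes> r \<otimes> r \<otimes> z}" using r z by auto
    moreover have "x \<otimes> r \<otimes> r \<otimes> z = x" using assms r z by (simp add: rr z_square m_assoc)
    moreover have "r \<otimes> z = z \<otimes> r" "r \<otimes> r \<otimes> z = \<one>" "z \<otimes> r \<otimes> z = r" "z \<otimes> r \<otimes> r \<otimes> z = z"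
      using z_central[OF r] z_square r z zz by (simp_all add: m_assoc z_def[symmetric])
    ultimately show False using False by auto
  qed
  with False show ?thesis by (auto simp: \<rho>_def)
qed

lemma signs_rho: "\<chi> \<in> signs \<Longrightarrow> \<chi> x * \<rho> q x = \<rho> q x"
  using signs_one signs_r signs_z signs_zr by (auto simp: \<rho>_def)

lemma rho_norm:
  "(\<Sum>y\<in>carrier G. \<rho> q y * \<rho> q' y) = 2 + 2 * q * q'"
proof -
  have "(\<Sum>y\<in>carrier G. \<rho> q y * \<rho> q' y) = (\<Sum>y\<in>four. \<rho> q y * \<rho> q' y)"
    using r z by (intro sum.mono_neutral_right) (auto simp: \<rho>_def)
  also have "\<dots> = 2 + 2 * q * q'"
    using four_distinct four_distinct[THEN not_sym] by (simp add: \<rho>_def)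
  finally show ?thesis .
qed

end

section \<open>The scalars by which a twist acts on odd functions\<close>

locale twisted_square_group = central_square_group + twisting
begin

text \<open>
  Each of the following three scalars is a class function evaluated at \<open>1\<close> minus its value at \<open>z\<close>, as provided by
  \<open>odd_class_scalar\<close>. The class functions are \<open>(\<chi> \<otimes> id)(\<Omega>)\<close>, \<open>(id \<otimes> \<chi>)(\<Omega>)\<close> and
  \<open>c \<mapsto> \<Sum> \<Omega>(a, c a)\<close>; they are class functions because \<open>\<Omega>\<close> is invariant.
\<close>
definition \<phi> :: "('a \<Rightarrow> complex) \<Rightarrow> complex" where
  "\<phi> \<chi> = (\<Sum>a\<in>carrier G. \<Omega> (a, \<one>) * \<chi> a) - (\<Sum>a\<in>carrier G. \<Omega> (a, z) * \<chi> a)"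

definition \<psi> :: "('a \<Rightarrow> complex) \<Rightarrow> complex" where
  "\<psi> \<chi> = (\<Sum>b\<in>carrier G. \<Omega> (\<one>, b) * \<chi> b) - (\<Sum>b\<in>carrier G. \<Omega> (z, b) * \<chi> b)"

definition \<kappa> :: complex where
  "\<kappa> = (\<Sum>a\<in>carrier G. \<Omega> (a, a)) - (\<Sum>a\<in>carrier G. \<Omega> (a, z \<otimes> a))"

lemma sum_conj:
  assumes "g \<in> carrier G"
  shows "(\<Sum>x\<in>carrier G. F (g \<otimes> x \<otimes> inv g)) = (\<Sum>x\<in>carrier G. F x)"
  using sum_shift(1)[OF assms, of "\<lambda>x. F (x \<otimes> inv g)"] sum_shift(2)[of "inv g" F] assms by simp

lemma ev_sq: "ev (sq G) \<Omega> (\<lambda>(a, b). F a b) = (\<Sum>a\<in>carrier G. \<Sum>b\<in>carrier G. \<Omega> (a, b) * F a b)"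
  by (simp add: ev_def sum.cartesian_product')

lemma sign_conj:
  "\<chi> \<in> signs \<Longrightarrow> g \<in> carrier G \<Longrightarrow> a \<in> carrier G \<Longrightarrow> \<chi> (g \<otimes> a \<otimes> inv g) = \<chi> a"
  using signs_square[of \<chi> g] by (simp add: signs_hom signs_inv mult_ac)

lemma sign_odd:
  assumes \<chi>: "\<chi> \<in> signs" and f: "z_odd f" and xy: "x \<in> carrier G" "y \<in> carrier G"
  shows "ev (sq G) \<Omega> (\<lambda>(a, b). \<chi> (a \<otimes> x) * f (b \<otimes> y)) = \<phi> \<chi> * (\<chi> x * f y)"
proof -
  let ?c = "\<lambda>b. \<Sum>a\<in>carrier G. \<Omega> (a, b) * \<chi> a"
  have "ev (sq G) \<Omega> (\<lambda>(a, b). \<chi> (a \<otimes> x) * f (b \<otimes> y)) = \<chi> x * (\<Sum>b\<in>carrier G. ?c b * f (b \<otimes> y))"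
    unfolding ev_sq sum_distrib_left sum_distrib_right
    by (subst sum.swap) (use \<chi> xy in \<open>auto intro!: sum.cong simp: signs_hom mult_ac\<close>)
  also have "(\<Sum>b\<in>carrier G. ?c b * f (b \<otimes> y)) = (?c \<one> - ?c z) * f y"
  proof (rule odd_class_scalar)
    fix g x assume g: "g \<in> carrier G" and x: "x \<in> carrier G"
    have "?c (g \<otimes> x \<otimes> inv g) = (\<Sum>a\<in>carrier G. \<Omega> (g \<otimes> a \<otimes> inv g, g \<otimes> x \<otimes> inv g) * \<chi> (g \<otimes> a \<otimes> inv g))"
      by (rule sum_conj[OF g, symmetric])
    also have "\<dots> = ?c x"
      using g x \<chi> by (auto intro!: sum.cong simp: cocycle_conj sign_conj)
    finally show "?c (g \<otimes> x \<otimes> inv g) = ?c x" .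
  qed (use f xy in \<open>auto simp: z_odd_def\<close>)
  finally show ?thesis by (simp add: \<phi>_def mult_ac)
qed

lemma odd_sign:
  assumes \<chi>: "\<chi> \<in> signs" and f: "z_odd f" and xy: "x \<in> carrier G" "y \<in> carrier G"
  shows "ev (sq G) \<Omega> (\<lambda>(a, b). f (a \<otimes> x) * \<chi> (b \<otimes> y)) = \<psi> \<chi> * (f x * \<chi> y)"
proof -
  let ?c = "\<lambda>a. \<Sum>b\<in>carrier G. \<Omega> (a, b) * \<chi> b"
  have "ev (sq G) \<Omega> (\<lambda>(a, b). f (a \<otimes> x) * \<chi> (b \<otimes> y)) = \<chi> y * (\<Sum>a\<in>carrier G. ?c a * f (a \<otimes> x))"
    unfolding ev_sq sum_distrib_left sum_distrib_right
    by (use \<chi> xy in \<open>auto intro!: sum.cong simp: signs_hom mult_ac\<close>)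
  also have "(\<Sum>a\<in>carrier G. ?c a * f (a \<otimes> x)) = (?c \<one> - ?c z) * f x"
  proof (rule odd_class_scalar)
    fix g x assume g: "g \<in> carrier G" and x: "x \<in> carrier G"
    have "?c (g \<otimes> x \<otimes> inv g) = (\<Sum>b\<in>carrier G. \<Omega> (g \<otimes> x \<otimes> inv g, g \<otimes> b \<otimes> inv g) * \<chi> (g \<otimes> b \<otimes> inv g))"
      by (rule sum_conj[OF g, symmetric])
    also have "\<dots> = ?c x"
      using g x \<chi> by (auto intro!: sum.cong simp: cocycle_conj sign_conj)
    finally show "?c (g \<otimes> x \<otimes> inv g) = ?c x" .
  qed (use f xy in \<open>auto simp: z_odd_def\<close>)
  finally show ?thesis by (simp add: \<psi>_def mult_ac)
qed

lemma sign_star_odd: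
  assumes "\<chi> \<in> signs" "z_odd f" shows "\<chi> \<star> f = (\<lambda>x. \<phi> \<chi> * (\<chi> x * f x))"
  using assms sign_odd[OF assms] by (auto simp: star_def fun_eq_iff signs_def ga_sel)

lemma odd_star_sign:
  assumes "\<chi> \<in> signs" "z_odd f" shows "f \<star> \<chi> = (\<lambda>x. \<psi> \<chi> * (\<chi> x * f x))"
  using assms odd_sign[OF assms] by (auto simp: star_def fun_eq_iff signs_def ga_sel)

text \<open>
  Summation over the group of \<open>f \<star> h\<close> is again governed by a class function in \<open>c\<close> after the substitution
  \<open>y = a x\<close>, \<open>b = c a\<close>, so for odd \<open>h\<close> it is proportional to the untwisted pairing of \<open>f\<close> and \<open>h\<close>. The statement
  for functions of two variables is needed for \<open>kappa_nonzero\<close>.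
\<close>
lemma haar_odd:
  assumes F: "\<And>x y. x \<in> carrier G \<Longrightarrow> y \<in> carrier G \<Longrightarrow> F x (z \<otimes> y) = - F x y"
  shows "(\<Sum>x\<in>carrier G. ev (sq G) \<Omega> (\<lambda>(a, b). F (a \<otimes> x) (b \<otimes> x))) = \<kappa> * (\<Sum>y\<in>carrier G. F y y)"
proof -
  let ?c = "\<lambda>c. \<Sum>a\<in>carrier G. \<Omega> (a, c \<otimes> a)"
  have "(\<Sum>x\<in>carrier G. ev (sq G) \<Omega> (\<lambda>(a, b). F (a \<otimes> x) (b \<otimes> x)))
    = (\<Sum>a\<in>carrier G. \<Sum>b\<in>carrier G. \<Sum>x\<in>carrier G. \<Omega> (a, b) * F (a \<otimes> x) (b \<otimes> x))"
    unfolding ev_sq by (subst sum.swap) (intro sum.cong refl sum.swap)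
  also have "\<dots> = (\<Sum>a\<in>carrier G. \<Sum>c\<in>carrier G. \<Sum>x\<in>carrier G. \<Omega> (a, c \<otimes> a) * F (a \<otimes> x) (c \<otimes> a \<otimes> x))"
  proof (rule sum.cong[OF refl])
    fix a assume "a \<in> carrier G"
    from sum_shift(2)[OF this, of "\<lambda>b. \<Sum>x\<in>carrier G. \<Omega> (a, b) * F (a \<otimes> x) (b \<otimes> x)", symmetric]
    show "(\<Sum>b\<in>carrier G. \<Sum>x\<in>carrier G. \<Omega> (a, b) * F (a \<otimes> x) (b \<otimes> x))
      = (\<Sum>c\<in>carrier G. \<Sum>x\<in>carrier G. \<Omega> (a, c \<otimes> a) * F (a \<otimes> x) (c \<otimes> a \<otimes> x))" .
  qed
  also have "\<dots> = (\<Sum>a\<in>carrier G. \<Sum>c\<in>carrier G. \<Sum>y\<in>carrier G. \<Omega> (a, c \<otimes> a) * F y (c \<otimes> y))"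
  proof (rule sum.cong[OF refl], rule sum.cong[OF refl])
    fix a c assume "a \<in> carrier G" "c \<in> carrier G"
    then show "(\<Sum>x\<in>carrier G. \<Omega> (a, c \<otimes> a) * F (a \<otimes> x) (c \<otimes> a \<otimes> x))
        = (\<Sum>y\<in>carrier G. \<Omega> (a, c \<otimes> a) * F y (c \<otimes> y))"
      using sum_shift(1)[of a "\<lambda>y. \<Omega> (a, c \<otimes> a) * F y (c \<otimes> y)"] by (simp add: m_assoc)
  qed
  also have "\<dots> = (\<Sum>y\<in>carrier G. \<Sum>c\<in>carrier G. ?c c * F y (c \<otimes> y))"
    unfolding sum_distrib_right
    by (subst (3) sum.swap, subst (2) sum.swap, subst sum.swap, rule refl)
  also have "\<dots> = (\<Sum>y\<in>carrier G. (?c \<one> - ?c z) * F y y)"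
  proof (rule sum.cong[OF refl])
    fix y assume y: "y \<in> carrier G"
    show "(\<Sum>c\<in>carrier G. ?c c * F y (c \<otimes> y)) = (?c \<one> - ?c z) * F y y"
    proof (rule odd_class_scalar)
      fix g x assume g: "g \<in> carrier G" and x: "x \<in> carrier G"
      have "?c (g \<otimes> x \<otimes> inv g) = (\<Sum>a\<in>carrier G. \<Omega> (g \<otimes> a \<otimes> inv g, g \<otimes> x \<otimes> inv g \<otimes> (g \<otimes> a \<otimes> inv g)))"
        by (rule sum_conj[OF g, symmetric])
      also have "\<dots> = (\<Sum>a\<in>carrier G. \<Omega> (g \<otimes> a \<otimes> inv g, g \<otimes> (x \<otimes> a) \<otimes> inv g))"
      proof (rule sum.cong[OF refl])
        fix a assume a: "a \<in> carrier G"
        have "g \<otimes> x \<otimes> inv g \<otimes> (g \<otimes> a \<otimes> inv g) = g \<otimes> x \<otimes> (inv g \<otimes> g) \<otimes> a \<otimes> inv g"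
          using g x a by (simp only: m_assoc m_closed inv_closed)
        also have "\<dots> = g \<otimes> (x \<otimes> a) \<otimes> inv g" using g x a by (simp add: m_assoc)
        finally show "\<Omega> (g \<otimes> a \<otimes> inv g, g \<otimes> x \<otimes> inv g \<otimes> (g \<otimes> a \<otimes> inv g))
          = \<Omega> (g \<otimes> a \<otimes> inv g, g \<otimes> (x \<otimes> a) \<otimes> inv g)" by simp
      qed
      also have "\<dots> = ?c x"
        using g x by (auto intro!: sum.cong simp: cocycle_conj)
      finally show "?c (g \<otimes> x \<otimes> inv g) = ?c x" .
    qed (use F y in auto)
  qed
  finally show ?thesis
    by (simp add: \<kappa>_def sum_distrib_left)
qed

lemma haar_star_odd:
  assumes "z_odd h"
  shows "(\<Sum>x\<in>carrier G. (f \<star> h) x) = \<kappa> * (\<Sum>y\<in>carrier G. f y * h y)"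
  using haar_odd[of "\<lambda>x y. f x * h y"] assms by (simp add: star_def z_odd_def)

text \<open>
  Twisting by \<open>\<Omega>\<close> and then by its inverse, in either order, does nothing. Hence none of the scalars above can
  vanish: a vanishing scalar would make the twist by \<open>\<Omega>\<close> kill a function, or a sum, that it must not kill.
\<close>
lemma untwist:
  assumes x: "x \<in> carrier G" "y \<in> carrier G"
  shows "ev (sq G) \<Omega> (\<lambda>(a, b). ev (sq G) (inv\<^bsub>ga (sq G)\<^esub> \<Omega>) (\<lambda>(c, d). F (c \<otimes> (a \<otimes> x)) (d \<otimes> (b \<otimes> y)))) = F x y"
    and "ev (sq G) (inv\<^bsub>ga (sq G)\<^esub> \<Omega>) (\<lambda>(a, b). ev (sq G) \<Omega> (\<lambda>(c, d). F (c \<otimes> (a \<otimes> x)) (d \<otimes> (b \<otimes> y)))) = F x y"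
proof -
  interpret G2: finite_group "sq G" by (rule sq)
  interpret M2: monoid "ga (sq G)" by (rule monoid2)
  let ?I = "inv\<^bsub>ga (sq G)\<^esub> \<Omega>"
  have *: "ev (sq G) u (\<lambda>(a, b). ev (sq G) v (\<lambda>(c, d). F (c \<otimes> (a \<otimes> x)) (d \<otimes> (b \<otimes> y)))) = F x y"
    if "v \<cdot>\<^sub>2 u = \<one>\<^bsub>ga (sq G)\<^esub>" for u v
  proof -
    have "ev (sq G) u (\<lambda>(a, b). ev (sq G) v (\<lambda>(c, d). F (c \<otimes> (a \<otimes> x)) (d \<otimes> (b \<otimes> y))))
      = ev (sq G) v (\<lambda>q. ev (sq G) u (\<lambda>p. F (fst q \<otimes> (fst p \<otimes> x)) (snd q \<otimes> (snd p \<otimes> y))))"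
      unfolding case_prod_unfold by (rule ev_swap)
    also have "\<dots> = ev (sq G) (v \<cdot>\<^sub>2 u) (\<lambda>p. F (fst p \<otimes> x) (snd p \<otimes> y))"
      unfolding G2.ev_mult using x by (auto intro!: ev_cong simp: m_assoc)
    also have "\<dots> = F x y"
      using x by (simp add: that ga_sel(2) ev_bvec)
    finally show ?thesis .
  qed
  show "ev (sq G) \<Omega> (\<lambda>(a, b). ev (sq G) ?I (\<lambda>(c, d). F (c \<otimes> (a \<otimes> x)) (d \<otimes> (b \<otimes> y)))) = F x y"
    using cocycleD(2) by (intro *) simp
  show "ev (sq G) ?I (\<lambda>(a, b). ev (sq G) \<Omega> (\<lambda>(c, d). F (c \<otimes> (a \<otimes> x)) (d \<otimes> (b \<otimes> y)))) = F x y"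
    using cocycleD(2) by (intro *) simp
qed

lemma phi_nonzero:
  assumes \<chi>: "\<chi> \<in> signs" shows "\<phi> \<chi> \<noteq> 0"
proof
  assume 0: "\<phi> \<chi> = 0"
  let ?I = "inv\<^bsub>ga (sq G)\<^esub> \<Omega>"
  have "1 = \<chi> \<one> * \<rho> 1 \<one>" using signs_one[OF \<chi>] by (simp add: \<rho>_def)
  also have "\<dots> = ev (sq G) ?I (\<lambda>(a, b). ev (sq G) \<Omega> (\<lambda>(c, d). \<chi> (c \<otimes> (a \<otimes> \<one>)) * \<rho> 1 (d \<otimes> (b \<otimes> \<one>))))"
    by (rule untwist(2)[symmetric]) auto
  also have "\<dots> = ev (sq G) ?I (\<lambda>_. 0)"
    by (rule ev_cong) (use 0 sign_odd[OF \<chi> rho_odd] in auto)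
  finally show False by (simp add: ev_def)
qed

lemma kappa_nonzero: "\<kappa> \<noteq> 0"
proof
  assume 0: "\<kappa> = 0"
  let ?I = "inv\<^bsub>ga (sq G)\<^esub> \<Omega>"
  \<comment> \<open>Odd in the second variable and equal to 1 on the diagonal; its inverse twist \<open>F\<close> contradicts
    \<open>haar_odd\<close> if the scalar vanishes.\<close>
  let ?F0 = "\<lambda>x y. bvec x y - bvec (z \<otimes> x) y :: complex"
  define F where "F x y = ev (sq G) ?I (\<lambda>(c, d). ?F0 (c \<otimes> x) (d \<otimes> y))" for x y
  have F0: "?F0 x (z \<otimes> y) = - ?F0 x y" if "x \<in> carrier G" "y \<in> carrier G" for x y
  proof -
    have "z \<otimes> y = x \<longleftrightarrow> y = z \<otimes> x" using that zz by auto
    moreover have "z \<otimes> y = z \<otimes> x \<longleftrightarrow> y = x" using that z by auto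
    ultimately show ?thesis by (auto simp: bvec_def)
  qed
  have "F x (z \<otimes> y) = - F x y" if "x \<in> carrier G" "y \<in> carrier G" for x y
  proof -
    have "F x (z \<otimes> y) = ev (sq G) ?I (\<lambda>p. -1 * (case p of (c, d) \<Rightarrow> ?F0 (c \<otimes> x) (d \<otimes> y)))"
      unfolding F_def
    proof (rule ev_cong)
      fix p assume "p \<in> carrier (sq G)"
      then obtain c d where p: "p = (c, d)" "c \<in> carrier G" "d \<in> carrier G" by auto
      have "d \<otimes> (z \<otimes> y) = z \<otimes> (d \<otimes> y)" using that p z z_central[of d] by (simp flip: m_assoc)
      then show "(case p of (c, d) \<Rightarrow> ?F0 (c \<otimes> x) (d \<otimes> (z \<otimes> y))) = -1 * (case p of (c, d) \<Rightarrow> ?F0 (c \<otimes> x) (d \<otimes> y))"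
        using F0[of "c \<otimes> x" "d \<otimes> y"] that p by simp
    qed
    then show ?thesis unfolding ev_scale F_def by simp
  qed
  from haar_odd[of F, OF this]
  have "(\<Sum>x\<in>carrier G. ev (sq G) \<Omega> (\<lambda>(a, b). F (a \<otimes> x) (b \<otimes> x))) = 0" by (simp add: 0)
  moreover have "(\<Sum>x\<in>carrier G. ev (sq G) \<Omega> (\<lambda>(a, b). F (a \<otimes> x) (b \<otimes> x))) = (\<Sum>x\<in>carrier G. 1)"
  proof (rule sum.cong[OF refl])
    fix x assume x: "x \<in> carrier G"
    have "x \<noteq> z \<otimes> x" using z_nontrivial x z by auto
    then have "?F0 x x = 1" by (simp add: bvec_def)
    then show "ev (sq G) \<Omega> (\<lambda>(a, b). F (a \<otimes> x) (b \<otimes> x)) = 1"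
      using untwist(1)[OF x x, of ?F0] by (simp add: F_def)
  qed
  ultimately show False using order_gt_0_iff_finite by (simp add: order_def)
qed

text \<open>
  The twisted algebra need not be commutative a priori, but a sign commutes with odd functions up to the factor
  \<open>\<psi>(\<chi>)/\<phi>(\<chi>)\<close>. Associativity of \<open>d \<star> \<chi> \<star> d\<close> with \<open>\<chi> d = d\<close> gives \<open>\<psi>(\<chi>) d \<star> d = \<phi>(\<chi>) d \<star> d\<close>, and
  \<open>d \<star> d\<close> has nonzero sum over the group. In terms of representations, the trivial one occurs just once in the
  square of the odd irreducible representation.
\<close>
lemma phi_eq_psi:
  assumes \<chi>: "\<chi> \<in> signs" shows "\<phi> \<chi> = \<psi> \<chi>"
proof -
  let ?d = "\<rho> 0"
  have o: "z_odd ?d" by (rule rho_odd)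
  have "(\<lambda>x. \<psi> \<chi> * (?d \<star> ?d) x) = ?d \<star> \<chi> \<star> ?d"
    by (simp add: odd_star_sign[OF \<chi> o] signs_rho[OF \<chi>] star_scale_left)
  also have "\<dots> = ?d \<star> (\<chi> \<star> ?d)" by (rule star_assoc)
  also have "\<dots> = (\<lambda>x. \<phi> \<chi> * (?d \<star> ?d) x)"
    by (simp add: sign_star_odd[OF \<chi> o] signs_rho[OF \<chi>] star_scale_right)
  finally have "(\<Sum>x\<in>carrier G. \<psi> \<chi> * (?d \<star> ?d) x) = (\<Sum>x\<in>carrier G. \<phi> \<chi> * (?d \<star> ?d) x)"
    by (rule arg_cong[where f = "\<lambda>h. \<Sum>x\<in>carrier G. h x"])
  then have "\<psi> \<chi> * (\<kappa> * 2) = \<phi> \<chi> * (\<kappa> * 2)"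
    by (simp add: haar_star_odd[OF o] rho_norm flip: sum_distrib_left)
  then show ?thesis using kappa_nonzero by simp
qed

text \<open>
  The value of the cocycle on a pair of signs is a coboundary, because all signs act on the one-dimensional
  space spanned by the odd function \<open>d\<close>; the action of \<open>\<chi> \<star> \<eta>\<close> is computed in two ways.
\<close>
lemma sign_star_sign:
  assumes "\<chi> \<in> signs" "\<eta> \<in> signs"
  shows "\<chi> \<star> \<eta> = (\<lambda>x. \<phi> \<chi> * \<phi> \<eta> / \<phi> (\<chi> \<bullet> \<eta>) * (\<chi> x * \<eta> x))"
proof -
  let ?d = "\<rho> 0"
  have o: "z_odd ?d" by (rule rho_odd)
  define J where "J = ev (sq G) \<Omega> (\<lambda>(a, b). \<chi> a * \<eta> b)"
  have J: "\<chi> \<star> \<eta> = (\<lambda>x. J * (\<chi> x * \<eta> x))"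
  proof
    fix x
    show "(\<chi> \<star> \<eta>) x = J * (\<chi> x * \<eta> x)"
    proof (cases "x \<in> carrier G")
      case True
      then have "(\<chi> \<star> \<eta>) x = ev (sq G) \<Omega> (\<lambda>p. (\<chi> x * \<eta> x) * (case p of (a, b) \<Rightarrow> \<chi> a * \<eta> b))"
        using assms by (auto simp: star_def signs_hom intro!: ev_cong)
      then show ?thesis unfolding ev_scale J_def by simp
    qed (use assms in \<open>auto simp: star_def signs_def ga_sel\<close>)
  qed
  have "(\<lambda>x. J * \<phi> (\<chi> \<bullet> \<eta>) * ?d x) = \<chi> \<star> \<eta> \<star> ?d"
    by (simp add: J star_scale_left sign_star_odd[OF signs_mult[OF assms] o] mult.assoc)
      (simp add: signs_rho assms)
  also have "\<dots> = \<chi> \<star> (\<eta> \<star> ?d)" by (rule star_assoc)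
  also have "\<dots> = (\<lambda>x. \<phi> \<eta> * \<phi> \<chi> * ?d x)"
    by (simp add: sign_star_odd assms o star_scale_right signs_rho mult.assoc)
  finally have "J * \<phi> (\<chi> \<bullet> \<eta>) = \<phi> \<eta> * \<phi> \<chi>"
    by (metis (no_types, lifting) \<rho>_def mult.right_neutral)
  then have "J = \<phi> \<chi> * \<phi> \<eta> / \<phi> (\<chi> \<bullet> \<eta>)"
    using phi_nonzero[OF signs_mult[OF assms]] by (simp add: field_simps)
  then show ?thesis using J by simp
qed

end

section \<open>A multiplicative functional on the twisted algebra\<close>

lemma complex_fourth_root: "\<exists>c::complex. c ^ 4 = b"
proof -
  have "csqrt (csqrt b) ^ 4 = ((csqrt (csqrt b))\<^sup>2)\<^sup>2"
    by (simp only: power_mult[symmetric]) simp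
  then show ?thesis by (metis power2_csqrt)
qed

context twisted_square_group
begin

text \<open>
  The signs, rescaled so that they act on odd functions as they do without the twist, and their average.
\<close>
definition E :: "('a \<Rightarrow> complex) \<Rightarrow> 'a \<Rightarrow> complex" where
  "E \<chi> = (\<lambda>x. inverse (\<phi> \<chi>) * \<chi> x)"

definition e :: "'a \<Rightarrow> complex" where
  "e = (\<lambda>x. inverse (of_nat (card signs)) * (\<Sum>\<chi>\<in>signs. E \<chi> x))"

lemma E_star_E:
  assumes "\<chi> \<in> signs" "\<eta> \<in> signs" shows "E \<chi> \<star> E \<eta> = E (\<chi> \<bullet> \<eta>)"
proof
  fix x
  show "(E \<chi> \<star> E \<eta>) x = E (\<chi> \<bullet> \<eta>) x"
    using phi_nonzero[OF assms(1)] phi_nonzero[OF assms(2)]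
    unfolding E_def star_scale_left star_scale_right sign_star_sign[OF assms]
    by (simp add: field_simps)
qed

lemma E_star_odd: "\<chi> \<in> signs \<Longrightarrow> z_odd f \<Longrightarrow> E \<chi> \<star> f = (\<lambda>x. \<chi> x * f x)"
  using phi_nonzero by (simp add: E_def star_scale_left sign_star_odd flip: mult.assoc)

lemma odd_star_E: "\<chi> \<in> signs \<Longrightarrow> z_odd f \<Longrightarrow> f \<star> E \<chi> = (\<lambda>x. \<chi> x * f x)"
  using phi_nonzero by (simp add: E_def star_scale_right odd_star_sign phi_eq_psi flip: mult.assoc)

lemma average_signs: "inverse (of_nat (card signs)) * (of_nat (card signs) * c) = (c :: complex)"
  using card_signs by (simp flip: mult.assoc)

lemma e_star_E:
  assumes "\<eta> \<in> signs" shows "e \<star> E \<eta> = e"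
  using sum_signs_shift[OF assms, of "\<lambda>\<chi>. E \<chi> _"]
  by (simp add: e_def star_scale_left star_sum_left E_star_E[OF _ assms])

lemma e_star_rho: "e \<star> \<rho> q = \<rho> q"
  by (simp add: average_signs e_def star_scale_left star_sum_left E_star_odd rho_odd signs_rho)

lemma rho_star_e: "\<rho> q \<star> e = \<rho> q"
  by (simp add: average_signs e_def star_scale_right star_sum_right odd_star_E rho_odd signs_rho)

lemma e_idem: "e \<star> e = e"
proof -
  have "e \<star> e = (\<lambda>x. inverse (of_nat (card signs)) * (\<Sum>\<chi>\<in>signs. (e \<star> E \<chi>) x))"
    by (subst (2) e_def) (simp add: star_scale_right star_sum_right)
  then show ?thesis
    by (simp add: average_signs e_star_E)
qed

lemma E_eig: "\<chi> \<in> signs \<Longrightarrow> eig r 1 (E \<chi>)"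
  using signs_hom[of \<chi> _ r] signs_r[of \<chi>] r by (auto simp: eig_def E_def ga_sel signs_def)

lemma e_eig: "eig r 1 e"
  using E_eig by (auto simp: e_def eig_def ga_sel)

text \<open>
  Multiplication by \<open>e\<close> absorbs every rescaled sign, and these span the functions invariant under \<open>r\<close>.
\<close>
lemma e_star_fixed:
  assumes "eig r 1 w" shows "\<exists>c. e \<star> w = (\<lambda>x. c * e x)"
proof -
  define c where "c \<chi> = (\<Sum>y\<in>carrier G. w y * \<chi> y) / (4 * of_nat (card signs)) * \<phi> \<chi>" for \<chi>
  have "w = (\<lambda>x. \<Sum>\<chi>\<in>signs. (\<Sum>y\<in>carrier G. w y * \<chi> y) / (4 * of_nat (card signs)) * \<chi> x)"
    by (rule fixed_expand) (use assms in \<open>auto simp: eig_def\<close>)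
  also have "\<dots> = (\<lambda>x. \<Sum>\<chi>\<in>signs. c \<chi> * E \<chi> x)"
    using phi_nonzero by (intro ext sum.cong) (auto simp: c_def E_def)
  finally have "e \<star> w = (\<lambda>x. \<Sum>\<chi>\<in>signs. c \<chi> * (e \<star> E \<chi>) x)"
    by (simp add: star_sum_right star_scale_right)
  also have "\<dots> = (\<lambda>x. (\<Sum>\<chi>\<in>signs. c \<chi>) * e x)"
    by (simp add: e_star_E sum_distrib_right)
  finally show ?thesis by blast
qed

lemma rho_eig: "q * q = -1 \<Longrightarrow> eig r q (\<rho> q)"
  using rho_shift rho_odd by (auto simp: eig_def z_odd_def)

text \<open>
  The eigenvalues \<open>\<i>\<close> and \<open>-\<i>\<close> multiply to 1, so the product is a multiple of \<open>e\<close>. The Haar pairing of a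
  function with its conjugate shows that the multiple is not 0.
\<close>
lemma rho_star_conj:
  obtains \<alpha> where "\<alpha> \<noteq> 0" "\<rho> \<i> \<star> \<rho> (- \<i>) = (\<lambda>x. \<alpha> * e x)"
proof -
  have "eig r (\<i> * - \<i>) (\<rho> \<i> \<star> \<rho> (- \<i>))"
    by (intro eig_star rho_eig r) auto
  then obtain \<alpha> where \<alpha>: "e \<star> (\<rho> \<i> \<star> \<rho> (- \<i>)) = (\<lambda>x. \<alpha> * e x)"
    using e_star_fixed by auto
  then have *: "\<rho> \<i> \<star> \<rho> (- \<i>) = (\<lambda>x. \<alpha> * e x)"
    by (simp add: e_star_rho flip: star_assoc)
  have "(\<Sum>x\<in>carrier G. (\<rho> \<i> \<star> \<rho> (- \<i>)) x) = \<kappa> * 4"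
    by (simp add: haar_star_odd[OF rho_odd] rho_norm mult.assoc)
  then have "\<alpha> \<noteq> 0" using * kappa_nonzero by auto
  with * show ?thesis using that by blast
qed

text \<open>
  The fourth power of \<open>\<rho> \<i>\<close> is a multiple of \<open>e\<close> because \<open>\<i>\<^sup>4 = 1\<close>, and not 0 because \<open>\<rho> \<i>\<close> has a right
  inverse relative to \<open>e\<close> by the previous lemma. A fourth root of the scalar normalizes it.
\<close>
lemma generator:
  obtains f where "eig r \<i> f" "e \<star> f = f" "f \<star> e = f" "f \<star> f \<star> f \<star> f = e"
proof -
  let ?f = "\<rho> \<i>"
  obtain \<alpha> where \<alpha>: "\<alpha> \<noteq> 0" "?f \<star> \<rho> (- \<i>) = (\<lambda>x. \<alpha> * e x)" by (rule rho_star_conj)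
  have "eig r (\<i> * \<i> * \<i> * \<i>) (?f \<star> ?f \<star> ?f \<star> ?f)"
    by (intro eig_star rho_eig r) auto
  then obtain \<beta> where "e \<star> (?f \<star> ?f \<star> ?f \<star> ?f) = (\<lambda>x. \<beta> * e x)"
    using e_star_fixed by auto
  then have \<beta>: "?f \<star> ?f \<star> ?f \<star> ?f = (\<lambda>x. \<beta> * e x)"
    by (simp add: e_star_rho flip: star_assoc)
  have cancel: "h = (\<lambda>_. 0)" if "h \<star> ?f = (\<lambda>_. 0)" "h \<star> e = h" for h
  proof -
    have "(\<lambda>_. 0) = h \<star> ?f \<star> \<rho> (- \<i>)" by (simp add: that star_zero_left)
    also have "\<dots> = (\<lambda>x. \<alpha> * h x)"
      unfolding star_assoc by (simp add: \<alpha>(2) star_scale_right that)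
    finally show ?thesis using \<alpha>(1) by (simp add: fun_eq_iff)
  qed
  have "\<beta> \<noteq> 0"
  proof
    assume "\<beta> = 0"
    then have "?f \<star> ?f \<star> ?f \<star> ?f = (\<lambda>_. 0)" using \<beta> by simp
    then have "?f \<star> ?f \<star> ?f = (\<lambda>_. 0)" by (rule cancel) (simp add: star_assoc rho_star_e)
    then have "?f \<star> ?f = (\<lambda>_. 0)" by (rule cancel) (simp add: star_assoc rho_star_e)
    then have "?f = (\<lambda>_. 0)" by (rule cancel) (simp add: rho_star_e)
    then have "?f \<one> = 0" by (rule fun_cong)
    then show False by (simp add: \<rho>_def)
  qed
  obtain \<gamma> where \<gamma>: "\<gamma> ^ 4 = inverse \<beta>" using complex_fourth_root by blast
  show ?thesis
  proof (rule that)
    show "eig r \<i> (\<lambda>x. \<gamma> * ?f x)"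
      using rho_eig[of \<i>] by (auto simp: eig_def ga_sel)
    show "e \<star> (\<lambda>x. \<gamma> * ?f x) = (\<lambda>x. \<gamma> * ?f x)" "(\<lambda>x. \<gamma> * ?f x) \<star> e = (\<lambda>x. \<gamma> * ?f x)"
      by (simp_all add: star_scale_left star_scale_right e_star_rho rho_star_e)
    have "(\<lambda>x. \<gamma> * ?f x) \<star> (\<lambda>x. \<gamma> * ?f x) \<star> (\<lambda>x. \<gamma> * ?f x) \<star> (\<lambda>x. \<gamma> * ?f x) = (\<lambda>x. \<gamma> ^ 4 * (\<beta> * e x))"
      by (simp add: star_scale_left star_scale_right \<beta> power4_eq_xxxx mult.assoc)
    then show "(\<lambda>x. \<gamma> * ?f x) \<star> (\<lambda>x. \<gamma> * ?f x) \<star> (\<lambda>x. \<gamma> * ?f x) \<star> (\<lambda>x. \<gamma> * ?f x) = e"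
      using \<open>\<beta> \<noteq> 0\<close> by (simp add: \<gamma> flip: mult.assoc)
  qed
qed

text \<open>
  The component with eigenvalue \<open>q\<^sup>-\<^sup>1\<close> in the decomposition of a function under the translation by \<open>r\<close>, for a
  fourth root of unity \<open>q\<close>. Indexing by the inverse means that a factor of eigenvalue \<open>q\<close> makes it invariant.
\<close>
definition eigenpart :: "complex \<Rightarrow> ('a \<Rightarrow> complex) \<Rightarrow> 'a \<Rightarrow> complex" where
  "eigenpart q h = (\<lambda>x. if x \<in> carrier G then
     (h x + q * h (x \<otimes> r) + q\<^sup>2 * h (x \<otimes> z) + q ^ 3 * h (x \<otimes> z \<otimes> r)) / 4 else 0)"

lemma eigenpart_eig:
  assumes "q * q' = 1" "q ^ 4 = 1"
  shows "eig r q' (eigenpart q h)"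
proof -
  have "q' * q ^ 4 = q * q' * q ^ 3" by (simp add: power4_eq_xxxx power3_eq_cube)
  then have q': "q' = q ^ 3" by (simp add: assms)
  have "eigenpart q h (x \<otimes> r) = q' * eigenpart q h x" if x: "x \<in> carrier G" for x
  proof -
    have "x \<otimes> r \<otimes> z = x \<otimes> z \<otimes> r" "x \<otimes> r \<otimes> z \<otimes> r = x"
      using x r z z_central[OF r] z_square by (simp_all add: m_assoc) (simp add: z_def[symmetric] z_square flip: m_assoc)
    moreover have "q ^ 3 * q = 1" "q ^ 3 * q\<^sup>2 = q" "q ^ 3 * q ^ 3 = q\<^sup>2"
      using assms(2) by (simp_all flip: power_Suc2 power_add)
        (simp_all add: eval_nat_numeral)
    ultimately show ?thesis
      using x r z by (simp add: eigenpart_def rr distrib_left q' mult.assoc[symmetric])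
  qed
  then show ?thesis by (simp add: eig_def eigenpart_def ga_sel)
qed

lemma eigenpart_sum:
  assumes "h \<in> carrier (ga G)"
  shows "h = (\<lambda>x. eigenpart 1 h x + eigenpart \<i> h x + eigenpart (-1) h x + eigenpart (- \<i>) h x)"
proof
  fix x
  show "h x = eigenpart 1 h x + eigenpart \<i> h x + eigenpart (-1) h x + eigenpart (- \<i>) h x"
    using assms by (cases "x \<in> carrier G") (auto simp: eigenpart_def ga_sel field_simps power3_eq_cube)
qed

text \<open>
  The element \<open>p = e + f + f \<star> f + f \<star> f \<star> f\<close> absorbs \<open>f\<close>. Therefore \<open>p \<star> h = p \<star> (f\<^sup>j \<star> h)\<close>, and if \<open>h\<close> is an
  eigenfunction, then a suitable \<open>j\<close> makes \<open>f\<^sup>j \<star> h\<close> invariant, hence a multiple of \<open>e\<close> after multiplication by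
  \<open>e\<close>. The powers of \<open>f\<close> lie in different eigenspaces, so that \<open>p\<close> is not 0. A quarter of \<open>p\<close> is idempotent.
\<close>
lemma minimal_idempotent:
  obtains p where "p \<noteq> (\<lambda>_. 0)" "p \<star> p = (\<lambda>x. 4 * p x)"
    "\<And>h. h \<in> carrier (ga G) \<Longrightarrow> \<exists>c. p \<star> h = (\<lambda>x. c * p x)"
proof -
  obtain f where f: "eig r \<i> f" "e \<star> f = f" "f \<star> e = f" "f \<star> f \<star> f \<star> f = e" by (rule generator)
  define p where "p = (\<lambda>x. e x + f x + (f \<star> f) x + (f \<star> f \<star> f) x)"
  have pf: "p \<star> f = p"
    by (simp add: p_def star_add_left f add_ac)
  have pe: "p \<star> e = p"
    by (simp add: p_def star_add_left f e_idem star_assoc)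
  have eig1: "\<exists>c. p \<star> w = (\<lambda>x. c * p x)" if "eig r 1 w" for w
  proof -
    obtain c where c: "e \<star> w = (\<lambda>x. c * e x)" using e_star_fixed \<open>eig r 1 w\<close> by blast
    have "p \<star> w = p \<star> e \<star> w" by (simp add: pe)
    also have "\<dots> = (\<lambda>x. c * p x)"
      unfolding star_assoc by (simp add: c star_scale_right pe)
    finally show ?thesis by blast
  qed
  have ff: "eig r (-1) (f \<star> f)" "eig r (- \<i>) (f \<star> f \<star> f)"
    using eig_star[OF r f(1) f(1)] eig_star[OF r eig_star[OF r f(1) f(1)] f(1)] by simp_all
  have main: "\<exists>c. p \<star> h = (\<lambda>x. c * p x)" if h: "h \<in> carrier (ga G)" for h
  proof -
    obtain c0 where c0: "p \<star> eigenpart 1 h = (\<lambda>x. c0 * p x)"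
      using eig1[OF eigenpart_eig[of 1 1 h]] by auto
    have "eig r 1 (f \<star> eigenpart \<i> h)"
      using eig_star[OF r f(1) eigenpart_eig[of \<i> "- \<i>" h]] by simp
    from eig1[OF this] obtain c1 where c1: "p \<star> eigenpart \<i> h = (\<lambda>x. c1 * p x)"
      by (auto simp: pf simp flip: star_assoc)
    have "eig r 1 (f \<star> f \<star> eigenpart (-1) h)"
      using eig_star[OF r ff(1) eigenpart_eig[of "-1" "-1" h]] by simp
    from eig1[OF this] obtain c2 where c2: "p \<star> eigenpart (-1) h = (\<lambda>x. c2 * p x)"
      by (auto simp: pf simp flip: star_assoc)
    have "eig r 1 (f \<star> f \<star> f \<star> eigenpart (- \<i>) h)"
      using eig_star[OF r ff(2) eigenpart_eig[of "- \<i>" "\<i>" h]] by simp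
    from eig1[OF this] obtain c3 where c3: "p \<star> eigenpart (- \<i>) h = (\<lambda>x. c3 * p x)"
      by (auto simp: pf simp flip: star_assoc)
    have "p \<star> h = (\<lambda>x. (c0 + c1 + c2 + c3) * p x)"
      by (subst eigenpart_sum[OF h]) (simp add: star_add_right c0 c1 c2 c3 distrib_right)
    then show ?thesis by blast
  qed
  have pp: "p \<star> p = (\<lambda>x. 4 * p x)"
    by (subst (2) p_def) (simp add: star_add_right pe pf flip: star_assoc)
  have "p \<noteq> (\<lambda>_. 0)"
  proof
    assume "p = (\<lambda>_. 0)"
    then have p0: "p x = 0" for x by (rule fun_cong)
    have "e x = 0" for x
    proof (cases "x \<in> carrier G")
      case x: True
      have s: "k (x \<otimes> r) = q * k x" "k (x \<otimes> r \<otimes> r) = q * q * k x" "k (x \<otimes> r \<otimes> r \<otimes> r) = q * q * q * k x"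
        if "eig r q k" for q k
        using that x r by (auto simp: eig_def)
      \<comment> \<open>Averaging over translations by powers of \<open>r\<close> removes all components but \<open>e\<close>.\<close>
      have "4 * e x = p x + p (x \<otimes> r) + p (x \<otimes> r \<otimes> r) + p (x \<otimes> r \<otimes> r \<otimes> r)"
        unfolding p_def by (simp add: s[OF e_eig] s[OF f(1)] s[OF ff(1)] s[OF ff(2)])
      then show ?thesis by (simp add: p0)
    next
      case False
      then show ?thesis using e_eig by (auto simp: eig_def ga_sel)
    qed
    then have "\<rho> 0 = (\<lambda>_. 0)" using e_star_rho[of 0] star_zero_left by (metis (no_types, lifting) ext)
    then have "\<rho> 0 \<one> = 0" by (rule fun_cong)
    then show False by (simp add: \<rho>_def)
  qed
  then show ?thesis using that pp main by blast
qed

text \<open>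
  The coefficient of \<open>p\<close> in \<open>p \<star> h\<close> depends multiplicatively on \<open>h\<close> because \<open>\<star>\<close> is associative. It is nonzero at
  \<open>h = p\<close>.
\<close>
lemma twisted_character:
  obtains v where "v \<in> carrier (ga G)" "v \<noteq> (\<lambda>_. 0)"
    "\<Omega> \<cdot>\<^sub>2 diag v = tens v v"
proof -
  interpret G2: finite_group "sq G" by (rule sq)
  obtain p where p: "p \<noteq> (\<lambda>_. 0)" "p \<star> p = (\<lambda>x. 4 * p x)"
    "\<And>h. h \<in> carrier (ga G) \<Longrightarrow> \<exists>c. p \<star> h = (\<lambda>x. c * p x)" by (rule minimal_idempotent) blast
  \<comment> \<open>Comparing values at one point where \<open>p\<close> does not vanish gives a formula for the coefficient of \<open>p\<close>
    that is visibly linear in \<open>h\<close>.\<close>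
  obtain x0 where x0: "p x0 \<noteq> 0" using p(1) by auto
  define v where "v = (\<lambda>g. if g \<in> carrier G then (p \<star> bvec g) x0 / p x0 else 0)"
  have vc: "v \<in> carrier (ga G)" by (simp add: v_def ga_sel)
  have v: "p \<star> h = (\<lambda>x. ev G v h * p x)" for h
  proof -
    let ?h = "\<lambda>x. \<Sum>g\<in>carrier G. h g * bvec g x"
    have h: "?h x = h x" if "x \<in> carrier G" for x
    proof -
      have "?h x = (\<Sum>g\<in>carrier G. bvec x g * h g)" by (rule sum.cong) (auto simp: bvec_def)
      then show ?thesis using sum_bvec[OF finite_carrier that] by simp
    qed
    have "p \<star> h = p \<star> ?h" by (rule star_cong) (simp_all add: h)
    then have 1: "p \<star> h = (\<lambda>x. \<Sum>g\<in>carrier G. h g * (p \<star> bvec g) x)"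
      by (simp add: star_sum_right star_scale_right)
    have "?h \<in> carrier (ga G)" by (auto simp: ga_sel bvec_def intro!: sum.neutral)
    then obtain c where c: "p \<star> h = (\<lambda>x. c * p x)" using p(3) \<open>p \<star> h = p \<star> ?h\<close> by metis
    have "ev G v h * p x0 = (p \<star> h) x0"
      unfolding 1 ev_def sum_distrib_right by (rule sum.cong) (use x0 in \<open>auto simp: v_def\<close>)
    then have "ev G v h = c" using c x0 by simp
    with c show ?thesis by simp
  qed
  have mult: "ev G v (f \<star> h) = ev G v f * ev G v h" for f h
  proof -
    have "(\<lambda>x. ev G v (f \<star> h) * p x) = p \<star> f \<star> h"
      unfolding star_assoc by (rule v[symmetric])
    also have "\<dots> = (\<lambda>x. ev G v f * (ev G v h * p x))" by (simp add: v star_scale_left)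
    finally have "ev G v (f \<star> h) * p x0 = ev G v f * (ev G v h * p x0)" by (rule fun_cong)
    then show ?thesis using x0 by simp
  qed
  have "ev G v p * p x0 = 4 * p x0" using fun_cong[OF v[of p], of x0] p(2) by simp
  then have "v \<noteq> (\<lambda>_. 0)" using x0 by (auto simp: ev_def)
  moreover have "\<Omega> \<cdot>\<^sub>2 diag v = tens v v"
  proof
    fix gh :: "'a \<times> 'a"
    obtain g h where gh: "gh = (g, h)" by force
    show "(\<Omega> \<cdot>\<^sub>2 diag v) gh = tens v v gh"
    proof (cases "gh \<in> carrier (sq G)")
      case True
      then have g: "g \<in> carrier G" "h \<in> carrier G" by (auto simp: gh)
      have "(\<Omega> \<cdot>\<^sub>2 diag v) gh = ev (sq G) (\<Omega> \<cdot>\<^sub>2 diag v) (bvec (g, h))"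
        using True by (simp only: gh ev_bvec_right G2.finite_carrier)
      also have "\<dots> = ev (sq G) \<Omega> (\<lambda>p. ev G v (\<lambda>x. bvec (g, h) (p \<otimes>\<^bsub>sq G\<^esub> (x, x))))"
        unfolding G2.ev_mult by (rule ev_cong, subst ev_push) auto
      also have "\<dots> = ev G v (\<lambda>x. ev (sq G) \<Omega> (\<lambda>p. bvec (g, h) (p \<otimes>\<^bsub>sq G\<^esub> (x, x))))"
        by (rule ev_swap)
      also have "\<dots> = ev G v (bvec g \<star> bvec h)"
        by (intro ev_cong) (auto simp: star_def bvec_def intro!: ev_cong)
      also have "\<dots> = v g * v h" using g by (simp add: mult ev_bvec_right)
      finally show ?thesis by (simp add: gh tens_def)
    next
      case False
      then show ?thesis
        using tens_closed[OF vc vc] G2.ga_closed[of \<Omega> "diag v"] unfolding ga_sel by metis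
    qed
  qed
  ultimately show ?thesis using that vc by blast
qed

text \<open>
  Unitarity of \<open>\<Omega>\<close> makes \<open>v\<^sup>* v\<close> group-like, and its coefficient at the identity is the sum of the
  \<open>\<bar>v(g)\<bar>\<^sup>2\<close>, which is not 0; so it is 1. For \<open>v v\<^sup>*\<close> the same argument needs invariance of \<open>\<Omega>\<close>.
\<close>
theorem cocycle_is_coboundary:
  obtains v where "normalizes v" "\<Omega> = bd v"
proof -
  interpret M: monoid "ga G" by (rule monoid_ga)
  interpret M2: monoid "ga (sq G)" by (rule monoid2)
  interpret G2: finite_group "sq G" by (rule sq)
  obtain v where v: "v \<in> carrier (ga G)" "v \<noteq> (\<lambda>_. 0)" "\<Omega> \<cdot>\<^sub>2 diag v = tens v v"
    by (rule twisted_character)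
  let ?a = "adj G v"
  have c: "?a \<in> carrier (ga G)" "\<Omega> \<in> carrier (ga (sq G))" "adj (sq G) \<Omega> \<in> carrier (ga (sq G))"
    "diag v \<in> carrier (ga (sq G))" "diag ?a \<in> carrier (ga (sq G))"
    "tens v v \<in> carrier (ga (sq G))" "tens ?a ?a \<in> carrier (ga (sq G))"
    using v(1) adj_closed cocycleD(1) G2.adj_closed by (auto intro!: push_closed tens_closed)
  have u: "adj (sq G) \<Omega> \<cdot>\<^sub>2 \<Omega> = \<one>\<^bsub>ga (sq G)\<^esub>"
    "\<Omega> \<cdot>\<^sub>2 adj (sq G) \<Omega> = \<one>\<^bsub>ga (sq G)\<^esub>"
    using cocycleD(4) by (simp_all add: G2.unitary_iff)
  have a: "tens ?a ?a = diag ?a \<cdot>\<^sub>2 adj (sq G) \<Omega>"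
    using v(1) by (simp add: v(3)[symmetric] G2.adj_mult push_adj[OF finite_group_axioms sq homs(5)]
        flip: adj_tens)
  have norm_one: "y \<cdot> y' = \<one>\<^bsub>ga G\<^esub>"
    if y: "y \<in> carrier (ga G)" "y' \<in> carrier (ga G)" "diag (y \<cdot> y') = tens (y \<cdot> y') (y \<cdot> y')"
      "y' = adj G y" "y \<noteq> (\<lambda>_. 0)" for y y'
  proof -
    have "(y \<cdot> y') \<one> = ev G (y \<cdot> y') (bvec \<one>)" by (simp add: ev_bvec_right)
    also have "\<dots> = ev G y (\<lambda>a. ev G y' (bvec (inv a)))"
      unfolding ev_mult by (intro ev_cong) (auto simp: bvec_def inv_equality r_inv dest: inv_equality)
    also have "\<dots> = ev G y (\<lambda>a. cnj (y a))"
      by (intro ev_cong) (auto simp: ev_bvec_right y(4) adj_apply)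
    also have "\<dots> = of_real (\<Sum>g\<in>carrier G. (cmod (y g))\<^sup>2)"
      unfolding ev_def of_real_sum complex_norm_square ..
    finally have *: "(y \<cdot> y') \<one> = of_real (\<Sum>g\<in>carrier G. (cmod (y g))\<^sup>2)" .
    obtain g where g: "y g \<noteq> 0" using y(5) by auto
    then have "g \<in> carrier G" using y(1) by (auto simp: ga_sel)
    then have "(\<Sum>g\<in>carrier G. (cmod (y g))\<^sup>2) > 0"
      using g by (intro sum_pos2[of _ g]) auto
    then have "(y \<cdot> y') \<one> \<noteq> 0" unfolding * of_real_eq_0_iff by linarith
    from grouplike[OF _ y(3) this] show ?thesis using y by (simp add: ga_sel(2))
  qed
  have n1: "?a \<cdot> v = \<one>\<^bsub>ga G\<^esub>"
  proof (rule norm_one)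
    have "tens (?a \<cdot> v) (?a \<cdot> v) = tens ?a ?a \<cdot>\<^sub>2 tens v v"
      using v(1) c by (simp add: tens_mult)
    also have "\<dots> = diag ?a \<cdot>\<^sub>2 (adj (sq G) \<Omega> \<cdot>\<^sub>2 \<Omega>) \<cdot>\<^sub>2 diag v"
      using c by (simp add: a v(3)[symmetric] M2.m_assoc del: u)
    also have "\<dots> = diag (?a \<cdot> v)"
      using c v(1) by (simp add: u hom_mult[OF push_homs(5)])
    finally show "diag (?a \<cdot> v) = tens (?a \<cdot> v) (?a \<cdot> v)" by simp
    show "?a \<noteq> (\<lambda>_. 0)"
    proof
      assume "?a = (\<lambda>_. 0)"
      then have "adj G ?a = (\<lambda>_. 0)" by (simp add: alg_star_def)
      then show False using v adj_adj by simp
    qed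
  qed (use v c adj_adj in auto)
  have n2: "v \<cdot> ?a = \<one>\<^bsub>ga G\<^esub>"
  proof (rule norm_one)
    have "tens (v \<cdot> ?a) (v \<cdot> ?a) = tens v v \<cdot>\<^sub>2 tens ?a ?a"
      using v(1) c by (simp add: tens_mult)
    also have "\<dots> = \<Omega> \<cdot>\<^sub>2 diag (v \<cdot> ?a) \<cdot>\<^sub>2 adj (sq G) \<Omega>"
      using c v(1) by (simp add: a v(3)[symmetric] M2.m_assoc hom_mult[OF push_homs(5)])
    also have "\<Omega> \<cdot>\<^sub>2 diag (v \<cdot> ?a) = diag (v \<cdot> ?a) \<cdot>\<^sub>2 \<Omega>"
      using cocycleD(3) v(1) c by (simp add: invariant_iff)
    also have "\<dots> \<cdot>\<^sub>2 adj (sq G) \<Omega> = diag (v \<cdot> ?a)"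
      using c v(1) by (simp add: M2.m_assoc u hom_mult[OF push_homs(5)])
    finally show "diag (v \<cdot> ?a) = tens (v \<cdot> ?a) (v \<cdot> ?a)" by simp
  qed (use v c in auto)
  have un: "alg_unitary (group_algebra G) v"
    using v n1 n2 by (simp add: unitary_iff)
  have "bd v = \<Omega> \<cdot>\<^sub>2 (diag v \<cdot>\<^sub>2 diag ?a)"
    using c unitary_Units[OF un] by (simp add: coboundary_eq v(3)[symmetric] M2.m_assoc)
  also have "diag v \<cdot>\<^sub>2 diag ?a = \<one>\<^bsub>ga (sq G)\<^esub>"
    using c v(1) n2 push_ones(5) by (simp flip: hom_mult[OF push_homs(5)])
  finally have "\<Omega> = bd v" using c by simp
  moreover have "normalizes v"
    using invariant_bd_normalizes[OF un] cocycleD(3) \<open>\<Omega> = bd v\<close> by simp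
  ultimately show ?thesis using that by blast
qed

end

section \<open>Cohomology with two classes\<close>

lemma group_of_two_elements:
  assumes "group K" "carrier K = {\<one>\<^bsub>K\<^esub>, a}" "a \<noteq> \<one>\<^bsub>K\<^esub>"
  shows "K \<cong> integer_mod_group 2"
proof -
  interpret K: group K by fact
  have a: "a \<in> carrier K" using assms by simp
  have "a \<otimes>\<^bsub>K\<^esub> a \<noteq> a" using a assms(3) by simp
  then have aa: "a \<otimes>\<^bsub>K\<^esub> a = \<one>\<^bsub>K\<^esub>" using K.m_closed[OF a a] assms(2) by auto
  have c: "carrier (integer_mod_group 2) = {0, 1}" by (auto simp: carrier_integer_mod_group)
  let ?f = "\<lambda>x. if x = a then 1 else 0 :: int"
  have "?f \<in> iso K (integer_mod_group 2)"
    unfolding iso_def hom_def bij_betw_def using a aa assms c by (auto simp: inj_on_def)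
  then show ?thesis by (auto simp: is_iso_def)
qed

context finite_group
begin

lemma A1u_iff:
  "w \<in> A1u (group_algebra G) \<longleftrightarrow> alg_unitary (group_algebra G) w \<and>
    (\<forall>y\<in>carrier (ga G). w \<cdot> y = y \<cdot> w)"
  by (auto simp: A1u_def alg_central_def elements_ga alg_mult_ga unitary_iff)

lemma A1u_normalizes: "w \<in> A1u (group_algebra G) \<Longrightarrow> normalizes w"
  using bvec_closed by (auto simp: A1u_iff normalizes_def)

lemma normalizesD:
  assumes "normalizes v"
  shows "alg_unitary (group_algebra G) v" "v \<in> Units (ga G)" "v \<in> carrier (ga G)"
  using assms unitary_Units unitary_iff by (auto simp: normalizes_def)

lemma bvec_Units:
  assumes "h \<in> carrier G"
  shows "bvec h \<in> Units (ga G)" "inv\<^bsub>ga G\<^esub> (bvec h) = bvec (inv h)"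
proof -
  interpret M: monoid "ga G" by (rule monoid_ga)
  have e: "bvec h \<cdot> bvec (inv h) = \<one>\<^bsub>ga G\<^esub>" "bvec (inv h) \<cdot> bvec h = \<one>\<^bsub>ga G\<^esub>"
    using assms by (simp_all add: bvec_mult ga_sel(2))
  show "bvec h \<in> Units (ga G)"
    using e assms bvec_closed[of h] bvec_closed[of "inv h"] by (auto simp: Units_def)
  show "inv\<^bsub>ga G\<^esub> (bvec h) = bvec (inv h)"
    using M.inv_unique'[OF _ _ e] assms bvec_closed by auto
qed

lemma adj_bvec: "h \<in> carrier G \<Longrightarrow> adj G (bvec h) = bvec (inv h)"
  by (subst alg_star_bvec) (simp_all add: group_algebra_def)

lemma unitary_bvec: "h \<in> carrier G \<Longrightarrow> alg_unitary (group_algebra G) (bvec h)"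
  by (simp add: unitary_iff bvec_closed adj_bvec bvec_mult ga_sel(2))

lemma bd_mult_bvec:
  assumes "v \<in> Units (ga G)" "h \<in> carrier G"
  shows "bd (v \<cdot> bvec h) = bd v"
proof -
  interpret M: monoid "ga G" by (rule monoid_ga)
  interpret M2: monoid "ga (sq G)" by (rule monoid2)
  interpret G2: finite_group "sq G" by (rule sq)
  let ?w = "inv\<^bsub>ga G\<^esub> v"
  have c: "v \<in> carrier (ga G)" "?w \<in> carrier (ga G)" "bvec h \<in> carrier (ga G)" "bvec (inv h) \<in> carrier (ga G)"
    "tens v v \<in> carrier (ga (sq G))" "diag ?w \<in> carrier (ga (sq G))"
    "bvec (h, h) \<in> carrier (ga (sq G))" "bvec (inv h, inv h) \<in> carrier (ga (sq G))"
    using assms bvec_closed G2.bvec_closed M.Units_closed by (auto intro!: tens_closed push_closed)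
  have "bd (v \<cdot> bvec h) = tens v v \<cdot>\<^sub>2 (bvec (h, h) \<cdot>\<^sub>2 bvec (inv h, inv h)) \<cdot>\<^sub>2 diag ?w"
    using assms c bvec_Units[OF assms(2)]
    by (simp add: coboundary_eq M.Units_inv_mult hom_mult[OF push_homs(5)] push_bvec M2.m_assoc
        tens_mult[symmetric] tens_bvec)
  also have "\<dots> = bd v"
  proof -
    have "bvec (h, h) \<cdot>\<^sub>2 bvec (inv h, inv h) = \<one>\<^bsub>ga (sq G)\<^esub>"
      using assms(2) by (simp add: G2.bvec_mult ga_sel(2))
    then show ?thesis using c by (simp add: coboundary_eq)
  qed
  finally show ?thesis .
qed

text \<open>
  The map \<open>bd\<close> is not multiplicative on all normalizing unitaries. A central left factor is harmless, as
  \<open>\<Delta>(w\<^sup>-\<^sup>1)\<close> commutes with the invariant element \<open>bd v\<close>.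
\<close>
lemma bd_central_mult:
  assumes w: "w \<in> A1u (group_algebra G)" and v: "normalizes v"
  shows "bd (w \<cdot> v) = bd w \<cdot>\<^sub>2 bd v"
proof -
  interpret M: monoid "ga G" by (rule monoid_ga)
  interpret M2: monoid "ga (sq G)" by (rule monoid2)
  note W = normalizesD[OF A1u_normalizes[OF w]] and V = normalizesD[OF v]
  let ?iw = "inv\<^bsub>ga G\<^esub> w" and ?iv = "inv\<^bsub>ga G\<^esub> v"
  have c: "?iw \<in> carrier (ga G)" "?iv \<in> carrier (ga G)" using W V by auto
  have t: "tens w w \<in> carrier (ga (sq G))" "tens v v \<in> carrier (ga (sq G))" "bd v \<in> carrier (ga (sq G))"
    "diag x \<in> carrier (ga (sq G))" for x
    using W V bd_closed by (auto intro!: tens_closed push_closed)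
  have "bd (w \<cdot> v) = tens w w \<cdot>\<^sub>2 (tens v v \<cdot>\<^sub>2 diag ?iv) \<cdot>\<^sub>2 diag ?iw"
    using W V c t
    by (simp add: coboundary_eq M.Units_inv_mult hom_mult[OF push_homs(5)] M2.m_assoc flip: tens_mult)
  also have "\<dots> = tens w w \<cdot>\<^sub>2 (bd v \<cdot>\<^sub>2 diag ?iw)"
    using t by (simp add: M2.m_assoc coboundary_eq)
  also have "bd v \<cdot>\<^sub>2 diag ?iw = diag ?iw \<cdot>\<^sub>2 bd v"
    using bd_invariant[OF v] c by (simp add: invariant_iff)
  also have "tens w w \<cdot>\<^sub>2 \<dots> = bd w \<cdot>\<^sub>2 bd v"
    using t by (simp add: M2.m_assoc coboundary_eq[of w])
  finally show ?thesis .
qed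

lemma bd_central:
  assumes w: "w \<in> A1u (group_algebra G)" and \<Omega>: "\<Omega> \<in> cocycles"
  shows "bd w \<cdot>\<^sub>2 \<Omega> = \<Omega> \<cdot>\<^sub>2 bd w"
proof -
  interpret M: monoid "ga G" by (rule monoid_ga)
  interpret M2: monoid "ga (sq G)" by (rule monoid2)
  interpret G2: finite_group "sq G" by (rule sq)
  note W = normalizesD[OF A1u_normalizes[OF w]]
  have \<Omega>c: "\<Omega> \<in> carrier (ga (sq G))" and inv: "invariant (group_algebra G) \<Omega>"
    using \<Omega> monoid.Units_closed[OF monoid2] by (auto simp: cocycles_def two_cocycle_iff)
  have t: "tens w w \<in> carrier (ga (sq G))" "diag x \<in> carrier (ga (sq G))" for x
    using W by (auto intro!: tens_closed push_closed)
  have "tens w w \<cdot>\<^sub>2 bvec p = bvec p \<cdot>\<^sub>2 tens w w" if pc: "p \<in> carrier (sq G)" for p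
  proof -
    obtain a b where p: "p = (a, b)" "a \<in> carrier G" "b \<in> carrier G" using pc by auto
    have "bvec a \<in> carrier (ga G)" "bvec b \<in> carrier (ga G)" using p bvec_closed by auto
    moreover have "w \<cdot> bvec a = bvec a \<cdot> w" "w \<cdot> bvec b = bvec b \<cdot> w"
      using w calculation unfolding A1u_iff by blast+
    ultimately show ?thesis using W by (simp add: p tens_mult flip: tens_bvec)
  qed
  then have "tens w w \<cdot>\<^sub>2 \<Omega> = \<Omega> \<cdot>\<^sub>2 tens w w"
    by (rule G2.commute_all) (use \<Omega>c in auto)
  moreover have "diag (inv\<^bsub>ga G\<^esub> w) \<cdot>\<^sub>2 \<Omega> = \<Omega> \<cdot>\<^sub>2 diag (inv\<^bsub>ga G\<^esub> w)"
    using inv W by (simp add: invariant_iff)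
  ultimately show ?thesis
    unfolding coboundary_eq using t \<Omega>c by (intro M2.commute_mult) auto
qed

lemma A1u_mult:
  assumes "w \<in> A1u (group_algebra G)" "w' \<in> A1u (group_algebra G)"
  shows "w \<cdot> w' \<in> A1u (group_algebra G)"
  unfolding A1u_iff
proof (intro conjI ballI)
  show "alg_unitary (group_algebra G) (w \<cdot> w')"
    using assms unitary_mult unfolding A1u_iff by blast
  fix y assume "y \<in> carrier (ga G)"
  then show "w \<cdot> w' \<cdot> y = y \<cdot> (w \<cdot> w')"
    using assms monoid.commute_mult[OF monoid_ga, of w w' y] unfolding A1u_iff unitary_iff by blast
qed

lemma A1u_adj:
  assumes "w \<in> A1u (group_algebra G)"
  shows "adj G w \<in> A1u (group_algebra G)"
proof -
  have "alg_unitary (group_algebra G) w" using assms by (simp add: A1u_iff)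
  note u = unitary_Units[OF this] unitary_adj[OF this]
  show ?thesis
    using assms u monoid.inv_commute[OF monoid_ga u(1)] unfolding A1u_iff by metis
qed

lemma A1u_one: "\<one>\<^bsub>ga G\<^esub> \<in> A1u (group_algebra G)"
  using unitary_one monoid.l_one[OF monoid_ga] monoid.r_one[OF monoid_ga] by (simp add: A1u_iff)

lemma bd_one: "bd \<one>\<^bsub>ga G\<^esub> = \<one>\<^bsub>ga (sq G)\<^esub>"
proof -
  interpret M: monoid "ga G" by (rule monoid_ga)
  interpret M2: monoid "ga (sq G)" by (rule monoid2)
  show ?thesis by (simp add: coboundary_eq tens_unit push_ones)
qed

lemma bd_adj:
  assumes "w \<in> A1u (group_algebra G)"
  shows "bd (adj G w) \<cdot>\<^sub>2 bd w = \<one>\<^bsub>ga (sq G)\<^esub>"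
proof -
  have "adj G w \<cdot> w = \<one>\<^bsub>ga G\<^esub>" using assms unfolding A1u_iff unitary_iff by blast
  then show ?thesis
    using bd_central_mult[OF A1u_adj[OF assms] A1u_normalizes[OF assms]] by (simp add: bd_one)
qed

lemma A2u_sel:
  "carrier (A2u (group_algebra G)) = cocycles" "\<Omega> \<otimes>\<^bsub>A2u (group_algebra G)\<^esub> \<Omega>' = \<Omega> \<cdot>\<^sub>2 \<Omega>'"
  "\<one>\<^bsub>A2u (group_algebra G)\<^esub> = \<one>\<^bsub>ga (sq G)\<^esub>"
  by (simp_all add: A2u_group_algebra units_of_def)

lemma coboundaries_normal: "(bd ` A1u (group_algebra G)) \<lhd> A2u (group_algebra G)"
proof -
  let ?A = "A2u (group_algebra G)" and ?B = "bd ` A1u (group_algebra G)"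
  interpret A: group ?A by (rule group_A2u)
  have sub: "?B \<subseteq> carrier ?A" using bd_in_cocycles A1u_normalizes by (auto simp: A2u_sel)
  have "subgroup ?B ?A"
  proof (rule A.subgroupI)
    show "?B \<noteq> {}" using A1u_one by auto
    fix a b assume "a \<in> ?B" "b \<in> ?B"
    then show "a \<otimes>\<^bsub>?A\<^esub> b \<in> ?B"
      using A1u_mult by (auto simp: A2u_sel bd_central_mult[symmetric] A1u_normalizes)
  next
    fix a assume "a \<in> ?B"
    then obtain w where w: "w \<in> A1u (group_algebra G)" "a = bd w" by auto
    have "inv\<^bsub>?A\<^esub> a = bd (adj G w)"
      by (rule A.inv_equality) (use w bd_adj[OF w(1)] sub A1u_adj[OF w(1)] in \<open>auto simp: A2u_sel\<close>)
    then show "inv\<^bsub>?A\<^esub> a \<in> ?B" using A1u_adj w by auto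
  qed (rule sub)
  then show ?thesis
    unfolding A.normal_inv_iff
  proof (safe)
    fix x w assume x: "x \<in> carrier ?A" and w: "w \<in> A1u (group_algebra G)"
    have "x \<otimes>\<^bsub>?A\<^esub> bd w = bd w \<otimes>\<^bsub>?A\<^esub> x" using bd_central[OF w] x by (simp add: A2u_sel)
    then have "x \<otimes>\<^bsub>?A\<^esub> bd w \<otimes>\<^bsub>?A\<^esub> inv\<^bsub>?A\<^esub> x = bd w"
      using x w sub by (auto simp: A.m_assoc)
    then show "x \<otimes>\<^bsub>?A\<^esub> bd w \<otimes>\<^bsub>?A\<^esub> inv\<^bsub>?A\<^esub> x \<in> ?B" using w by auto
  qed
qed

lemma bd_eq_one:
  assumes "x \<in> Units (ga G)" "bd x = \<one>\<^bsub>ga (sq G)\<^esub>"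
  shows "\<exists>h\<in>carrier G. x = bvec h"
proof -
  interpret M: monoid "ga G" by (rule monoid_ga)
  interpret M2: monoid "ga (sq G)" by (rule monoid2)
  have x: "x \<in> carrier (ga G)" using assms M.Units_closed by auto
  have t: "tens x x \<in> carrier (ga (sq G))" "diag y \<in> carrier (ga (sq G))" for y
    using x by (auto intro!: tens_closed push_closed)
  have "diag x = tens x x \<cdot>\<^sub>2 (diag (inv\<^bsub>ga G\<^esub> x) \<cdot>\<^sub>2 diag x)"
    using assms t by (simp add: coboundary_eq flip: M2.m_assoc)
  also have "diag (inv\<^bsub>ga G\<^esub> x) \<cdot>\<^sub>2 diag x = \<one>\<^bsub>ga (sq G)\<^esub>"
    using assms(1) x push_ones(5) by (simp flip: hom_mult[OF push_homs(5)])
  finally have d: "diag x = tens x x" using t by simp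
  have "\<exists>h. x h \<noteq> 0"
  proof (rule ccontr)
    assume "\<not> ?thesis"
    then have x0: "x = (\<lambda>_. 0)" by auto
    have "ev G (x \<cdot> inv\<^bsub>ga G\<^esub> x) (\<lambda>_. 1) = 0"
      unfolding ev_mult by (simp add: ev_def x0)
    then show False using assms(1) by (simp add: ga_sel(2) ev_bvec)
  qed
  then obtain h where h: "x h \<noteq> 0" by auto
  have "h \<in> carrier G" using h x unfolding ga_sel by blast
  with grouplike[OF x d h] show ?thesis by auto
qed

text \<open>
  Right multiplication of \<open>v\<close> by a group element does not change \<open>bd v\<close>, and central left factors only contribute
  coboundaries; so \<open>split\<close> leaves the trivial class and the class of \<open>bd v0\<close>. They differ because \<open>bd x = 1\<close> only
  for group elements \<open>x\<close>.
\<close>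
theorem H2_uinv_two_classes:
  assumes cob: "\<And>\<Omega>. \<Omega> \<in> cocycles \<Longrightarrow> \<exists>v. normalizes v \<and> \<Omega> = bd v"
    and v0: "normalizes v0"
    and split: "\<And>v. normalizes v \<Longrightarrow> \<exists>w\<in>A1u (group_algebra G). \<exists>h\<in>carrier G.
      v = w \<cdot> bvec h \<or> v = w \<cdot> v0 \<cdot> bvec h"
    and outer: "\<And>w h. w \<in> A1u (group_algebra G) \<Longrightarrow> h \<in> carrier G \<Longrightarrow> v0 \<noteq> w \<cdot> bvec h"
  shows "H2_uinv (group_algebra G) \<cong> integer_mod_group 2"
proof -
  let ?A = "A2u (group_algebra G)" and ?B = "bd ` A1u (group_algebra G)"
  interpret M: monoid "ga G" by (rule monoid_ga)
  interpret A: group ?A by (rule group_A2u)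
  interpret B: normal ?B ?A by (rule coboundaries_normal)
  have v0c: "bd v0 \<in> carrier ?A" using bd_in_cocycles[OF v0] by (simp add: A2u_sel)
  have "bd v0 \<notin> ?B"
  proof
    assume "bd v0 \<in> ?B"
    then obtain w where w: "w \<in> A1u (group_algebra G)" "bd v0 = bd w" by auto
    let ?x = "adj G w \<cdot> v0"
    have wu: "w \<in> carrier (ga G)" "adj G w \<in> Units (ga G)" "adj G w \<in> carrier (ga G)"
        "w \<cdot> adj G w = \<one>\<^bsub>ga G\<^esub>"
      using w(1) A1u_adj[OF w(1)] unitary_Units unfolding A1u_iff unitary_iff by blast+
    have "bd ?x = \<one>\<^bsub>ga (sq G)\<^esub>"
      using bd_central_mult[OF A1u_adj[OF w(1)] v0] bd_adj[OF w(1)] w(2) by simp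
    moreover have "?x \<in> Units (ga G)" using wu normalizesD[OF v0] by simp
    ultimately obtain h where h: "h \<in> carrier G" "?x = bvec h" using bd_eq_one by blast
    have "v0 = w \<cdot> ?x" using wu normalizesD[OF v0] by (simp flip: M.m_assoc)
    then show False using outer[OF w(1) h(1)] h(2) by simp
  qed
  then have ne: "?B #>\<^bsub>?A\<^esub> bd v0 \<noteq> ?B" using A.coset_join1 v0c B.is_subgroup B.subset by blast
  have "rcosets\<^bsub>?A\<^esub> ?B = {?B, ?B #>\<^bsub>?A\<^esub> bd v0}"
  proof (rule equalityI; rule subsetI)
    fix C assume "C \<in> rcosets\<^bsub>?A\<^esub> ?B"
    then obtain \<Omega> where \<Omega>: "\<Omega> \<in> cocycles" "C = ?B #>\<^bsub>?A\<^esub> \<Omega>" by (auto simp: RCOSETS_def A2u_sel)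
    obtain v where v: "normalizes v" "\<Omega> = bd v" using cob[OF \<Omega>(1)] by auto
    obtain w h where w: "w \<in> A1u (group_algebra G)" "h \<in> carrier G"
      "v = w \<cdot> bvec h \<or> v = w \<cdot> v0 \<cdot> bvec h" using split[OF v(1)] by auto
    have wB: "bd w \<in> ?B" using w by auto
    have U: "w \<in> Units (ga G)" "v0 \<in> Units (ga G)"
      using normalizesD[OF v0] normalizesD[OF A1u_normalizes[OF w(1)]] by auto
    from w(3) show "C \<in> {?B, ?B #>\<^bsub>?A\<^esub> bd v0}"
    proof
      assume "v = w \<cdot> bvec h"
      then have "\<Omega> = bd w" using v bd_mult_bvec[OF U(1) w(2)] by simp
      then show ?thesis using \<Omega>(2) A.coset_join2[OF _ B.is_subgroup wB] wB B.subset by auto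
    next
      assume "v = w \<cdot> v0 \<cdot> bvec h"
      then have "\<Omega> = bd w \<otimes>\<^bsub>?A\<^esub> bd v0"
        using v bd_mult_bvec[OF M.Units_m_closed[OF U] w(2)] bd_central_mult[OF w(1) v0] by (simp add: A2u_sel)
      then have "C = ?B #>\<^bsub>?A\<^esub> bd v0"
        using \<Omega>(2) A.coset_join2[OF _ B.is_subgroup wB] wB B.subset v0c
          A.coset_mult_assoc[OF B.subset _ v0c, of "bd w"] by auto
      then show ?thesis by simp
    qed
  next
    fix C assume "C \<in> {?B, ?B #>\<^bsub>?A\<^esub> bd v0}"
    then show "C \<in> rcosets\<^bsub>?A\<^esub> ?B"
      using A.rcosetsI[OF B.subset v0c] B.subgroup_in_rcosets[OF A.is_group] by auto
  qed
  then show ?thesis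
    unfolding H2_uinv_def
    by (intro group_of_two_elements[where a = "?B #>\<^bsub>?A\<^esub> bd v0"] B.factorgroup_is_group)
      (use ne in \<open>auto simp: FactGroup_def\<close>)
qed

text \<open>
  The relation \<open>v\<^sup>-\<^sup>1 g v = h\<close>, kept free of inverses so that it makes sense before \<open>v\<close> is known to be invertible.
\<close>
definition carries :: "('a \<Rightarrow> complex) \<Rightarrow> 'a \<Rightarrow> 'a \<Rightarrow> bool" where
  "carries v g h \<longleftrightarrow> g \<in> carrier G \<and> h \<in> carrier G \<and> bvec g \<cdot> v = v \<cdot> bvec h"

lemma normalizes_iff:
  "normalizes v \<longleftrightarrow> alg_unitary (group_algebra G) v \<and> (\<forall>g\<in>carrier G. \<exists>h. carries v g h)"
  by (auto simp: normalizes_def carries_def)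

lemma carries_mult:
  assumes "v \<in> carrier (ga G)" "carries v g h" "carries v g' h'"
  shows "carries v (g \<otimes> g') (h \<otimes> h')"
proof -
  interpret M: monoid "ga G" by (rule monoid_ga)
  note a = assms(2,3)[unfolded carries_def]
  have c: "bvec g \<in> carrier (ga G)" "bvec g' \<in> carrier (ga G)" "bvec h \<in> carrier (ga G)" "bvec h' \<in> carrier (ga G)"
    using a bvec_closed by auto
  have "bvec (g \<otimes> g') \<cdot> v = bvec g \<cdot> (bvec g' \<cdot> v)"
    using a c assms(1) by (simp add: M.m_assoc flip: bvec_mult)
  also have "\<dots> = (bvec g \<cdot> v) \<cdot> bvec h'"
    using a c assms(1) by (metis M.m_assoc)
  also have "\<dots> = v \<cdot> bvec (h \<otimes> h')"
    using a c assms(1) by (simp add: M.m_assoc bvec_mult)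
  finally show ?thesis using a by (simp add: carries_def)
qed

lemma carries_one: "v \<in> carrier (ga G) \<Longrightarrow> carries v \<one> \<one>"
  using monoid.l_one[OF monoid_ga, of v] monoid.r_one[OF monoid_ga, of v] by (simp add: carries_def ga_sel(2))

lemma carries_right:
  assumes "v \<in> carrier (ga G)" "carries v g h" "k \<in> carrier G" "h' \<in> carrier G" "h \<otimes> k = k \<otimes> h'"
  shows "carries (v \<cdot> bvec k) g h'"
proof -
  interpret M: monoid "ga G" by (rule monoid_ga)
  note a = assms(2)[unfolded carries_def]
  have c: "bvec g \<in> carrier (ga G)" "bvec k \<in> carrier (ga G)" "bvec h \<in> carrier (ga G)" "bvec h' \<in> carrier (ga G)"
    using a assms bvec_closed by auto
  have "bvec g \<cdot> (v \<cdot> bvec k) = v \<cdot> (bvec h \<cdot> bvec k)"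
    using a c assms(1) by (metis M.m_assoc)
  also have "\<dots> = v \<cdot> bvec k \<cdot> bvec h'"
    using a assms c by (simp add: bvec_mult M.m_assoc)
  finally show ?thesis using a assms by (simp add: carries_def)
qed

lemma normalizes_right:
  assumes "normalizes v" "k \<in> carrier G"
  shows "normalizes (v \<cdot> bvec k)"
proof -
  have "\<exists>h'. carries (v \<cdot> bvec k) g h'" if g: "g \<in> carrier G" for g
  proof -
    obtain h where h: "carries v g h" using assms(1) g by (auto simp: normalizes_iff)
    then have hc: "h \<in> carrier G" by (simp add: carries_def)
    have "carries (v \<cdot> bvec k) g (inv k \<otimes> h \<otimes> k)"
      by (rule carries_right[OF _ h]) (use assms hc normalizesD in \<open>auto simp flip: m_assoc\<close>)
    then show ?thesis by blast
  qed
  then show ?thesis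
    using assms unitary_mult unitary_bvec by (simp add: normalizes_iff)
qed

text \<open>
  A class function, regarded as a linear functional, is a trace; it does not distinguish \<open>v\<^sup>-\<^sup>1 g v\<close> from \<open>g\<close>. The
  class function used here is the indicator of the conjugacy class of \<open>g\<close>.
\<close>
lemma carries_class:
  assumes "normalizes v" "carries v g h"
  shows "\<exists>k\<in>carrier G. h \<otimes> k = k \<otimes> g"
proof -
  interpret M: monoid "ga G" by (rule monoid_ga)
  note V = normalizesD[OF assms(1)]
  note a = assms(2)[unfolded carries_def]
  have b: "bvec g \<in> carrier (ga G)" "bvec h \<in> carrier (ga G)" using a bvec_closed by auto
  define c :: "'a \<Rightarrow> complex" where "c x = of_bool (\<exists>k\<in>carrier G. x \<otimes> k = k \<otimes> g)" for x
  have cc: "c (x \<otimes> y) = c (y \<otimes> x)" if "x \<in> carrier G" "y \<in> carrier G" for x y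
  proof -
    have "\<exists>k\<in>carrier G. (y \<otimes> x) \<otimes> k = k \<otimes> g" if xy: "x \<in> carrier G" "y \<in> carrier G"
      and k: "k \<in> carrier G" "(x \<otimes> y) \<otimes> k = k \<otimes> g" for x y k
    proof (rule bexI[of _ "y \<otimes> k"])
      show "y \<otimes> x \<otimes> (y \<otimes> k) = y \<otimes> k \<otimes> g" using xy k a by (metis m_assoc m_closed)
    qed (use xy k in auto)
    then have "(\<exists>k\<in>carrier G. (x \<otimes> y) \<otimes> k = k \<otimes> g) = (\<exists>k\<in>carrier G. (y \<otimes> x) \<otimes> k = k \<otimes> g)"
      using that by blast
    then show ?thesis by (simp add: c_def)
  qed
  have tr: "ev G (x \<cdot> y) c = ev G (y \<cdot> x) c" for x y
  proof -
    have "ev G (x \<cdot> y) c = ev G x (\<lambda>a. ev G y (\<lambda>b. c (b \<otimes> a)))"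
      unfolding ev_mult by (intro ev_cong) (auto simp: cc)
    also have "\<dots> = ev G (y \<cdot> x) c" unfolding ev_mult by (rule ev_swap)
    finally show ?thesis .
  qed
  have "bvec h = inv\<^bsub>ga G\<^esub> v \<cdot> (bvec g \<cdot> v)"
    using a V b by (simp flip: M.m_assoc)
  then have "c h = ev G (inv\<^bsub>ga G\<^esub> v \<cdot> (bvec g \<cdot> v)) c"
    using a by (metis ev_bvec finite_carrier)
  also have "\<dots> = ev G (bvec g) c"
    unfolding tr[of "inv\<^bsub>ga G\<^esub> v"] using b V by (simp add: M.m_assoc)
  also have "\<dots> = 1" using a by (auto simp: ev_bvec c_def)
  finally show ?thesis by (auto simp: c_def split: if_splits)
qed

lemma carries_div:
  assumes "alg_unitary (group_algebra G) v" "alg_unitary (group_algebra G) v'" "carries v g h" "carries v' g h"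
  shows "carries (v \<cdot> adj G v') g g"
proof -
  interpret M: monoid "ga G" by (rule monoid_ga)
  note a = assms(3,4)[unfolded carries_def]
  have c: "bvec g \<in> carrier (ga G)" "bvec h \<in> carrier (ga G)" "v \<in> carrier (ga G)" "v' \<in> carrier (ga G)"
     "adj G v' \<in> carrier (ga G)"
    "v' \<cdot> adj G v' = \<one>\<^bsub>ga G\<^esub>" "adj G v' \<cdot> v' = \<one>\<^bsub>ga G\<^esub>"
    using a assms bvec_closed adj_closed by (auto simp: unitary_iff)
  have "bvec h \<cdot> adj G v' = adj G v' \<cdot> (v' \<cdot> bvec h) \<cdot> adj G v'"
    using c by (simp flip: M.m_assoc)
  also have "\<dots> = adj G v' \<cdot> (bvec g \<cdot> v') \<cdot> adj G v'" using a by simp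
  also have "\<dots> = adj G v' \<cdot> bvec g" using c by (simp add: M.m_assoc)
  finally have *: "bvec h \<cdot> adj G v' = adj G v' \<cdot> bvec g" .
  have "bvec g \<cdot> (v \<cdot> adj G v') = v \<cdot> (bvec h \<cdot> adj G v')"
    using a c by (metis M.m_assoc)
  also have "\<dots> = v \<cdot> adj G v' \<cdot> bvec g" using c by (simp add: * M.m_assoc)
  finally show ?thesis using a by (simp add: carries_def)
qed

lemma central_if_carries:
  assumes "alg_unitary (group_algebra G) w" "\<And>g. g \<in> carrier G \<Longrightarrow> carries w g g"
  shows "w \<in> A1u (group_algebra G)"
proof -
  have "w \<cdot> bvec g = bvec g \<cdot> w" if "g \<in> carrier G" for g
    using assms(2)[OF that] by (simp add: carries_def)
  then show ?thesis
    unfolding A1u_iff using assms(1) commute_all by blast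
qed

end

section \<open>Coordinates on the holomorph of the cyclic group of order 8\<close>

abbreviation zmult (infixl "\<otimes>\<^sub>Z" 70) where "x \<otimes>\<^sub>Z y \<equiv> x \<otimes>\<^bsub>Z8_Aut\<^esub> y"
abbreviation zconv (infixl "\<cdot>\<^sub>Z" 70) where "x \<cdot>\<^sub>Z y \<equiv> x \<otimes>\<^bsub>ga Z8_Aut\<^esub> y"

text \<open>
  The pair of \<open>n\<close> and the automorphism \<open>i \<mapsto> k i\<close>. In these coordinates \<open>u = el 1 1\<close>, \<open>s = el 0 3\<close> and
  \<open>t = el 0 5\<close>. Arbitrary integers are admitted as coordinates so that products need no reduction modulo 8.
\<close>
definition el :: "int \<Rightarrow> int \<Rightarrow> int \<times> (int \<Rightarrow> int)" where
  "el n k = (n mod 8, \<lambda>i\<in>{0..<8}. (k * i) mod 8)"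

lemma el_eq_iff: "el n k = el m l \<longleftrightarrow> n mod 8 = m mod 8 \<and> k mod 8 = l mod 8"
proof
  assume *: "el n k = el m l"
  then have "fst (el n k) = fst (el m l)" "snd (el n k) 1 = snd (el m l) 1" by simp_all
  then show "n mod 8 = m mod 8 \<and> k mod 8 = l mod 8" by (simp add: el_def)
next
  assume *: "n mod 8 = m mod 8 \<and> k mod 8 = l mod 8"
  then have "(k * i) mod 8 = (l * i) mod 8" for i by (metis mod_mult_left_eq)
  with * show "el n k = el m l" by (simp add: el_def)
qed

lemma fst_el: "fst (el n k) = n mod 8" and snd_el: "snd (el n k) 1 = k mod 8"
  by (simp_all add: el_def)

lemma interval8: "{0..<8::int} = {0, 1, 2, 3, 4, 5, 6, 7}"
  by auto

lemma odd_square_mod8: "odd (k :: int) \<Longrightarrow> k * k mod 8 = 1"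
proof -
  assume "odd k"
  then have "k mod 8 \<in> {1, 3, 5, 7}" by (simp, presburger)
  then have "(k mod 8) * (k mod 8) mod 8 = 1" by (elim insertE emptyE) (simp_all only:, simp_all)
  then show ?thesis by (simp only: mod_mult_eq)
qed

lemma mult_automorphism:
  assumes "odd k"
  shows "(\<lambda>i\<in>{0..<8::int}. (k * i) mod 8) \<in> auto (integer_mod_group 8)"
proof -
  let ?f = "\<lambda>i\<in>{0..<8::int}. (k * i) mod 8"
  have "k * ((k * i) mod 8) mod 8 = i" if "i \<in> {0..<8}" for i
  proof -
    have "k * ((k * i) mod 8) mod 8 = (k * k mod 8) * i mod 8"
      by (simp only: mod_mult_right_eq mod_mult_left_eq mult.assoc)
    then show ?thesis using odd_square_mod8[OF assms] that by simp
  qed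
  then have "bij_betw ?f {0..<8} {0..<8}"
    by (intro bij_betw_byWitness[of _ ?f]) auto
  moreover have "?f \<in> hom (integer_mod_group 8) (integer_mod_group 8)"
  proof -
    have "k * ((i + j) mod 8) mod 8 = (k * i mod 8 + k * j mod 8) mod 8" for i j
      by (simp only: mod_mult_right_eq distrib_left mod_add_eq)
    then show ?thesis by (auto simp: hom_def carrier_integer_mod_group)
  qed
  ultimately show ?thesis
    by (auto simp: auto_def Bij_def carrier_integer_mod_group)
qed

text \<open>
  An endomorphism is multiplication by its value \<open>k\<close> at 1. If \<open>k\<close> were even, 4 would be mapped to 0.
\<close>
lemma automorphism_mult:
  assumes "\<alpha> \<in> auto (integer_mod_group 8)"
  shows "\<exists>k\<in>{1, 3, 5, 7}. \<alpha> = (\<lambda>i\<in>{0..<8::int}. (k * i) mod 8)"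
proof -
  have ext: "\<alpha> \<in> extensional {0..<8}" and bij: "bij_betw \<alpha> {0..<8} {0..<8}"
    and hom: "\<And>i j. i \<in> {0..<8} \<Longrightarrow> j \<in> {0..<8} \<Longrightarrow> \<alpha> ((i + j) mod 8) = (\<alpha> i + \<alpha> j) mod 8"
    using assms hom_mult[of \<alpha> "integer_mod_group 8" "integer_mod_group 8"]
    by (simp_all add: auto_def Bij_def carrier_integer_mod_group)
  have r: "\<alpha> i \<in> {0..<8}" if "i \<in> {0..<8}" for i
    using bij_betwE[OF bij] that by blast
  define k where "k = \<alpha> 1"
  have lin: "\<alpha> (int n) = (k * int n) mod 8" if "n < 8" for n
    using that
  proof (induction n)
    case 0
    have double: "a = 0" if "(a + a) mod 8 = a" "0 \<le> a" "a < 8" for a :: int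
      using that by presburger
    have "(\<alpha> 0 + \<alpha> 0) mod 8 = \<alpha> ((0 + 0) mod 8)" by (rule hom[symmetric]) auto
    then have "(\<alpha> 0 + \<alpha> 0) mod 8 = \<alpha> 0" by (simp only: add_0 mod_0)
    then have "\<alpha> 0 = 0" by (rule double) (use r[of 0] in auto)
    then show ?case by simp
  next
    case (Suc n)
    have "\<alpha> (int (Suc n)) = \<alpha> ((int n + 1) mod 8)" using Suc.prems by (simp add: add.commute)
    also have "\<dots> = (\<alpha> (int n) + \<alpha> 1) mod 8" using Suc.prems by (intro hom) auto
    also have "\<dots> = ((k * int n) mod 8 + k) mod 8" using Suc by (simp only: k_def)
    also have "\<dots> = (k * int n + k) mod 8" by (rule mod_add_left_eq)
    finally show ?case by (simp add: distrib_left add.commute)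
  qed
  have "\<alpha> = (\<lambda>i\<in>{0..<8}. (k * i) mod 8)"
  proof
    fix i show "\<alpha> i = (\<lambda>i\<in>{0..<8}. (k * i) mod 8) i"
    proof (cases "i \<in> {0..<8}")
      case True
      then have "nat i < 8" "int (nat i) = i" by auto
      then show ?thesis using lin[of "nat i"] True by simp
    next
      case False
      then show ?thesis using extensional_arb[OF ext False] by (simp only: restrict_def False if_False)
    qed
  qed
  moreover have "k \<in> {1, 3, 5, 7}"
  proof -
    have "k \<in> {0..<8}" using r by (simp add: k_def)
    moreover have "odd k"
    proof
      assume "even k"
      then have "(k * 4) mod 8 = 0" by presburger
      then have "\<alpha> 4 = \<alpha> 0" using lin[of 4] lin[of 0] by simp
      then have "(4 :: int) = 0" by (rule inj_onD[OF bij_betw_imp_inj_on[OF bij]]) auto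
      then show False by simp
    qed
    ultimately show ?thesis unfolding interval8 by auto
  qed
  ultimately show ?thesis by blast
qed

lemma el_closed: "odd k \<Longrightarrow> el n k \<in> carrier Z8_Aut"
  by (simp add: Z8_Aut_def semidirect_def AutoGroup_def BijGroup_def el_def mult_automorphism
      carrier_integer_mod_group)

lemma carrier_Z8_Aut:
  assumes "x \<in> carrier Z8_Aut"
  obtains n k where "n \<in> {0, 1, 2, 3, 4, 5, 6, 7}" "k \<in> {1, 3, 5, 7}" "x = el n k"
proof -
  obtain n \<alpha> where x: "x = (n, \<alpha>)" "n \<in> {0..<8}" "\<alpha> \<in> auto (integer_mod_group 8)"
    using assms by (auto simp: Z8_Aut_def semidirect_def AutoGroup_def carrier_integer_mod_group)
  from automorphism_mult[OF x(3)] obtain k where k: "k \<in> {1, 3, 5, 7}" "\<alpha> = (\<lambda>i\<in>{0..<8}. (k * i) mod 8)"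
    by blast
  have "x = el n k" using x(1,2) k(2) by (simp add: el_def)
  then show ?thesis by (rule that[OF x(2)[unfolded interval8] k(1)])
qed

lemma el_mult:
  assumes "odd k" "odd l"
  shows "el n k \<otimes>\<^sub>Z el m l = el (n + k * m) (k * l)"
proof -
  let ?f = "\<lambda>k. \<lambda>i\<in>{0..<8::int}. (k * i) mod 8"
  have *: "k * (l * i mod 8) mod 8 = k * l * i mod 8" for i
    by (simp only: mod_mult_right_eq mult.assoc)
  have comp: "compose {0..<8} (?f k) (?f l) = ?f (k * l)"
  proof
    fix i :: int
    have "l * i mod 8 \<in> {0..<8}" by simp
    then show "compose {0..<8} (?f k) (?f l) i = ?f (k * l) i"
      by (simp only: compose_def restrict_def * if_True split: if_split) blast
  qed
  have bij: "?f k \<in> Bij {0..<8}" "?f l \<in> Bij {0..<8}"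
    using mult_automorphism[OF assms(1)] mult_automorphism[OF assms(2)]
    by (simp_all only: auto_def carrier_integer_mod_group Int_iff) simp_all
  have "el n k \<otimes>\<^sub>Z el m l
    = ((n mod 8 + k * (m mod 8) mod 8) mod 8, compose {0..<8} (?f k) (?f l))"
    using bij by (simp add: Z8_Aut_def semidirect_def AutoGroup_def BijGroup_def el_def
        carrier_integer_mod_group del: mod_simps)
  also have "\<dots> = el (n + k * m) (k * l)"
    by (simp only: comp el_def mod_add_eq mod_mult_right_eq)
  finally show ?thesis .
qed

lemma el_one: "\<one>\<^bsub>Z8_Aut\<^esub> = el 0 1"
  by (auto simp: Z8_Aut_def semidirect_def AutoGroup_def BijGroup_def el_def
      carrier_integer_mod_group fun_eq_iff)

interpretation Z: finite_group Z8_Aut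
  by (simp add: finite_group_def finite_group_axioms_def group_Z8_Aut finite_Z8_Aut)

lemma el_inv:
  assumes "odd k" shows "inv\<^bsub>Z8_Aut\<^esub> (el n k) = el (- k * n) k"
proof (rule Z.inv_equality)
  have "el (- k * n) k \<otimes>\<^sub>Z el n k = el (- k * n + k * n) (k * k)"
    by (rule el_mult) (rule assms)+
  also have "\<dots> = el 0 1"
    unfolding el_eq_iff using odd_square_mod8[OF assms] by simp
  finally show "el (- k * n) k \<otimes>\<^sub>Z el n k = \<one>\<^bsub>Z8_Aut\<^esub>" by (simp only: el_one)
qed (rule el_closed, rule assms)+

text \<open>
  The required signs are the parity of \<open>n\<close> and two characters of the units modulo 8, with kernels \<open>{1, 7}\<close> and
  \<open>{1, 5}\<close>. Together they detect every element outside \<open>{1, u\<^sup>2, u\<^sup>4, u\<^sup>6}\<close>.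
\<close>
interpretation Z: central_square_group Z8_Aut "el 2 1" "el 4 1"
proof
  show "el 2 1 \<in> carrier Z8_Aut" by (simp add: el_closed)
  show "el 4 1 = el 2 1 \<otimes>\<^sub>Z el 2 1" by (simp add: el_mult)
  show "el 4 1 \<otimes>\<^sub>Z el 4 1 = \<one>\<^bsub>Z8_Aut\<^esub>" by (simp add: el_mult el_one el_eq_iff)
  show "el 4 1 \<noteq> \<one>\<^bsub>Z8_Aut\<^esub>" by (simp add: el_one el_eq_iff)
  show "\<exists>y\<in>carrier Z8_Aut. el 2 1 = y \<otimes>\<^sub>Z y"
    by (rule bexI[of _ "el 1 1"]) (simp_all add: el_mult el_closed)
next
  fix x assume "x \<in> carrier Z8_Aut"
  then show "el 4 1 \<otimes>\<^sub>Z x = x \<otimes>\<^sub>Z el 4 1"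
    by (elim carrier_Z8_Aut) (auto simp: el_mult el_eq_iff)
next
  fix x assume x: "x \<in> carrier Z8_Aut" "x \<noteq> \<one>\<^bsub>Z8_Aut\<^esub>" "x \<noteq> el 4 1"
  obtain n k where nk: "n \<in> {0, 1, 2, 3, 4, 5, 6, 7}" "k \<in> {1, 3, 5, 7}" "x = el n k"
    using x(1) by (rule carrier_Z8_Aut)
  \<comment> \<open>Odd powers of \<open>u\<close> are moved by \<open>t\<close>, the elements \<open>u\<^sup>2\<close> and \<open>u\<^sup>6\<close> by \<open>s\<close>. For other \<open>k\<close>, conjugation by
    \<open>u\<^sup>m\<close> adds \<open>(1 - k) m\<close> to \<open>n\<close>, which is 4 modulo 8 for \<open>m = 1\<close> or \<open>m = 2\<close>.\<close>
  define g where "g = (if k = 1 then if odd n then el 0 5 else el 0 3 else if k = 5 then el 1 1 else el 2 1)"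
  have g: "g \<in> carrier Z8_Aut" by (simp add: g_def el_closed)
  have "k \<noteq> 1 \<or> n \<noteq> 0 \<and> n \<noteq> 4" using x(2,3) by (auto simp: nk(3) el_one)
  then have gx: "g \<otimes>\<^sub>Z x = el 4 1 \<otimes>\<^sub>Z x \<otimes>\<^sub>Z g"
    using nk(1,2) unfolding nk(3) g_def
    by (elim insertE emptyE) (simp_all add: el_mult el_eq_iff)
  have "g \<otimes>\<^sub>Z x \<otimes>\<^sub>Z inv\<^bsub>Z8_Aut\<^esub> g = el 4 1 \<otimes>\<^sub>Z x"
    unfolding gx using g x(1) by (simp add: Z.m_assoc el_closed)
  with g show "\<exists>g\<in>carrier Z8_Aut. g \<otimes>\<^sub>Z x \<otimes>\<^sub>Z inv\<^bsub>Z8_Aut\<^esub> g = el 4 1 \<otimes>\<^sub>Z x" by blast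
next
  fix x assume x: "x \<in> carrier Z8_Aut" "x \<notin> {\<one>\<^bsub>Z8_Aut\<^esub>, el 2 1, el 4 1, el 4 1 \<otimes>\<^sub>Z el 2 1}"
  obtain n k where nk: "n \<in> {0, 1, 2, 3, 4, 5, 6, 7}" "k \<in> {1, 3, 5, 7}" "x = el n k"
    using x(1) by (rule carrier_Z8_Aut)
  define sgn_on :: "(int \<times> (int \<Rightarrow> int) \<Rightarrow> bool) \<Rightarrow> int \<times> (int \<Rightarrow> int) \<Rightarrow> complex"
    where "sgn_on P y = (if P y then -1 else 1)" for P y
  have hom: "sgn_on (\<lambda>y. odd (fst y)) (a \<otimes>\<^sub>Z b)
       = sgn_on (\<lambda>y. odd (fst y)) a * sgn_on (\<lambda>y. odd (fst y)) b"
    "sgn_on (\<lambda>y. snd y 1 \<in> {3, 5}) (a \<otimes>\<^sub>Z b)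
       = sgn_on (\<lambda>y. snd y 1 \<in> {3, 5}) a * sgn_on (\<lambda>y. snd y 1 \<in> {3, 5}) b"
    "sgn_on (\<lambda>y. snd y 1 \<in> {3, 7}) (a \<otimes>\<^sub>Z b)
       = sgn_on (\<lambda>y. snd y 1 \<in> {3, 7}) a * sgn_on (\<lambda>y. snd y 1 \<in> {3, 7}) b"
    if ab: "a \<in> carrier Z8_Aut" "b \<in> carrier Z8_Aut" for a b
  proof -
    obtain n k where a: "n \<in> {0, 1, 2, 3, 4, 5, 6, 7}" "k \<in> {1, 3, 5, 7}" "a = el n k"
      using ab(1) by (rule carrier_Z8_Aut)
    obtain m l where b: "m \<in> {0, 1, 2, 3, 4, 5, 6, 7}" "l \<in> {1, 3, 5, 7}" "b = el m l"
      using ab(2) by (rule carrier_Z8_Aut)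
    have o: "odd k" "odd l" using a(2) b(2) by auto
    have e: "even ((i::int) mod 8) = even i" for i by (simp add: dvd_mod_iff)
    have p: "odd (n + k * m) = (odd n \<noteq> odd m)" using o by simp
    show "sgn_on (\<lambda>y. odd (fst y)) (a \<otimes>\<^sub>Z b)
       = sgn_on (\<lambda>y. odd (fst y)) a * sgn_on (\<lambda>y. odd (fst y)) b"
      unfolding a(3) b(3) el_mult[OF o] sgn_on_def fst_el e p by simp
    show "sgn_on (\<lambda>y. snd y 1 \<in> {3, 5}) (a \<otimes>\<^sub>Z b)
       = sgn_on (\<lambda>y. snd y 1 \<in> {3, 5}) a * sgn_on (\<lambda>y. snd y 1 \<in> {3, 5}) b"
      "sgn_on (\<lambda>y. snd y 1 \<in> {3, 7}) (a \<otimes>\<^sub>Z b)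
       = sgn_on (\<lambda>y. snd y 1 \<in> {3, 7}) a * sgn_on (\<lambda>y. snd y 1 \<in> {3, 7}) b"
      unfolding a(3) b(3) el_mult[OF o] sgn_on_def snd_el
      using a(2) b(2) by (elim insertE emptyE; simp)+
  qed
  have val: "sgn_on P y \<in> {1, -1}" for P y by (simp add: sgn_on_def)
  have "sgn_on (\<lambda>y. odd (fst y)) x = -1 \<or> sgn_on (\<lambda>y. snd y 1 \<in> {3, 5}) x = -1 \<or>
      sgn_on (\<lambda>y. snd y 1 \<in> {3, 7}) x = -1"
  proof (cases "k = 1")
    case True
    then have "odd n" using nk(1) x(2) by (auto simp: nk(3) el_mult el_one)
    then show ?thesis using nk(1) by (auto simp: nk(3) fst_el snd_el sgn_on_def)
  next
    case False
    then show ?thesis using nk(2) by (auto simp: nk(3) fst_el snd_el sgn_on_def)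
  qed
  then show "\<exists>\<chi>. \<chi> x = - 1 \<and>
      (\<forall>a\<in>carrier Z8_Aut. \<forall>b\<in>carrier Z8_Aut. \<chi> (a \<otimes>\<^sub>Z b) = \<chi> a * \<chi> b) \<and>
      (\<forall>a\<in>carrier Z8_Aut. \<chi> a \<in> {1, -1 :: complex})"
  proof (elim disjE)
    assume "sgn_on (\<lambda>y. odd (fst y)) x = -1"
    then show ?thesis by (intro exI[of _ "sgn_on (\<lambda>y. odd (fst y))"] conjI ballI hom(1) val)
  next
    assume "sgn_on (\<lambda>y. snd y 1 \<in> {3, 5}) x = -1"
    then show ?thesis by (intro exI[of _ "sgn_on (\<lambda>y. snd y 1 \<in> {3, 5})"] conjI ballI hom(2) val)
  next
    assume "sgn_on (\<lambda>y. snd y 1 \<in> {3, 7}) x = -1"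
    then show ?thesis by (intro exI[of _ "sgn_on (\<lambda>y. snd y 1 \<in> {3, 7})"] conjI ballI hom(3) val)
  qed
qed

section \<open>Automorphisms that become inner in the group algebra\<close>

lemma Z8_Aut_generated:
  assumes "g \<in> carrier Z8_Aut"
    and one: "P (el 0 1)" and mult: "\<And>a b. a \<in> carrier Z8_Aut \<Longrightarrow> b \<in> carrier Z8_Aut \<Longrightarrow> P a \<Longrightarrow> P b \<Longrightarrow> P (a \<otimes>\<^sub>Z b)"
    and gens: "P (el 1 1)" "P (el 0 3)" "P (el 0 5)"
  shows "P g"
proof -
  obtain n k where nk: "n \<in> {0, 1, 2, 3, 4, 5, 6, 7}" "k \<in> {1, 3, 5, 7}" "g = el n k"
    using assms(1) by (rule carrier_Z8_Aut)
  have "P (el (int m) 1)" for m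
  proof (induction m)
    case (Suc m)
    have "P (el (int m) 1 \<otimes>\<^sub>Z el 1 1)" by (rule mult) (auto simp: Suc gens el_closed)
    then show ?case by (simp add: el_mult add.commute)
  qed (simp add: one)
  from this[of "nat n"] have n: "P (el n 1)" using nk(1) by auto
  have "P (el 0 3 \<otimes>\<^sub>Z el 0 5)" by (rule mult) (auto simp: gens el_closed)
  moreover have "el 0 15 = el 0 7" by (simp add: el_eq_iff)
  ultimately have k: "P (el 0 k)" using nk(2) one gens by (auto simp: el_mult)
  have o: "odd k" using nk(2) by auto
  have "P (el n 1 \<otimes>\<^sub>Z el 0 k)" by (rule mult) (auto simp: n k o el_closed)
  then show ?thesis using o by (simp add: el_mult nk(3))
qed

definition half_sqrt :: complex where
  "half_sqrt = of_real (1 / (2 * sqrt 2))"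

lemma half_sqrt_square: "half_sqrt * half_sqrt = 1 / 8" "half_sqrt * (half_sqrt * x) = x / 8"
proof -
  have "(1 / (2 * sqrt 2)) * (1 / (2 * sqrt 2)) = (1 / 8 :: real)" by simp
  then show *: "half_sqrt * half_sqrt = 1 / 8"
    unfolding half_sqrt_def of_real_mult[symmetric] by simp
  show "half_sqrt * (half_sqrt * x) = x / 8"
    using * by (simp flip: mult.assoc)
qed

text \<open>
  The element \<open>(1 + z)/2 + (u + u\<^sup>3)(1 - z)/(2\<surd>2)\<close>. On the part of the group algebra where \<open>z = 1\<close> it is the
  identity. Where \<open>z = -1\<close> it is a multiple of \<open>u + u\<^sup>3\<close>, which commutes with \<open>s\<close> and, since \<open>t u t\<^sup>-\<^sup>1 = z u\<close>,
  anticommutes with \<open>t\<close>; its adjoint there is \<open>-(u + u\<^sup>3)\<close>, and \<open>-(u + u\<^sup>3)\<^sup>2 = 2\<close> explains the factor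
  \<open>1/\<surd>2\<close>.
\<close>
definition outer_unitary :: "int \<times> (int \<Rightarrow> int) \<Rightarrow> complex" where
  "outer_unitary g = (bvec (el 0 1) g + bvec (el 4 1) g) / 2 +
     half_sqrt * (bvec (el 1 1) g + bvec (el 3 1) g - bvec (el 5 1) g - bvec (el 7 1) g)"

lemma ev_outer_unitary:
  "ev Z8_Aut outer_unitary f = (f (el 0 1) + f (el 4 1)) / 2 +
     half_sqrt * (f (el 1 1) + f (el 3 1) - f (el 5 1) - f (el 7 1))"
proof -
  have b: "(\<Sum>x\<in>carrier Z8_Aut. bvec (el n 1) x * f x) = f (el n 1)" for n
    by (simp add: sum_bvec el_closed)
  have "ev Z8_Aut outer_unitary f = (\<Sum>x\<in>carrier Z8_Aut. (bvec (el 0 1) x * f x + bvec (el 4 1) x * f x) / 2 +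
     half_sqrt * (bvec (el 1 1) x * f x + bvec (el 3 1) x * f x - bvec (el 5 1) x * f x - bvec (el 7 1) x * f x))"
    unfolding ev_def outer_unitary_def by (intro sum.cong refl) (simp add: field_simps)
  also have "\<dots> = (f (el 0 1) + f (el 4 1)) / 2 +
     half_sqrt * (f (el 1 1) + f (el 3 1) - f (el 5 1) - f (el 7 1))"
    unfolding sum.distrib sum_divide_distrib[symmetric] sum_distrib_left[symmetric] sum_subtractf b ..
  finally show ?thesis .
qed

lemma outer_unitary_closed: "outer_unitary \<in> carrier (ga Z8_Aut)"
proof -
  have "bvec (el n 1) g = 0" if "g \<notin> carrier Z8_Aut" for n g
    using that el_closed[of 1 n] by (auto simp: bvec_def)
  then show ?thesis by (simp add: ga_sel outer_unitary_def)
qed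

lemma el_mod: "el n k = el (n mod 8) k"
  by (simp only: el_eq_iff mod_mod_trivial)

text \<open>The premise keeps the rewriting of first coordinates from looping.\<close>

lemma el_reduce: "8 \<le> (numeral n :: int) \<Longrightarrow> el (numeral n) k = el (numeral n mod 8) k"
  by (rule el_mod)

lemma el_reduce_neg: "el (- numeral n) k = el (- numeral n mod 8) k" "el (- 1) k = el (- 1 mod 8) k"
  by (rule el_mod)+

lemma outer_unitary_unitary: "alg_unitary (group_algebra Z8_Aut) outer_unitary"
proof -
  have "cnj (outer_unitary g) = outer_unitary g" for g
    by (simp add: outer_unitary_def bvec_def half_sqrt_def)
  then have a: "ev Z8_Aut (adj Z8_Aut outer_unitary) f = ev Z8_Aut outer_unitary (\<lambda>g. f (inv\<^bsub>Z8_Aut\<^esub> g))" for f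
    by (simp add: Z.ev_adj)
  show ?thesis
    unfolding Z.unitary_iff
  proof (intro conjI)
    show "adj Z8_Aut outer_unitary \<cdot>\<^sub>Z outer_unitary = \<one>\<^bsub>ga Z8_Aut\<^esub>"
      by (rule ga_eqI[where G = Z8_Aut])
        (simp_all add: Z.ga_closed monoid.one_closed[OF Z.monoid_ga] Z.ev_mult a ev_outer_unitary el_inv el_mult ga_sel(2)
          ev_bvec el_one el_closed el_reduce el_reduce_neg algebra_simps add_divide_distrib half_sqrt_square Z.bvec_closed)
    show "outer_unitary \<cdot>\<^sub>Z adj Z8_Aut outer_unitary = \<one>\<^bsub>ga Z8_Aut\<^esub>"
      by (rule ga_eqI[where G = Z8_Aut])
        (simp_all add: Z.ga_closed monoid.one_closed[OF Z.monoid_ga] Z.ev_mult a ev_outer_unitary el_inv el_mult ga_sel(2)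
          ev_bvec el_one el_closed el_reduce el_reduce_neg algebra_simps add_divide_distrib half_sqrt_square Z.bvec_closed)
  qed (rule outer_unitary_closed)
qed

lemma outer_unitary_carries:
  "Z.carries outer_unitary (el 1 1) (el 1 1)" "Z.carries outer_unitary (el 0 3) (el 0 3)" "Z.carries outer_unitary (el 0 5) (el 4 5)"
  unfolding Z.carries_def
  by (intro conjI el_closed ga_eqI[where G = Z8_Aut];
      simp add: Z.ga_closed Z.ev_mult ev_outer_unitary ev_bvec el_closed el_mult el_reduce)+

lemma outer_unitary_normalizes: "Z.normalizes outer_unitary"
  unfolding Z.normalizes_iff
proof (intro conjI ballI)
  fix g assume "g \<in> carrier Z8_Aut"
  then show "\<exists>h. Z.carries outer_unitary g h"
  proof (rule Z8_Aut_generated)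
    show "\<exists>h. Z.carries outer_unitary (el 0 1) h" using Z.carries_one[OF outer_unitary_closed] unfolding el_one by blast
  qed (use outer_unitary_carries Z.carries_mult[OF outer_unitary_closed] in blast)+
qed (rule outer_unitary_unitary)

lemma central_Z8_Aut:
  assumes "alg_unitary (group_algebra Z8_Aut) w"
    "Z.carries w (el 1 1) (el 1 1)" "Z.carries w (el 0 3) (el 0 3)" "Z.carries w (el 0 5) (el 0 5)"
  shows "w \<in> A1u (group_algebra Z8_Aut)"
proof (rule Z.central_if_carries[OF assms(1)])
  have w: "w \<in> carrier (ga Z8_Aut)" using assms(1) by (simp add: Z.unitary_iff)
  fix g assume "g \<in> carrier Z8_Aut"
  then show "Z.carries w g g"
  proof (rule Z8_Aut_generated)
    show "Z.carries w (el 0 1) (el 0 1)" using Z.carries_one[OF w] by (simp add: el_one)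
  qed (use assms Z.carries_mult[OF w] in blast)+
qed

text \<open>
  Otherwise conjugation by \<open>h\<close> would fix \<open>u\<close> and \<open>s\<close> and send \<open>t\<close> to \<open>z t\<close>. Elements commuting with \<open>u\<close> and \<open>s\<close>
  are powers of \<open>u\<^sup>4\<close>, which commute with \<open>t\<close>.
\<close>
lemma outer_unitary_outer:
  assumes "w \<in> A1u (group_algebra Z8_Aut)" "h \<in> carrier Z8_Aut"
  shows "outer_unitary \<noteq> w \<cdot>\<^sub>Z bvec h"
proof
  assume outer_unitary: "outer_unitary = w \<cdot>\<^sub>Z bvec h"
  interpret M: monoid "ga Z8_Aut" by (rule Z.monoid_ga)
  have w: "w \<in> carrier (ga Z8_Aut)" "w \<in> Units (ga Z8_Aut)"
    using Z.normalizesD[OF Z.A1u_normalizes[OF assms(1)]] by auto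
  have *: "g \<otimes>\<^sub>Z h = h \<otimes>\<^sub>Z g'" if c: "Z.carries outer_unitary g g'" for g g'
  proof -
    have g: "g \<in> carrier Z8_Aut" "g' \<in> carrier Z8_Aut"
      "bvec g \<cdot>\<^sub>Z (w \<cdot>\<^sub>Z bvec h) = w \<cdot>\<^sub>Z bvec h \<cdot>\<^sub>Z bvec g'"
      using c by (auto simp: Z.carries_def outer_unitary)
    have b: "bvec g \<in> carrier (ga Z8_Aut)" "bvec g' \<in> carrier (ga Z8_Aut)" "bvec h \<in> carrier (ga Z8_Aut)"
      using g assms(2) Z.bvec_closed by auto
    have "bvec g \<cdot>\<^sub>Z w = w \<cdot>\<^sub>Z bvec g"
    proof -
      have "\<forall>y\<in>carrier (ga Z8_Aut). w \<cdot>\<^sub>Z y = y \<cdot>\<^sub>Z w"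
        using assms(1) unfolding Z.A1u_iff by blast
      from bspec[OF this b(1)] show ?thesis by (rule sym)
    qed
    then have "w \<cdot>\<^sub>Z (bvec g \<cdot>\<^sub>Z bvec h) = w \<cdot>\<^sub>Z (bvec h \<cdot>\<^sub>Z bvec g')"
      using g(3) b w by (metis M.m_assoc)
    then have "bvec (g \<otimes>\<^sub>Z h) = bvec (h \<otimes>\<^sub>Z g')"
      using w b g assms(2) by (simp add: Z.bvec_mult M.Units_l_cancel Z.bvec_closed)
    from fun_cong[OF this, of "g \<otimes>\<^sub>Z h"] show ?thesis by (auto simp: bvec_def)
  qed
  obtain n k where nk: "n \<in> {0, 1, 2, 3, 4, 5, 6, 7}" "k \<in> {1, 3, 5, 7}" "h = el n k"
    using assms(2) by (rule carrier_Z8_Aut)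
  have o: "odd k" using nk(2) by auto
  have "(1 + n) mod 8 = (n + k) mod 8" "3 * n mod 8 = n mod 8" "5 * n mod 8 = (n + k * 4) mod 8"
    using *[OF outer_unitary_carries(1)] *[OF outer_unitary_carries(2)] *[OF outer_unitary_carries(3)] o
    by (simp_all add: nk(3) el_mult el_eq_iff)
  then show False using nk(1,2) by (elim insertE emptyE) simp_all
qed

text \<open>
  Since \<open>v\<close> preserves conjugacy classes, a right factor from the group makes it commute with \<open>u\<close>. The conjugates of
  \<open>s\<close> are already conjugate to it by powers of \<open>u\<close>, so a second factor makes it commute with \<open>s\<close> as well. As
  \<open>t\<close> is conjugate only to itself and \<open>z t\<close>, two cases remain: either the unitary obtained is central, or it
  becomes central after division by \<open>outer_unitary\<close>.
\<close>
lemma normalizers_Z8_Aut: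
  assumes v: "Z.normalizes v"
  shows "\<exists>w\<in>A1u (group_algebra Z8_Aut). \<exists>h\<in>carrier Z8_Aut.
    v = w \<cdot>\<^sub>Z bvec h \<or> v = w \<cdot>\<^sub>Z outer_unitary \<cdot>\<^sub>Z bvec h"
proof -
  interpret M: monoid "ga Z8_Aut" by (rule Z.monoid_ga)
  have ex: "\<exists>h k. Z.carries v' g h \<and> h \<in> carrier Z8_Aut \<and> k \<in> carrier Z8_Aut \<and> h \<otimes>\<^sub>Z k = k \<otimes>\<^sub>Z g"
    if v': "Z.normalizes v'" "g \<in> carrier Z8_Aut" for v' g
  proof -
    obtain h where h: "Z.carries v' g h" using v' by (auto simp: Z.normalizes_iff)
    moreover have "h \<in> carrier Z8_Aut" using h by (simp add: Z.carries_def)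
    ultimately show ?thesis using Z.carries_class[OF v'(1) h] by blast
  qed
  have el: "el n 1 \<in> carrier Z8_Aut" "el 0 3 \<in> carrier Z8_Aut" "el 0 5 \<in> carrier Z8_Aut" "el 4 5 \<in> carrier Z8_Aut" for n
    by (simp_all add: el_closed)
  obtain hu k where u: "Z.carries v (el 1 1) hu" "hu \<in> carrier Z8_Aut" "k \<in> carrier Z8_Aut"
      "hu \<otimes>\<^sub>Z k = k \<otimes>\<^sub>Z el 1 1"
    using ex[OF v el(1)] by blast
  define v1 where "v1 = v \<cdot>\<^sub>Z bvec k"
  have v1: "Z.normalizes v1" "Z.carries v1 (el 1 1) (el 1 1)"
    unfolding v1_def using Z.normalizes_right[OF v u(3)]
      Z.carries_right[OF Z.normalizesD(3)[OF v] u(1) u(3) el(1) u(4)] by auto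
  obtain hs j where s: "Z.carries v1 (el 0 3) hs" "hs \<in> carrier Z8_Aut" "j \<in> carrier Z8_Aut"
      "hs \<otimes>\<^sub>Z j = j \<otimes>\<^sub>Z el 0 3"
    using ex[OF v1(1) el(2)] by blast
  obtain n l where j: "n \<in> {0, 1, 2, 3, 4, 5, 6, 7}" "l \<in> {1, 3, 5, 7}" "j = el n l"
    using s(3) by (rule carrier_Z8_Aut)
  have ol: "odd l" using j(2) by auto
  have cl: "el 0 l \<in> carrier Z8_Aut" using ol by (rule el_closed)
  have "hs \<otimes>\<^sub>Z el n 1 \<otimes>\<^sub>Z el 0 l = el n 1 \<otimes>\<^sub>Z el 0 3 \<otimes>\<^sub>Z el 0 l"
  proof -
    have "hs \<otimes>\<^sub>Z el n 1 \<otimes>\<^sub>Z el 0 l = hs \<otimes>\<^sub>Z el n l"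
      using s(2) el(1) cl ol by (simp add: Z.m_assoc) (simp add: el_mult)
    also have "\<dots> = el n l \<otimes>\<^sub>Z el 0 3" using s(4) by (simp only: j(3))
    also have "\<dots> = el n 1 \<otimes>\<^sub>Z el 0 3 \<otimes>\<^sub>Z el 0 l"
      using ol by (simp add: el_mult mult.commute)
    finally show ?thesis .
  qed
  then have hs: "hs \<otimes>\<^sub>Z el n 1 = el n 1 \<otimes>\<^sub>Z el 0 3"
    using s(2) el cl by (simp only: Z.right_cancel Z.m_closed)
  define v2 where "v2 = v1 \<cdot>\<^sub>Z bvec (el n 1)"
  have comm: "el 1 1 \<otimes>\<^sub>Z el n 1 = el n 1 \<otimes>\<^sub>Z el 1 1"
    by (simp add: el_mult add.commute)
  have v2: "Z.normalizes v2" "Z.carries v2 (el 0 3) (el 0 3)" "Z.carries v2 (el 1 1) (el 1 1)"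
    unfolding v2_def
    using Z.normalizes_right[OF v1(1) el(1)]
      Z.carries_right[OF Z.normalizesD(3)[OF v1(1)] s(1) el(1) el(2) hs]
      Z.carries_right[OF Z.normalizesD(3)[OF v1(1)] v1(2) el(1) el(1) comm] by auto
  obtain ht i where t: "Z.carries v2 (el 0 5) ht" "ht \<in> carrier Z8_Aut" "i \<in> carrier Z8_Aut"
      "ht \<otimes>\<^sub>Z i = i \<otimes>\<^sub>Z el 0 5"
    using ex[OF v2(1) el(3)] by blast
  have ht: "ht = el 0 5 \<or> ht = el 4 5"
  proof -
    obtain m q where i: "m \<in> {0, 1, 2, 3, 4, 5, 6, 7}" "q \<in> {1, 3, 5, 7}" "i = el m q"
      using t(3) by (rule carrier_Z8_Aut)
    have oq: "odd q" using i(2) by auto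
    have "i \<otimes>\<^sub>Z el 0 5 = el 0 5 \<otimes>\<^sub>Z i \<or> i \<otimes>\<^sub>Z el 0 5 = el 4 5 \<otimes>\<^sub>Z i"
      using i(1) oq by (auto simp: i(3) el_mult el_eq_iff mult.commute)
    then show ?thesis
      unfolding t(4)[symmetric] using t(2,3) el by (simp only: Z.right_cancel)
  qed
  define k' where "k' = k \<otimes>\<^sub>Z el n 1"
  have k': "k' \<in> carrier Z8_Aut" "inv\<^bsub>Z8_Aut\<^esub> k' \<in> carrier Z8_Aut" using u(3) el by (simp_all add: k'_def)
  have vc: "v \<in> carrier (ga Z8_Aut)" using v by (rule Z.normalizesD(3))
  have b: "bvec k' \<in> carrier (ga Z8_Aut)" "bvec (inv\<^bsub>Z8_Aut\<^esub> k') \<in> carrier (ga Z8_Aut)"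
    "bvec k \<in> carrier (ga Z8_Aut)" "bvec (el n 1) \<in> carrier (ga Z8_Aut)"
    using k' u(3) el Z.bvec_closed by auto
  have v2_eq: "v2 = v \<cdot>\<^sub>Z bvec k'"
    using vc b u(3) el by (simp add: v2_def v1_def k'_def M.m_assoc Z.bvec_mult)
  have vv2: "v = v2 \<cdot>\<^sub>Z bvec (inv\<^bsub>Z8_Aut\<^esub> k')"
  proof -
    have "bvec k' \<cdot>\<^sub>Z bvec (inv\<^bsub>Z8_Aut\<^esub> k') = \<one>\<^bsub>ga Z8_Aut\<^esub>"
      using k' by (simp add: Z.bvec_mult ga_sel(2))
    then show ?thesis using vc b v2_eq by (simp add: M.m_assoc)
  qed
  note V2 = Z.normalizesD[OF v2(1)]
  from ht show ?thesis
  proof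
    assume "ht = el 0 5"
    then have "v2 \<in> A1u (group_algebra Z8_Aut)"
      using central_Z8_Aut V2 v2 t(1) by blast
    then show ?thesis using vv2 k' by blast
  next
    assume ht: "ht = el 4 5"
    define w where "w = v2 \<cdot>\<^sub>Z adj Z8_Aut outer_unitary"
    have "w \<in> A1u (group_algebra Z8_Aut)"
      unfolding w_def using V2 v2 t(1) ht outer_unitary_unitary outer_unitary_carries
      by (intro central_Z8_Aut Z.unitary_mult Z.unitary_adj Z.carries_div) auto
    moreover have "v2 = w \<cdot>\<^sub>Z outer_unitary"
    proof -
      have "adj Z8_Aut outer_unitary \<cdot>\<^sub>Z outer_unitary = \<one>\<^bsub>ga Z8_Aut\<^esub>"
        using outer_unitary_unitary unfolding Z.unitary_iff by blast
      then show ?thesis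
        using V2 outer_unitary_closed Z.adj_closed[of outer_unitary] by (simp add: w_def M.m_assoc)
    qed
    ultimately show ?thesis using vv2 k' by blast
  qed
qed

theorem theorem3p26:
  shows "H2_uinv (group_algebra Z8_Aut) \<cong> integer_mod_group 2"
proof (rule Z.H2_uinv_two_classes[OF _ outer_unitary_normalizes normalizers_Z8_Aut outer_unitary_outer])
  fix \<Omega> assume \<Omega>: "\<Omega> \<in> Z.cocycles"
  interpret T: twisted_square_group Z8_Aut "el 2 1" "el 4 1" \<Omega>
    by unfold_locales (rule \<Omega>)
  show "\<exists>v. Z.normalizes v \<and> \<Omega> = Z.bd v"
    using T.cocycle_is_coboundary by blast
qed

end
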